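(* Let $d\mu$ be a regular $l\times l$ matrix-valued measure with $E=\operatorname{supp}(d\mu)$, where $E$ has positive logarithmic capacity. Let $d\nu_n$ be the zero counting measure for $\det(p_n^L(x))$, that is, if $\{x_j^{(n)}\}_{j=1}^{nl}$ are the zeros of this determinant (counting degenerate zeros multiply), then $$d\nu_n=\frac1{nl}\sum_{j=1}^{nl}\delta_{x_j^{(n)}}.$$ Then $d\nu_n$ converges weakly to $d\rho_E$, the equilibrium measure for $E$.
   Context: Fix $l\ge1$; $^\dagger$ is the Hermitian adjoint, $\mathbf 1$ the $l\times l$ identity. Measures are positive semi-definite $l\times l$ matrix-valued on $\mathbb R$, compactly supported, normalized by $\mu(\mathbb R)=\mathbf 1$, and non-trivial: with $\langle\!\langle f,g\rangle\!\rangle_R=\int f(x)^\dagger\,d\mu(x)\,g(x)$, $\operatorname{Tr}\langle\!\langle f,f\rangle\!\rangle_R>0$ for every non-zero polynomial $f$ with $l\times l$ matrix coefficients. $(p_n^R)_{n\ge0}$ are right orthonormal matrix polynomials: $\deg p_n^R=n$, $p_0^R=\mathbf 1$, $\langle\!\langle p_n^R,p_m^R\rangle\!\rangle_R=\delta_{nm}\mathbf 1$; $p_n^L(z)=p_n^R(\bar z)^\dagger$. All $nl$ zeros of $\det(p_n^L)$ are real and do not depend on the choice of normalization. The Jacobi parameters are $A_n=\langle\!\langle p_{n-1}^R,xp_n^R\rangle\!\rangle_R$, $B_n=\langle\!\langle p_{n-1}^R,xp_{n-1}^R\rangle\!\rangle_R$, $n\ge1$. $C(E)$ denotes logarithmic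 capacity. The measure $\mu$ with $E=\operatorname{supp}(d\mu)$ compact is called regular if $\lim_{n\to\infty}|\det(A_1\cdots A_n)|^{1/n}=C(E)^l$. *)

theory Defs
  imports "HOL-Probability.Probability" "HOL-Computational_Algebra.Polynomial"
begin

section \<open>Matrix-valued measures\<close>

definition hermitian_adjoint :: "complex^'n^'m \<Rightarrow> complex^'m^'n" where
  "hermitian_adjoint A = (\<chi> i j. cnj (A $ j $ i))"

definition pos_semidef :: "complex^'l^'l \<Rightarrow> bool" where
  "pos_semidef A \<longleftrightarrow> hermitian_adjoint A = A \<and>
     (\<forall>v. 0 \<le> Re (\<Sum>i\<in>UNIV. \<Sum>j\<in>UNIV. cnj (v $ i) * A $ i $ j * v $ j))"

text \<open>
  A matrix-valued measure on the real line is a set function; only its values on Borel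
  sets matter. Convergence of the series forces the value on the empty set to be 0.
\<close>

definition matrix_measure :: "(real set \<Rightarrow> complex^'l^'l) \<Rightarrow> bool" where
  "matrix_measure \<mu> \<longleftrightarrow>
     (\<forall>A\<in>sets borel. pos_semidef (\<mu> A)) \<and>
     (\<forall>A::nat \<Rightarrow> real set. range A \<subseteq> sets borel \<longrightarrow> disjoint_family A \<longrightarrow>
        (\<lambda>n. \<mu> (A n)) sums \<mu> (\<Union>n. A n))"

definition matrix_supp :: "(real set \<Rightarrow> complex^'l^'l) \<Rightarrow> real set" where
  "matrix_supp \<mu> = {x. \<forall>U. open U \<longrightarrow> x \<in> U \<longrightarrow> \<mu> U \<noteq> 0}"

definition trace_measure :: "(real set \<Rightarrow> complex^'l^'l) \<Rightarrow> real measure" where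
  "trace_measure \<mu> = measure_of UNIV (sets borel) (\<lambda>A. ennreal (Re (trace (\<mu> A))))"

text \<open>
  Every entry of a positive semi-definite \<open>\<mu>\<close> is absolutely continuous with respect to the
  finite measure \<open>trace_measure \<mu>\<close>, so a density exists by Radon-Nikodym. It is unique up to
  null sets, and the integrals below do not depend on the one that is chosen.
\<close>

definition matrix_density :: "(real set \<Rightarrow> complex^'l^'l) \<Rightarrow> real \<Rightarrow> complex^'l^'l" where
  "matrix_density \<mu> = (SOME W. integrable (trace_measure \<mu>) W \<and>
     (\<forall>A\<in>sets borel. \<mu> A = set_lebesgue_integral (trace_measure \<mu>) A W))"


section \<open>Orthonormal matrix polynomials\<close>

text \<open>A polynomial with matrix coefficients is represented as a matrix of scalar polynomials.\<close>

type_synonym 'l mat_poly = "complex poly^'l^'l"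

definition eval_mp :: "'l::finite mat_poly \<Rightarrow> complex \<Rightarrow> complex^'l^'l" where
  "eval_mp P z = (\<chi> i j. poly (P $ i $ j) z)"

definition degree_mp :: "'l::finite mat_poly \<Rightarrow> nat" where
  "degree_mp P = Max (range (\<lambda>(i, j). degree (P $ i $ j)))"

definition times_x :: "'l::finite mat_poly \<Rightarrow> 'l mat_poly" where
  "times_x P = (\<chi> i j. [:0, 1:] * P $ i $ j)"

text \<open>\<open>inner_R \<mu> f g\<close> is the integral of \<open>f(x)\<^sup>\<dagger> d\<mu>(x) g(x)\<close>.\<close>

definition inner_R ::
    "(real set \<Rightarrow> complex^'l^'l) \<Rightarrow> 'l::finite mat_poly \<Rightarrow> 'l mat_poly \<Rightarrow> complex^'l^'l" where
  "inner_R \<mu> f g = (\<integral>x. hermitian_adjoint (eval_mp f (of_real x)) ** matrix_density \<mu> x **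
     eval_mp g (of_real x) \<partial>trace_measure \<mu>)"

definition nontrivial_mm :: "(real set \<Rightarrow> complex^'l^'l::finite) \<Rightarrow> bool" where
  "nontrivial_mm \<mu> \<longleftrightarrow> (\<forall>f. f \<noteq> 0 \<longrightarrow> 0 < Re (trace (inner_R \<mu> f f)))"

definition right_orthonormal ::
    "(real set \<Rightarrow> complex^'l^'l) \<Rightarrow> (nat \<Rightarrow> 'l::finite mat_poly) \<Rightarrow> bool" where
  "right_orthonormal \<mu> p \<longleftrightarrow>
     p 0 = mat 1 \<and> (\<forall>n. degree_mp (p n) = n) \<and>
     (\<forall>n m. inner_R \<mu> (p n) (p m) = (if n = m then mat 1 else 0))"

text \<open>The left polynomial \<open>p\<^sup>L(z) = (p\<^sup>R(cnj z))\<^sup>\<dagger>\<close>.\<close>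

definition left_mp :: "'l::finite mat_poly \<Rightarrow> 'l mat_poly" where
  "left_mp P = (\<chi> i j. map_poly cnj (P $ j $ i))"

text \<open>\<open>jacobi_A \<mu> p n\<close> is meant for \<open>n \<ge> 1\<close>.\<close>

definition jacobi_A ::
    "(real set \<Rightarrow> complex^'l^'l) \<Rightarrow> (nat \<Rightarrow> 'l::finite mat_poly) \<Rightarrow> nat \<Rightarrow> complex^'l^'l" where
  "jacobi_A \<mu> p n = inner_R \<mu> (p (n - 1)) (times_x (p n))"

primrec jacobi_prod ::
    "(real set \<Rightarrow> complex^'l^'l) \<Rightarrow> (nat \<Rightarrow> 'l::finite mat_poly) \<Rightarrow> nat \<Rightarrow> complex^'l^'l" where
  "jacobi_prod \<mu> p 0 = mat 1"
| "jacobi_prod \<mu> p (Suc n) = jacobi_prod \<mu> p n ** jacobi_A \<mu> p (Suc n)"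

text \<open>
  The zero counting measure of \<open>det p\<^sub>n\<^sup>L\<close>. All zeros of this determinant are real; a zero of
  multiplicity \<open>m\<close> carries the mass \<open>m/(n l)\<close>.
\<close>

definition zero_counting_measure :: "(nat \<Rightarrow> 'l::finite mat_poly) \<Rightarrow> nat \<Rightarrow> real measure" where
  "zero_counting_measure p n =
     distr (point_measure {x::real. poly (det (left_mp (p n))) (of_real x) = 0}
        (\<lambda>x. ennreal (real (order (of_real x) (det (left_mp (p n)))) / real (n * CARD('l)))))
       borel (\<lambda>x. x)"


section \<open>Logarithmic potential theory on the real line\<close>

text \<open>
  The kernel is infinite on the diagonal, whereas \<open>ln 0 = 0\<close> in the library. The energy of a
  measure with bounded support is well defined, as the negative part of the kernel has a finite
  integral.
\<close>

definition log_kernel :: "real \<Rightarrow> real \<Rightarrow> ereal" where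
  "log_kernel x y = (if x = y then \<infinity> else ereal (- ln \<bar>x - y\<bar>))"

definition log_energy :: "real measure \<Rightarrow> ereal" where
  "log_energy \<rho> =
     enn2ereal (\<integral>\<^sup>+z. e2ennreal (log_kernel (fst z) (snd z)) \<partial>(\<rho> \<Otimes>\<^sub>M \<rho>)) -
     enn2ereal (\<integral>\<^sup>+z. e2ennreal (- log_kernel (fst z) (snd z)) \<partial>(\<rho> \<Otimes>\<^sub>M \<rho>))"

definition prob_measures_on :: "real set \<Rightarrow> real measure set" where
  "prob_measures_on E = {\<rho>. real_distribution \<rho> \<and> emeasure \<rho> E = 1}"

definition min_log_energy :: "real set \<Rightarrow> ereal" where
  "min_log_energy E = (INF \<rho>\<in>prob_measures_on E. log_energy \<rho>)"

text \<open>The following two notions are meant for compact \<open>E\<close>.\<close>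

definition log_capacity :: "real set \<Rightarrow> real" where
  "log_capacity E =
     (if min_log_energy E = \<infinity> then 0 else exp (- real_of_ereal (min_log_energy E)))"

definition equilibrium_measure :: "real set \<Rightarrow> real measure" where
  "equilibrium_measure E =
     (THE \<rho>. \<rho> \<in> prob_measures_on E \<and> log_energy \<rho> = min_log_energy E)"


section \<open>Regular measures\<close>

text \<open>
  Two choices of orthonormal polynomials differ by unitary right factors, so the absolute value
  of the determinant, and hence regularity, does not depend on \<open>p\<close>.
\<close>

definition regular_mm ::
    "(real set \<Rightarrow> complex^'l^'l) \<Rightarrow> (nat \<Rightarrow> 'l::finite mat_poly) \<Rightarrow> bool" where
  "regular_mm \<mu> p \<longleftrightarrow>
     (\<lambda>n. root n (cmod (det (jacobi_prod \<mu> p n))))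
       \<longlonglongrightarrow> log_capacity (matrix_supp \<mu>) ^ CARD('l)"

end

theory Submission
  imports Defs "HOL-Complex_Analysis.Complex_Analysis" "HOL-Computational_Algebra.Fundamental_Theorem_Algebra"
begin

text \<open>
  The zeros of \<open>det p\<^sub>n\<^sup>L\<close> are compared with near-Fekete points of \<open>E\<close> through the logarithmic
  potentials of the two counting measures, always at points off the real line, where no
  singularity is met.

  Orthogonality gives a lower bound for \<open>det p\<^sub>n\<close>. Let \<open>q\<close> be a scalar polynomial of degree at
  most \<open>n\<close> that is bounded by 1 on \<open>E\<close>, and let \<open>z\<close> be nonreal. Expanding the vector polynomial
  \<open>q(x) w\<close> in the orthonormal polynomials and evaluating at \<open>z\<close>, the Cauchy-Schwarz inequality
  yields \<open>|q(z)|\<^sup>2 |w|\<^sup>2 \<le> \<Sum>j\<le>n. |p\<^sub>j(z)\<^sup>\<dagger> w|\<^sup>2\<close> (lemma \<open>K_ge\<close>), because the norm of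
  \<open>q\<close> with respect to the measure is at most its supremum on \<open>E\<close>. The Christoffel-Darboux identity
  bounds this sum by a constant times \<open>|p\<^sub>n\<^sub>+\<^sub>1(z)\<^sup>\<dagger> w|\<^sup>2\<close> (lemma \<open>phi_Suc_ge\<close>). As \<open>w\<close> is
  arbitrary, \<open>|det p\<^sub>n\<^sub>+\<^sub>1(z)|\<close> is at least a constant times the \<open>l\<close>-th power of \<open>|q(z)|\<close>
  (lemma \<open>ln_cmod_D_ge\<close>). The same identity shows that all zeros are real and stay in a fixed
  interval (lemma \<open>zero_real_bounded\<close>).

  The leading coefficient of the determinant has modulus \<open>1 / |det (A\<^sub>1 \<dots> A\<^sub>n)|\<close>. Regularity says
  that its root of order \<open>n l\<close> tends to \<open>exp V\<close>, where \<open>V\<close> is the minimal energy of \<open>E\<close>. Take for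
  \<open>q\<close> a Fekete polynomial normalised to have supremum about 1 on \<open>E\<close>. Then \<open>(ln |q(z)|) / n\<close> tends
  to \<open>V + \<integral> ln |z - x| d\<rho>(x)\<close> with \<open>\<rho>\<close> the equilibrium measure. The two occurrences
  of \<open>V\<close> cancel, so every weak limit \<open>\<nu>\<close> of the zero counting measures satisfies
  \<open>\<integral> ln |z - x| d\<nu>(x) \<ge> \<integral> ln |z - x| d\<rho>(x)\<close> off the real line. The difference of the two
  sides is the real part of a function that is holomorphic near infinity and vanishes there, hence
  it is zero by the open mapping theorem, and \<open>\<nu> = \<rho>\<close> (lemma \<open>distribution_eqI_log_potential\<close>).
  Compactness of probability measures on an interval then gives convergence of the whole sequence.

  All the potential theory rests on one expansion. In the coordinates \<open>x = 2 s cos t\<close> the kernel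
  \<open>- ln |x - y|\<close> is \<open>- ln s\<close> plus the sum of \<open>(2 / k) cos (k t) cos (k u)\<close>, so the energy of a
  probability measure is \<open>- ln s\<close> plus the sum of \<open>2 / k\<close> times the squares of its
  Chebyshev moments (lemmas \<open>cheb_moments_le_energy\<close> and \<open>energy_le_cheb_moments\<close>). Uniqueness of
  the energy minimiser is strict convexity of the square. Since moments are continuous under weak
  convergence, a weak limit of near-Fekete measures has energy at most \<open>V\<close>; this proves existence of
  the equilibrium measure and convergence of the near-Fekete measures to it.
\<close>

section \<open>The Chebyshev expansion of the logarithmic kernel\<close>

text \<open>
  The argument is clamped to the interval where the inverse cosine is meaningful, which makes the
  angle, and the Chebyshev polynomials below, bounded and continuous on the whole real line. They
  can then be used as test functions for weak convergence.
\<close>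

definition joukowski_angle :: "real \<Rightarrow> real \<Rightarrow> real" where
  "joukowski_angle s x = arccos (max (-1) (min 1 (x / (2 * s))))"

definition cheb :: "real \<Rightarrow> nat \<Rightarrow> real \<Rightarrow> real" where
  "cheb s k x = cos (real k * joukowski_angle s x)"

definition cheb_moment :: "real \<Rightarrow> nat \<Rightarrow> real measure \<Rightarrow> real" where
  "cheb_moment s k \<rho> = (\<integral>x. cheb s k x \<partial>\<rho>)"

text \<open>
  The generating function \<open>\<Sum>k\<ge>1. (2 / k) Re (w\<^sup>k) cos (k t)\<close> of the Chebyshev polynomials.
\<close>

definition log_gen :: "complex \<Rightarrow> real \<Rightarrow> real" where
  "log_gen w t = - ln (cmod (1 - w * cis t)) - ln (cmod (1 - w * cis (- t)))"

lemma cos_joukowski_angle: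
  assumes "0 < s" "\<bar>x\<bar> \<le> 2 * s"
  shows "2 * s * cos (joukowski_angle s x) = x"
proof -
  have "-1 \<le> x / (2 * s)" "x / (2 * s) \<le> 1" using assms by (auto simp: field_simps)
  then have "cos (joukowski_angle s x) = x / (2 * s)"
    unfolding joukowski_angle_def by (simp add: cos_arccos)
  then show ?thesis using assms by simp
qed

lemma continuous_joukowski_angle: "isCont (joukowski_angle s) x"
proof -
  have "continuous_on UNIV (\<lambda>x. arccos (max (-1) (min 1 (x * inverse (2 * s)))))"
    by (intro continuous_intros) (auto)
  then show ?thesis unfolding joukowski_angle_def divide_inverse
    by (auto simp: continuous_on_eq_continuous_at)
qed

lemma continuous_cheb: "isCont (cheb s k) x"
  unfolding cheb_def by (intro continuous_intros continuous_joukowski_angle)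

lemma measurable_joukowski_angle [measurable]: "joukowski_angle s \<in> borel_measurable borel"
  by (intro borel_measurable_continuous_onI continuous_at_imp_continuous_on)
     (simp add: continuous_joukowski_angle)

lemma measurable_cheb [measurable]: "cheb s k \<in> borel_measurable borel"
  unfolding cheb_def by measurable

lemma abs_cheb_le_1: "\<bar>cheb s k x\<bar> \<le> 1"
  by (simp add: cheb_def)

lemma integrable_cheb:
  assumes "real_distribution \<rho>" shows "integrable \<rho> (cheb s k)"
proof -
  interpret real_distribution \<rho> by fact
  show ?thesis by (rule integrable_const_bound[of _ 1]) (auto simp: abs_cheb_le_1)
qed

lemma abs_cheb_moment_le_1:
  assumes "real_distribution \<rho>" shows "\<bar>cheb_moment s k \<rho>\<bar> \<le> 1"
proof -
  interpret real_distribution \<rho> by fact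
  have "\<bar>cheb_moment s k \<rho>\<bar> \<le> (\<integral>x. \<bar>cheb s k x\<bar> \<partial>\<rho>)"
    unfolding cheb_moment_def by (rule integral_abs_bound)
  also have "\<dots> \<le> (\<integral>x. 1 \<partial>\<rho>)"
    by (intro integral_mono integrable_abs integrable_cheb assms) (auto simp: abs_cheb_le_1)
  finally show ?thesis using prob_space by simp
qed

lemma cmod_1_minus_pos: 
  assumes "cmod w < 1" shows "0 < cmod (1 - w)"
  using assms by auto

lemma neg_ln_sums:
  assumes "cmod u < 1"
  shows "(\<lambda>k. Re (u ^ k) / real k) sums (- ln (cmod (1 - u)))"
proof -
  have "(\<lambda>n. (-1)^Suc n / of_nat n * (-u)^n) sums ln (1 + - u)"
    by (rule Ln_series) (use assms in simp)
  then have "(\<lambda>n. - ((-1)^Suc n / of_nat n * (-u)^n)) sums - ln (1 - u)"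
    using sums_minus by force
  moreover have "- ((-1)^Suc n / of_nat n * (-u)^n) = u ^ n / of_nat n" for n
  proof -
    have "(-1) ^ n * (-u) ^ n = u ^ n" by (simp flip: power_mult_distrib)
    then show ?thesis by simp
  qed
  ultimately have "(\<lambda>n. u ^ n / of_nat n) sums - ln (1 - u)" by (simp only:)
  then have "(\<lambda>n. Re (u ^ n / of_nat n)) sums Re (- ln (1 - u))" by (rule sums_Re)
  moreover have "1 - u \<noteq> 0" using assms by auto
  moreover have "Re (u ^ n / of_nat n) = Re (u ^ n) / real n" for n
    by (metis Re_divide_of_nat)
  ultimately show ?thesis by (simp add: Re_Ln)
qed

lemma log_gen_sums:
  assumes "cmod w < 1"
  shows "(\<lambda>k. 2 / real k * Re (w ^ k) * cos (real k * t)) sums log_gen w t"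
proof -
  have 1: "cmod (w * cis t) < 1" for t using assms by (simp add: norm_mult)
  have "(\<lambda>k. Re ((w * cis t) ^ k) / real k + Re ((w * cis (-t)) ^ k) / real k) sums
     (- ln (cmod (1 - w * cis t)) + - ln (cmod (1 - w * cis (-t))))"
    by (intro sums_add neg_ln_sums 1)
  moreover have "Re ((w * cis t) ^ k) / real k + Re ((w * cis (-t)) ^ k) / real k
     = 2 / real k * Re (w ^ k) * cos (real k * t)" for k
    by (simp only: power_mult_distrib Complex.DeMoivre) (simp add: add_divide_distrib[symmetric] mult.commute)
  ultimately show ?thesis unfolding log_gen_def by simp
qed

text \<open>
  At the Joukowski image \<open>s (w + 1 / w)\<close> the difference \<open>z - x\<close> splits into
  \<open>s / w\<close> times \<open>1 - w e\<^sup>i\<^sup>t\<close> times \<open>1 - w e\<^sup>-\<^sup>i\<^sup>t\<close>. This turns the expansion of the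
  generating function into an expansion of \<open>ln |z - x|\<close>.
\<close>

lemma log_gen_factor:
  assumes "0 < s" "w \<noteq> 0" "cmod w < 1"
  shows "ln (cmod (of_real s * (w + 1 / w) - of_real (2 * s * cos t))) = ln s - ln (cmod w) - log_gen w t"
proof -
  have e: "of_real s * (w + 1 / w) - of_real (2 * s * cos t)
     = of_real s / w * ((1 - w * cis t) * (1 - w * cis (- t)))"
  proof -
    have c: "cis t + cis (-t) = of_real (2 * cos t)" by (simp add: complex_eq_iff)
    have cc: "cis t * cis (-t) = 1" by (simp add: cis_mult)
    have "(1 - w * cis t) * (1 - w * cis (- t)) = 1 - w * (cis t + cis (-t)) + w^2 * (cis t * cis (-t))"
      by (simp add: algebra_simps power2_eq_square)
    also have "\<dots> = 1 - w * of_real (2 * cos t) + w^2" by (simp only: c cc mult_1_right)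
    finally have "of_real s / w * ((1 - w * cis t) * (1 - w * cis (- t)))
      = of_real s / w * (1 - w * of_real (2 * cos t) + w^2)" by simp
    then show ?thesis using assms by (simp add: field_simps power2_eq_square)
  qed
  have p: "0 < cmod (1 - w * cis t)" for t 
    by (rule cmod_1_minus_pos) (use assms in \<open>simp add: norm_mult\<close>)
  show ?thesis unfolding e log_gen_def norm_mult norm_divide
    using p[of t] p[of "-t"] assms by (auto simp: ln_mult ln_div)
qed

text \<open>
  A series of functions bounded by 1 with geometrically decaying coefficients may be integrated term
  by term. This is applied to one measure and to the product of a measure with itself.
\<close>

lemma (in prob_space) sums_integral_geometric:
  fixes f :: "nat \<Rightarrow> 'a \<Rightarrow> real"
  assumes [measurable]: "\<And>k. f k \<in> borel_measurable M"
    and f: "\<And>k z. \<bar>f k z\<bar> \<le> 1" and c: "\<And>k. \<bar>c k\<bar> \<le> C * q ^ k" and q: "0 \<le> q" "q < 1"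
    and g: "\<And>z. (\<lambda>k. c k * f k z) sums g z"
  shows "integrable M g" "(\<lambda>k. c k * integral\<^sup>L M (f k)) sums integral\<^sup>L M g"
proof -
  have bnd: "norm (c k * f k z) \<le> C * q ^ k" for k z
    using mult_mono[OF c[of k] f[of k z]] order_trans[OF abs_ge_zero c[of k]] by (simp add: abs_mult)
  have sg: "summable (\<lambda>k. C * q ^ k)" using q by (intro summable_mult summable_geometric) auto
  have int: "integrable M (\<lambda>z. c k * f k z)" for k
    by (rule integrable_const_bound[of _ "C * q ^ k"]) (use bnd in auto)
  have s1: "summable (\<lambda>k. norm (c k * f k z))" for z
    by (rule summable_comparison_test'[OF sg, of 0]) (use bnd in auto)
  have s2: "summable (\<lambda>k. \<integral>z. norm (c k * f k z) \<partial>M)"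
  proof (rule summable_comparison_test'[OF sg, of 0])
    fix k :: nat
    have "(\<integral>z. norm (c k * f k z) \<partial>M) \<le> (\<integral>z. C * q ^ k \<partial>M)"
      by (intro integral_mono integrable_norm int) (use bnd in auto)
    then show "norm (\<integral>z. norm (c k * f k z) \<partial>M) \<le> C * q ^ k"
      using prob_space by simp
  qed
  have eq: "(\<Sum>k. c k * f k z) = g z" for z using g by (simp add: sums_iff)
  have "integrable M (\<lambda>z. \<Sum>k. c k * f k z)"
    using int s1 s2 by (intro integrable_suminf) auto
  then show "integrable M g" by (simp only: eq)
  have "(\<lambda>k. \<integral>z. c k * f k z \<partial>M) sums (\<integral>z. (\<Sum>k. c k * f k z) \<partial>M)"
    using int s1 s2 by (intro sums_integral) auto
  then show "(\<lambda>k. c k * integral\<^sup>L M (f k)) sums integral\<^sup>L M g"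
    by (simp only: eq integral_mult_right_zero)
qed

abbreviation log_gen_int :: "real \<Rightarrow> complex \<Rightarrow> real measure \<Rightarrow> real" where
  "log_gen_int s w \<rho> \<equiv> \<integral>x. log_gen w (joukowski_angle s x) \<partial>\<rho>"

lemma integral_log_gen_sums:
  assumes "real_distribution \<rho>" "cmod w < 1"
  shows "integrable \<rho> (\<lambda>x. log_gen w (joukowski_angle s x))"
    and "(\<lambda>k. 2 / real k * Re (w ^ k) * cheb_moment s k \<rho>) sums
      log_gen_int s w \<rho>"
proof -
  interpret real_distribution \<rho> by fact
  have c: "\<bar>2 / real k * Re (w ^ k)\<bar> \<le> 2 * cmod w ^ k" for k
  proof -
    have "\<bar>2 / real k * Re (w ^ k)\<bar> = (2 / real k) * \<bar>Re (w ^ k)\<bar>" by (simp add: abs_mult)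
    also have "\<dots> \<le> 2 * cmod (w ^ k)"
      by (intro mult_mono abs_Re_le_cmod) (cases k; auto simp: field_simps)+
    finally show ?thesis by (simp add: norm_power)
  qed
  have g: "(\<lambda>k. 2 / real k * Re (w ^ k) * cheb s k x) sums log_gen w (joukowski_angle s x)" for x
    unfolding cheb_def by (rule log_gen_sums[OF assms(2)])
  note * = sums_integral_geometric[OF _ abs_cheb_le_1 c norm_ge_zero assms(2) g]
  show "integrable \<rho> (\<lambda>x. log_gen w (joukowski_angle s x))"
    by (rule *(1)) simp
  show "(\<lambda>k. 2 / real k * Re (w ^ k) * cheb_moment s k \<rho>) sums
      log_gen_int s w \<rho>"
    unfolding cheb_moment_def by (rule *(2)) simp
qed

text \<open>
  The three-term recurrence of the Chebyshev polynomials, from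
  \<open>2 cos t cos (k t) = cos ((k + 1) t) + cos ((k - 1) t)\<close>.
\<close>

lemma cheb_rec:
  assumes "0 < s" "\<bar>x\<bar> \<le> 2 * s"
  shows "x * cheb s (Suc k) x = s * (cheb s (Suc (Suc k)) x + cheb s k x)"
    and "x * cheb s 0 x = 2 * s * cheb s 1 x"
proof -
  let ?t = "joukowski_angle s x"
  have x: "x = 2 * s * cos ?t" using cos_joukowski_angle[OF assms] by simp
  have "cos (real (Suc (Suc k)) * ?t) + cos (real k * ?t) = 2 * cos ?t * cos (real (Suc k) * ?t)"
    using cos_add[of "real (Suc k) * ?t" ?t] cos_diff[of "real (Suc k) * ?t" ?t]
    by (simp add: algebra_simps)
  then have "2 * s * cos ?t * cheb s (Suc k) x = s * (cheb s (Suc (Suc k)) x + cheb s k x)"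
    by (simp add: cheb_def del: of_nat_Suc)
  then show "x * cheb s (Suc k) x = s * (cheb s (Suc (Suc k)) x + cheb s k x)"
    by (simp only: x[symmetric])
  show "x * cheb s 0 x = 2 * s * cheb s 1 x" using x by (simp add: cheb_def)
qed

text \<open>
  The recurrence for the Chebyshev polynomials raises the exponent \<open>j\<close> in the integrals of
  \<open>x\<^sup>j cos (k t)\<close>, so equal Chebyshev moments force equal power moments. On a bounded interval
  these determine the integrals of the cosine and the sine by polynomial approximation, and hence
  the characteristic function.
\<close>

lemma distribution_eqI_cheb_moments:
  assumes \<rho>: "real_distribution \<rho>" and \<sigma>: "real_distribution \<sigma>" and s: "0 < s"
    and \<rho>s: "AE x in \<rho>. \<bar>x\<bar> \<le> 2 * s" and \<sigma>s: "AE x in \<sigma>. \<bar>x\<bar> \<le> 2 * s"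
    and eq: "\<And>k. cheb_moment s k \<rho> = cheb_moment s k \<sigma>"
  shows "\<rho> = \<sigma>"
proof -
  interpret \<rho>: real_distribution \<rho> by fact
  interpret \<sigma>: real_distribution \<sigma> by fact
  have int: "integrable M (\<lambda>x. x ^ j * cheb s k x)"
    if M: "real_distribution M" "AE x in M. \<bar>x\<bar> \<le> 2 * s" for M j k
  proof -
    interpret real_distribution M by fact
    show ?thesis
    proof (rule integrable_const_bound)
      show "AE x in M. norm (x ^ j * cheb s k x) \<le> (2 * s)^j"
        using M(2)
      proof eventually_elim
        case (elim x)
        have "\<bar>x\<bar> ^ j * \<bar>cheb s k x\<bar> \<le> (2 * s)^j * 1"
          by (intro mult_mono power_mono abs_cheb_le_1 elim) (use s in auto)
        then show ?case by (simp add: abs_mult power_abs)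
      qed
    qed simp
  qed
  have mom: "(\<integral>x. x ^ j * cheb s k x \<partial>\<rho>) = (\<integral>x. x ^ j * cheb s k x \<partial>\<sigma>)" for j k
  proof (induction j arbitrary: k)
    case 0 then show ?case using eq by (simp add: cheb_moment_def)
  next
    case (Suc j)
    have step: "(\<integral>x. x ^ Suc j * cheb s (Suc k) x \<partial>M)
       = s * ((\<integral>x. x ^ j * cheb s (Suc (Suc k)) x \<partial>M) + (\<integral>x. x ^ j * cheb s k x \<partial>M))"
      "(\<integral>x. x ^ Suc j * cheb s 0 x \<partial>M) = 2 * s * (\<integral>x. x ^ j * cheb s 1 x \<partial>M)"
      if M: "real_distribution M" "AE x in M. \<bar>x\<bar> \<le> 2 * s" for M k
    proof -
      interpret real_distribution M by fact
      have "(\<integral>x. x ^ Suc j * cheb s (Suc k) x \<partial>M)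
        = (\<integral>x. s * (x ^ j * cheb s (Suc (Suc k)) x + x ^ j * cheb s k x) \<partial>M)"
      proof (rule integral_cong_AE)
        show "AE x in M. x ^ Suc j * cheb s (Suc k) x = s * (x ^ j * cheb s (Suc (Suc k)) x + x ^ j * cheb s k x)"
          using M(2)
        proof eventually_elim
          case (elim x)
          have "x ^ Suc j * cheb s (Suc k) x = x ^ j * (x * cheb s (Suc k) x)" by simp
          also have "\<dots> = x ^ j * (s * (cheb s (Suc (Suc k)) x + cheb s k x))"
            by (simp only: cheb_rec(1)[OF s elim])
          finally show ?case by (simp add: algebra_simps)
        qed
      qed simp_all
      also have "\<dots> = s * ((\<integral>x. x ^ j * cheb s (Suc (Suc k)) x \<partial>M) + (\<integral>x. x ^ j * cheb s k x \<partial>M))"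
        by (simp add: int[OF M])
      finally show "(\<integral>x. x ^ Suc j * cheb s (Suc k) x \<partial>M)
       = s * ((\<integral>x. x ^ j * cheb s (Suc (Suc k)) x \<partial>M) + (\<integral>x. x ^ j * cheb s k x \<partial>M))" .
      have "(\<integral>x. x ^ Suc j * cheb s 0 x \<partial>M) = (\<integral>x. 2 * s * (x ^ j * cheb s 1 x) \<partial>M)"
      proof (rule integral_cong_AE)
        show "AE x in M. x ^ Suc j * cheb s 0 x = 2 * s * (x ^ j * cheb s 1 x)"
          using M(2)
        proof eventually_elim
          case (elim x)
          have "x ^ Suc j * cheb s 0 x = x ^ j * (x * cheb s 0 x)" by simp
          also have "\<dots> = x ^ j * (2 * s * cheb s 1 x)" by (simp only: cheb_rec(2)[OF s elim])
          finally show ?case by (simp add: algebra_simps)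
        qed
      qed simp_all
      then show "(\<integral>x. x ^ Suc j * cheb s 0 x \<partial>M) = 2 * s * (\<integral>x. x ^ j * cheb s 1 x \<partial>M)"
        by (simp)
    qed
    show ?case
    proof (cases k)
      case 0 then show ?thesis using step(2)[OF \<rho> \<rho>s] step(2)[OF \<sigma> \<sigma>s] Suc.IH by simp
    next
      case (Suc k') then show ?thesis
        using step(1)[OF \<rho> \<rho>s] step(1)[OF \<sigma> \<sigma>s] Suc.IH by simp
    qed
  qed
  have mom': "(\<integral>x. x ^ j \<partial>\<rho>) = (\<integral>x. x ^ j \<partial>\<sigma>)" for j
    using mom[of j 0] by (simp add: cheb_def)
  have ipow: "integrable \<rho> (\<lambda>x. x ^ j)" "integrable \<sigma> (\<lambda>x. x ^ j)" for j
    using int[OF \<rho> \<rho>s, of j 0] int[OF \<sigma> \<sigma>s, of j 0] by (simp_all add: cheb_def)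
  have "integral\<^sup>L \<rho> f = integral\<^sup>L \<sigma> f" if f: "\<And>x. isCont f x" "\<And>x. \<bar>f x\<bar> \<le> 1" for f :: "real \<Rightarrow> real"
  proof -
    have [measurable]: "f \<in> borel_measurable borel"
      using f by (intro borel_measurable_continuous_onI) (auto intro: continuous_at_imp_continuous_on)
    have "\<bar>integral\<^sup>L \<rho> f - integral\<^sup>L \<sigma> f\<bar> \<le> e" if "e > 0" for e
    proof -
      have "e / 2 > 0" using that by simp
      then obtain g where g: "real_polynomial_function g" "\<And>x. x \<in> {-(2 * s)..2 * s} \<Longrightarrow> \<bar>f x - g x\<bar> < e/2"
        using Stone_Weierstrass_real_polynomial_function[of "{-(2 * s)..2 * s}" f "e/2"] f
        by (auto intro: continuous_at_imp_continuous_on)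
      then obtain a n where g_eq: "g = (\<lambda>x. \<Sum>i\<le>n. a i * x ^ i)"
        by (auto simp: real_polynomial_function_iff_sum)
      have ig: "integrable \<rho> g" "integrable \<sigma> g" unfolding g_eq using ipow by auto
      have geq: "integral\<^sup>L \<rho> g = integral\<^sup>L \<sigma> g"
        unfolding g_eq using ipow by (simp add: mom')
      have close: "\<bar>integral\<^sup>L M f - integral\<^sup>L M g\<bar> \<le> e / 2"
        if M: "real_distribution M" "AE x in M. \<bar>x\<bar> \<le> 2 * s" "integrable M g" for M
      proof -
        interpret real_distribution M by fact
        have if': "integrable M f" by (rule integrable_const_bound[of _ 1]) (use f in auto)
        have "integral\<^sup>L M f - integral\<^sup>L M g = (\<integral>x. f x - g x \<partial>M)" using if' M(3) by simp
        also have "\<bar>\<dots>\<bar> \<le> (\<integral>x. \<bar>f x - g x\<bar> \<partial>M)" by (rule integral_abs_bound)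
        also have "\<dots> \<le> (\<integral>x. e / 2 \<partial>M)"
        proof (rule integral_mono_AE)
          show "AE x in M. \<bar>f x - g x\<bar> \<le> e / 2"
            using M(2) by eventually_elim (rule less_imp_le[OF g(2)], auto)
        qed (use if' M(3) in auto)
        finally show ?thesis using prob_space by simp
      qed
      show ?thesis using close[OF \<rho> \<rho>s ig(1)] close[OF \<sigma> \<sigma>s ig(2)] geq by linarith
    qed
    then show ?thesis by (metis abs_le_zero_iff eq_iff_diff_eq_0 field_le_epsilon add_0 )
  qed
  then have cs: "(\<integral>x. cos (t * x) \<partial>\<rho>) = (\<integral>x. cos (t * x) \<partial>\<sigma>)"
     "(\<integral>x. sin (t * x) \<partial>\<rho>) = (\<integral>x. sin (t * x) \<partial>\<sigma>)" for t
    by (auto intro!: continuous_intros)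
  have "char \<rho> = char \<sigma>"
  proof
    fix t
    have "char M t = Complex (\<integral>x. cos (t * x) \<partial>M) (\<integral>x. sin (t * x) \<partial>M)"
      if "real_distribution M" for M
    proof -
      interpret real_distribution M by fact
      have i: "integrable M (\<lambda>x. iexp (t * x))" by (rule integrable_iexp) auto
      show ?thesis unfolding char_def
        by (rule complex_eqI) (use i in \<open>simp_all add: Re_exp Im_exp flip: integral_Re integral_Im\<close>)
    qed
    then show "char \<rho> t = char \<sigma> t" using cs \<rho> \<sigma> by simp
  qed
  then show ?thesis using Levy_uniqueness \<rho> \<sigma> by blast
qed

section \<open>Logarithmic energy in terms of Chebyshev moments\<close>

lemma measurable_cis_compose [measurable]:
  "(\<lambda>z. cis (g z)) \<in> borel_measurable M" if [measurable]: "g \<in> borel_measurable M"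
proof -
  have c: "cis \<in> borel_measurable borel" 
    by (intro borel_measurable_continuous_onI continuous_intros)
  show ?thesis by (rule measurable_compose[OF _ c], measurable)
qed

lemma measurable_log_gen [measurable]:
  "(\<lambda>z. log_gen (f z) (g z)) \<in> borel_measurable M"
  if [measurable]: "f \<in> borel_measurable M" "g \<in> borel_measurable M"
  unfolding log_gen_def by measurable

text \<open>
  The Abel mean of the expansion of the logarithmic kernel. For \<open>r < 1\<close> it is bounded, it is a
  superposition of products \<open>cheb s k x * cheb s k y\<close> with nonnegative coefficients, and it exceeds
  its limit \<open>ln s - ln |x - y|\<close> by at most \<open>- ln r\<close>. It replaces truncation of the kernel.
\<close>

definition abel_kernel :: "real \<Rightarrow> real \<Rightarrow> real \<Rightarrow> real \<Rightarrow> real" where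
  "abel_kernel s r x y = log_gen (of_real r * cis (joukowski_angle s y)) (joukowski_angle s x)"

abbreviation cheb_sum :: "real \<Rightarrow> nat \<Rightarrow> real measure \<Rightarrow> real" where
  "cheb_sum s K \<rho> \<equiv> \<Sum>k\<le>K. 2 / real k * (cheb_moment s k \<rho>)\<^sup>2"

abbreviation abel_sum :: "real \<Rightarrow> real \<Rightarrow> nat \<Rightarrow> real measure \<Rightarrow> real" where
  "abel_sum s r K \<rho> \<equiv> \<Sum>k\<le>K. 2 / real k * r ^ k * (cheb_moment s k \<rho>)\<^sup>2"

lemma abel_kernel_sums:
  assumes "0 \<le> r" "r < 1"
  shows "(\<lambda>k. 2 / real k * r ^ k * (cheb s k x * cheb s k y)) sums abel_kernel s r x y"
proof -
  have "cmod (of_real r * cis (joukowski_angle s y)) < 1" using assms by (simp add: norm_mult)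
  from log_gen_sums[OF this, of "joukowski_angle s x"]
  have "(\<lambda>k. 2 / real k * Re ((of_real r * cis (joukowski_angle s y)) ^ k) * cheb s k x) sums abel_kernel s r x y"
    unfolding cheb_def abel_kernel_def .
  moreover have "Re ((of_real r * cis (joukowski_angle s y)) ^ k) = r ^ k * cheb s k y" for k
    by (simp add: power_mult_distrib Complex.DeMoivre cheb_def flip: of_real_power)
  ultimately show ?thesis by (simp add: mult_ac)
qed

text \<open>
  Expanding the squares, the difference of the two sides is \<open>(1 - r)\<^sup>2\<close>. The factor \<open>sqrt r\<close>, which
  tends to 1, is what makes the bound on the Abel means sharp.
\<close>

lemma cmod_1_minus_cis_ge:
  assumes "0 < r" shows "sqrt r * cmod (1 - cis t) \<le> cmod (1 - of_real r * cis t)"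
proof -
  have e: "(cmod (1 - of_real r * cis t))\<^sup>2 = 1 - 2 * r * cos t + r\<^sup>2" for r
  proof -
    have "(cmod (1 - of_real r * cis t))\<^sup>2 = (1 - r * cos t)\<^sup>2 + (r * sin t)\<^sup>2"
      by (simp add: cmod_power2)
    also have "\<dots> = 1 - 2 * r * cos t + r\<^sup>2 * ((cos t)\<^sup>2 + (sin t)\<^sup>2)"
      by (simp add: power2_eq_square algebra_simps del: sin_cos_squared_add sin_cos_squared_add2 sin_cos_squared_add3)
    finally show ?thesis by (simp del: sin_cos_squared_add3)
  qed
  have "(sqrt r * cmod (1 - cis t))\<^sup>2 \<le> (cmod (1 - of_real r * cis t))\<^sup>2"
  proof -
    have "(sqrt r * cmod (1 - cis t))\<^sup>2 = r * (cmod (1 - of_real 1 * cis t))\<^sup>2"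
      using assms by (simp add: power_mult_distrib)
    also have "\<dots> = (cmod (1 - of_real r * cis t))\<^sup>2 - (1 - r)\<^sup>2"
      unfolding e by (simp add: power2_eq_square algebra_simps)
    finally show ?thesis by simp
  qed
  then show ?thesis by (rule power2_le_imp_le) simp
qed

lemma abel_kernel_eq:
  "abel_kernel s r x y = - ln (cmod (1 - of_real r * cis (joukowski_angle s y + joukowski_angle s x)))
     - ln (cmod (1 - of_real r * cis (joukowski_angle s y - joukowski_angle s x)))"
  unfolding abel_kernel_def log_gen_def by (simp add: mult.assoc cis_mult)

lemma joukowski_dist:
  assumes "0 < s" "\<bar>x\<bar> \<le> 2 * s" "\<bar>y\<bar> \<le> 2 * s"
  shows "cmod (1 - cis (joukowski_angle s y + joukowski_angle s x)) *
     cmod (1 - cis (joukowski_angle s y - joukowski_angle s x)) = \<bar>x - y\<bar> / s"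
proof -
  let ?a = "joukowski_angle s y" and ?b = "joukowski_angle s x"
  have "(1 - cis (?a + ?b)) * (1 - cis (?a - ?b)) = cis ?a * (of_real (2 * cos ?a - 2 * cos ?b))"
  proof -
    have 1: "cis (?a + ?b) + cis (?a - ?b) = cis ?a * of_real (2 * cos ?b)"
      by (simp add: complex_eq_iff cos_add cos_diff sin_add sin_diff)
    have 2: "1 + cis (?a + ?b) * cis (?a - ?b) = cis ?a * of_real (2 * cos ?a)"
      by (simp add: cis_mult complex_eq_iff cos_double_cos sin_double power2_eq_square)
    have "(1 - cis (?a + ?b)) * (1 - cis (?a - ?b)) = 1 + cis (?a + ?b) * cis (?a - ?b)
      - (cis (?a + ?b) + cis (?a - ?b))"
      by (simp add: algebra_simps del: cis_mult)
    then show ?thesis unfolding 1 2 by (simp add: algebra_simps)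
  qed
  then have "cmod (1 - cis (?a + ?b)) * cmod (1 - cis (?a - ?b)) = \<bar>2 * cos ?a - 2 * cos ?b\<bar>"
    by (metis norm_mult norm_cis mult_1 norm_of_real)
  moreover have "2 * cos ?a = y / s" "2 * cos ?b = x / s"
    using cos_joukowski_angle[OF assms(1,2)] cos_joukowski_angle[OF assms(1,3)] assms(1)
    by (auto simp: field_simps)
  ultimately show ?thesis using assms(1) by (simp add: diff_divide_distrib[symmetric] abs_minus_commute)
qed

lemma abel_kernel_le:
  assumes "0 < s" "\<bar>x\<bar> \<le> 2 * s" "\<bar>y\<bar> \<le> 2 * s" "x \<noteq> y" "0 < r" "r < 1"
  shows "abel_kernel s r x y \<le> - ln \<bar>x - y\<bar> + ln s - ln r"
proof -
  let ?a = "joukowski_angle s y" and ?b = "joukowski_angle s x"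
  have p: "0 < cmod (1 - of_real r * cis t)" for t 
    by (rule cmod_1_minus_pos) (use assms in \<open>simp add: norm_mult\<close>)
  have "r * (\<bar>x - y\<bar> / s) = (sqrt r * cmod (1 - cis (?a + ?b))) * (sqrt r * cmod (1 - cis (?a - ?b)))"
    unfolding joukowski_dist[OF assms(1-3), symmetric] using assms by simp
  also have "\<dots> \<le> cmod (1 - of_real r * cis (?a + ?b)) * cmod (1 - of_real r * cis (?a - ?b))"
    by (intro mult_mono cmod_1_minus_cis_ge assms) (use assms in auto)
  finally have "ln (r * (\<bar>x - y\<bar> / s)) \<le> ln (cmod (1 - of_real r * cis (?a + ?b)) * cmod (1 - of_real r * cis (?a - ?b)))"
    using assms by (intro ln_mono) (auto intro!: divide_pos_pos)
  also have "\<dots> = - abel_kernel s r x y"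
    unfolding abel_kernel_eq using p[of "?a + ?b"] p[of "?a - ?b"] by (auto simp: ln_mult)
  finally show ?thesis using assms by (simp add: ln_mult ln_div)
qed

lemma abel_kernel_le_diag:
  assumes "0 < r" "r < 1"
  shows "abel_kernel s r x y \<le> - 2 * ln (1 - r)"
proof -
  have "ln (1 - r) \<le> ln (cmod (1 - of_real r * cis t))" for t
  proof (rule ln_mono)
    have "1 - r = cmod 1 - cmod (of_real r * cis t)" using assms by (simp add: norm_mult)
    also have "\<dots> \<le> cmod (1 - of_real r * cis t)" by (rule norm_triangle_ineq2)
    finally show "1 - r \<le> cmod (1 - of_real r * cis t)" .
  qed (use assms in auto)
  from this[of "joukowski_angle s y + joukowski_angle s x"] this[of "joukowski_angle s y - joukowski_angle s x"]
  show ?thesis unfolding abel_kernel_eq by linarith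
qed

lemma ln_cmod_1_minus_le:
  assumes "0 < r" "r < 1" shows "ln (cmod (1 - of_real r * cis t)) \<le> ln 2"
proof (rule ln_mono)
  have "cmod (1 - of_real r * cis t) \<le> cmod 1 + cmod (of_real r * cis t)" by (rule norm_triangle_ineq4)
  also have "\<dots> \<le> 2" using assms by (simp add: norm_mult)
  finally show "cmod (1 - of_real r * cis t) \<le> 2" .
  show "0 < cmod (1 - of_real r * cis t)"
    by (rule cmod_1_minus_pos) (use assms in \<open>simp add: norm_mult\<close>)
qed

lemma abel_kernel_ge:
  assumes "0 < r" "r < 1"
  shows "- 2 * ln 2 \<le> abel_kernel s r x y"
  unfolding abel_kernel_eq using ln_cmod_1_minus_le[OF assms, of "joukowski_angle s y + joukowski_angle s x"]
   ln_cmod_1_minus_le[OF assms, of "joukowski_angle s y - joukowski_angle s x"] by linarith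

text \<open>
  On the diagonal one of the two factors is \<open>1 - r\<close>, so the Abel means tend to infinity there. This
  detects atoms of a measure.
\<close>

lemma abel_kernel_diag_ge:
  assumes "0 < r" "r < 1"
  shows "- ln (1 - r) - ln 2 \<le> abel_kernel s r x x"
proof -
  have "1 - of_real r * cis 0 = complex_of_real (1 - r)" by simp
  then have "cmod (1 - of_real r * cis 0) = 1 - r" using assms by (simp only: norm_of_real)
  then show ?thesis unfolding abel_kernel_eq using ln_cmod_1_minus_le[OF assms, of "joukowski_angle s x + joukowski_angle s x"]
    by simp
qed

text \<open>
  Off the diagonal neither of the two factors vanishes at \<open>r = 1\<close>, because their product is
  \<open>|x - y| / s\<close>.
\<close>

lemma abel_kernel_tendsto:
  assumes "0 < s" "\<bar>x\<bar> \<le> 2 * s" "\<bar>y\<bar> \<le> 2 * s" "x \<noteq> y" "r \<longlonglongrightarrow> 1"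
  shows "(\<lambda>n. abel_kernel s (r n) x y) \<longlonglongrightarrow> - ln \<bar>x - y\<bar> + ln s"
proof -
  let ?a = "joukowski_angle s y" and ?b = "joukowski_angle s x"
  have nz: "cmod (1 - cis (?a + ?b)) * cmod (1 - cis (?a - ?b)) \<noteq> 0"
    unfolding joukowski_dist[OF assms(1-3)] using assms by auto
  have "(\<lambda>n. abel_kernel s (r n) x y) \<longlonglongrightarrow>
     - ln (cmod (1 - of_real 1 * cis (?a + ?b))) - ln (cmod (1 - of_real 1 * cis (?a - ?b)))"
    unfolding abel_kernel_eq using nz assms(5) by (intro tendsto_intros) auto
  also have "- ln (cmod (1 - of_real 1 * cis (?a + ?b))) - ln (cmod (1 - of_real 1 * cis (?a - ?b)))
     = - ln (\<bar>x - y\<bar> / s)"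
    unfolding joukowski_dist[OF assms(1-3), symmetric] using nz by (simp add: ln_mult)
  also have "\<dots> = - ln \<bar>x - y\<bar> + ln s" using assms by (simp add: ln_div)
  finally show ?thesis .
qed

lemma measurable_abel_kernel [measurable]:
  "(\<lambda>z. abel_kernel s r (fst z) (snd z)) \<in> borel_measurable (borel \<Otimes>\<^sub>M borel)"
  unfolding abel_kernel_def by measurable

lemma prob_space_pair_real_distribution:
  assumes "real_distribution \<rho>"
  shows "prob_space (\<rho> \<Otimes>\<^sub>M \<rho>)" and "sets (\<rho> \<Otimes>\<^sub>M \<rho>) = sets (borel \<Otimes>\<^sub>M borel)"
proof -
  interpret real_distribution \<rho> by fact
  interpret pair_prob_space \<rho> \<rho> ..
  show "prob_space (\<rho> \<Otimes>\<^sub>M \<rho>)" by (rule P.prob_space_axioms)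
  show "sets (\<rho> \<Otimes>\<^sub>M \<rho>) = sets (borel \<Otimes>\<^sub>M borel)" by (intro sets_pair_measure_cong) auto
qed

lemma AE_pair_bounded:
  assumes "real_distribution \<rho>" and b: "AE x in \<rho>. \<bar>x\<bar> \<le> B"
  shows "AE z in \<rho> \<Otimes>\<^sub>M \<rho>. \<bar>fst z\<bar> \<le> B \<and> \<bar>snd z\<bar> \<le> B"
proof -
  interpret real_distribution \<rho> by fact
  interpret pair_prob_space \<rho> \<rho> ..
  show ?thesis
  proof (rule AE_pair_measure)
    show "{z \<in> space (\<rho> \<Otimes>\<^sub>M \<rho>). \<bar>fst z\<bar> \<le> B \<and> \<bar>snd z\<bar> \<le> B} \<in> sets (\<rho> \<Otimes>\<^sub>M \<rho>)"
      by measurable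
    show "AE x in \<rho>. AE y in \<rho>. \<bar>fst (x, y)\<bar> \<le> B \<and> \<bar>snd (x, y)\<bar> \<le> B"
      using b by eventually_elim (use b in \<open>eventually_elim, simp\<close>)
  qed
qed

text \<open>
  By Fubini each product \<open>cheb s k x * cheb s k y\<close> integrates to the square of a moment.
\<close>

lemma integral_abel_kernel_sums:
  assumes \<rho>: "real_distribution \<rho>" and r: "0 \<le> r" "r < 1"
  shows "integrable (\<rho> \<Otimes>\<^sub>M \<rho>) (\<lambda>z. abel_kernel s r (fst z) (snd z))"
    and "(\<lambda>k. 2 / real k * r ^ k * (cheb_moment s k \<rho>)\<^sup>2) sums
      (\<integral>z. abel_kernel s r (fst z) (snd z) \<partial>(\<rho> \<Otimes>\<^sub>M \<rho>))"
proof -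
  interpret real_distribution \<rho> by fact
  interpret pair_prob_space \<rho> \<rho> ..
  let ?N = "\<rho> \<Otimes>\<^sub>M \<rho>"
  note [measurable_cong] = prob_space_pair_real_distribution(2)[OF \<rho>]
  let ?f = "\<lambda>k z. cheb s k (fst z) * cheb s k (snd z)"
  have c: "\<bar>2 / real k * r ^ k\<bar> \<le> 2 * r ^ k" for k
    using r by (cases k) (auto simp: abs_mult field_simps)
  have f1: "\<bar>?f k z\<bar> \<le> 1" for k z
    using mult_mono[OF abs_cheb_le_1 abs_cheb_le_1, of s k "fst z" s k "snd z"] by (simp add: abs_mult mult.commute)
  have [measurable]: "?f k \<in> borel_measurable ?N" for k by measurable
  note * = P.sums_integral_geometric[of ?f "\<lambda>k. 2 / real k * r ^ k" 2 r
     "\<lambda>z. abel_kernel s r (fst z) (snd z)", OF _ f1 c r abel_kernel_sums[OF r]]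
  show "integrable ?N (\<lambda>z. abel_kernel s r (fst z) (snd z))"
    by (rule *(1)) measurable
  have i: "(\<integral>z. ?f k z \<partial>?N) = (cheb_moment s k \<rho>)\<^sup>2" for k
  proof -
    have "integrable ?N (?f k)" by (rule P.integrable_const_bound[of _ 1]) (use f1 in auto)
    then have "(\<integral>z. ?f k z \<partial>?N) = (\<integral>x. (\<integral>y. cheb s k x * cheb s k y \<partial>\<rho>) \<partial>\<rho>)"
      by (subst integral_fst'[symmetric]) auto
    then show ?thesis by (simp add: cheb_moment_def power2_eq_square)
  qed
  have "(\<lambda>k. 2 / real k * r ^ k * (\<integral>z. ?f k z \<partial>?N)) sums
      (\<integral>z. abel_kernel s r (fst z) (snd z) \<partial>?N)"
    by (rule *(2)) measurable
  then show "(\<lambda>k. 2 / real k * r ^ k * (cheb_moment s k \<rho>)\<^sup>2) sums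
      (\<integral>z. abel_kernel s r (fst z) (snd z) \<partial>?N)" by (simp only: i)
qed

text \<open>
  The library logarithm vanishes at 0, so the diagonal has to be excluded separately.
\<close>

definition finite_energy :: "real measure \<Rightarrow> bool" where
  "finite_energy \<rho> \<longleftrightarrow> (AE z in \<rho> \<Otimes>\<^sub>M \<rho>. fst z \<noteq> snd z) \<and>
     integrable (\<rho> \<Otimes>\<^sub>M \<rho>) (\<lambda>z. - ln \<bar>fst z - snd z\<bar>)"

definition energy :: "real measure \<Rightarrow> real" where
  "energy \<rho> = (\<integral>z. - ln \<bar>fst z - snd z\<bar> \<partial>(\<rho> \<Otimes>\<^sub>M \<rho>))"

lemma log_energy_eq_energy:
  assumes "finite_energy \<rho>" shows "log_energy \<rho> = ereal (energy \<rho>)"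
proof -
  let ?N = "\<rho> \<Otimes>\<^sub>M \<rho>" and ?l = "\<lambda>z. - ln \<bar>fst z - snd z\<bar> :: real"
  have ae: "AE z in ?N. fst z \<noteq> snd z" and int: "integrable ?N ?l"
    using assms by (auto simp: finite_energy_def)
  have P: "(\<integral>\<^sup>+z. e2ennreal (log_kernel (fst z) (snd z)) \<partial>?N) = (\<integral>\<^sup>+z. ennreal (?l z) \<partial>?N)"
    by (rule nn_integral_cong_AE) (use ae in \<open>eventually_elim, simp add: log_kernel_def\<close>)
  have Q: "(\<integral>\<^sup>+z. e2ennreal (- log_kernel (fst z) (snd z)) \<partial>?N) = (\<integral>\<^sup>+z. ennreal (- ?l z) \<partial>?N)"
    by (rule nn_integral_cong_AE) (use ae in \<open>eventually_elim, simp add: log_kernel_def\<close>)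
  have fin: "(\<integral>\<^sup>+z. ennreal (?l z) \<partial>?N) < \<infinity>" "(\<integral>\<^sup>+z. ennreal (- ?l z) \<partial>?N) < \<infinity>"
    using int unfolding real_integrable_def by (auto simp: less_top[symmetric])
  have "enn2ereal X = ereal (enn2real X)" if "X < \<infinity>" for X :: ennreal
    using that by (cases X) (auto simp: enn2real_def)
  then show ?thesis unfolding log_energy_def P Q energy_def real_lebesgue_integral_def[OF int]
    using fin by (simp del: uminus_ereal.simps)
qed

text \<open>
  On a bounded set the negative part of the kernel is bounded. A finite energy therefore bounds the
  integral of the positive part, where the diagonal counts as infinite.
\<close>

lemma finite_energyI_log_energy:
  assumes \<rho>: "real_distribution \<rho>" and s: "0 < s" and b: "AE x in \<rho>. \<bar>x\<bar> \<le> 2 * s"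
    and e: "log_energy \<rho> \<noteq> \<infinity>"
  shows "finite_energy \<rho>"
proof -
  interpret real_distribution \<rho> by fact
  interpret pair_prob_space \<rho> \<rho> ..
  let ?N = "\<rho> \<Otimes>\<^sub>M \<rho>" and ?l = "\<lambda>z. - ln \<bar>fst z - snd z\<bar> :: real"
  note [measurable_cong] = prob_space_pair_real_distribution(2)[OF \<rho>]
  let ?P = "(\<integral>\<^sup>+z. e2ennreal (log_kernel (fst z) (snd z)) \<partial>?N)"
  let ?Q = "(\<integral>\<^sup>+z. e2ennreal (- log_kernel (fst z) (snd z)) \<partial>?N)"
  have [measurable]: "(\<lambda>z. log_kernel (fst z) (snd z)) \<in> borel_measurable ?N"
    unfolding log_kernel_def by measurable
  have bN: "AE z in ?N. \<bar>fst z\<bar> \<le> 2 * s \<and> \<bar>snd z\<bar> \<le> 2 * s"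
    by (rule AE_pair_bounded[OF \<rho> b])
  have "?Q \<le> (\<integral>\<^sup>+z. ennreal \<bar>ln (4 * s)\<bar> \<partial>?N)"
  proof (rule nn_integral_mono_AE)
    show "AE z in ?N. e2ennreal (- log_kernel (fst z) (snd z)) \<le> ennreal \<bar>ln (4 * s)\<bar>"
      using bN
    proof eventually_elim
      case (elim z)
      show ?case
      proof (cases "fst z = snd z")
        case False
        then have "ln \<bar>fst z - snd z\<bar> \<le> ln (4 * s)" using elim by (intro ln_mono) auto
        then have "ln \<bar>fst z - snd z\<bar> \<le> \<bar>ln (4 * s)\<bar>" by linarith
        then show ?thesis using False by (simp add: log_kernel_def ennreal_leI)
      qed (simp add: log_kernel_def e2ennreal_neg)
    qed
  qed
  also have "\<dots> < \<infinity>" using P.emeasure_space_1 by simp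
  finally have Q: "?Q < \<infinity>" .
  have P: "?P < \<infinity>"
  proof (rule ccontr)
    assume "\<not> ?P < \<infinity>"
    then have "?P = \<infinity>" by (metis infinity_ennreal_def top.not_eq_extremum)
    then have "log_energy \<rho> = \<infinity>" unfolding log_energy_def using Q by (cases ?Q) (auto simp: enn2ereal_ennreal)
    with e show False by simp
  qed
  have ae: "AE z in ?N. fst z \<noteq> snd z"
  proof -
    have "AE z in ?N. e2ennreal (log_kernel (fst z) (snd z)) \<noteq> \<infinity>"
      by (rule nn_integral_noteq_infinite) (use P in auto)
    then show ?thesis by eventually_elim (auto simp: log_kernel_def)
  qed
  have "(\<integral>\<^sup>+z. ennreal (norm (?l z)) \<partial>?N) \<le> (\<integral>\<^sup>+z. e2ennreal (log_kernel (fst z) (snd z)) + e2ennreal (- log_kernel (fst z) (snd z)) \<partial>?N)"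
  proof (rule nn_integral_mono_AE)
    show "AE z in ?N. ennreal (norm (?l z)) \<le> e2ennreal (log_kernel (fst z) (snd z)) + e2ennreal (- log_kernel (fst z) (snd z))"
      using ae
    proof eventually_elim
      case (elim z)
      have "ennreal \<bar>a\<bar> \<le> ennreal (- a) + ennreal a" for a :: real
        by (cases "a \<ge> 0") (auto simp: ennreal_neg)
      then show ?case using elim by (simp add: log_kernel_def)
    qed
  qed
  also have "\<dots> = ?P + ?Q" by (rule nn_integral_add) auto
  also have "\<dots> < \<infinity>" using P Q by simp
  finally have "integrable ?N ?l" by (intro integrableI_bounded) auto
  with ae show ?thesis by (simp add: finite_energy_def)
qed

text \<open>
  The bound for \<open>r < 1\<close> passes to the limit \<open>r = 1\<close> because the sum is finite.
\<close>

lemma cheb_sum_le_of_abel: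
  fixes c :: real and m :: "nat \<Rightarrow> real"
  assumes "\<And>r. 0 < r \<Longrightarrow> r < 1 \<Longrightarrow> (\<Sum>k\<le>K. 2 / real k * r ^ k * (m k)\<^sup>2) \<le> c - ln r"
  shows "(\<Sum>k\<le>K. 2 / real k * (m k)\<^sup>2) \<le> c"
proof -
  have lim: "((\<lambda>r. \<Sum>k\<le>K. 2 / real k * r ^ k * (m k)\<^sup>2) \<longlongrightarrow>
      (\<Sum>k\<le>K. 2 / real k * 1 ^ k * (m k)\<^sup>2)) (at_left 1)"
    by (intro tendsto_intros)
  have lim2: "((\<lambda>r. c - ln r) \<longlongrightarrow> c - ln 1) (at_left (1::real))"
    by (intro tendsto_intros) auto
  have ev: "eventually (\<lambda>r. 0 < r \<and> r < 1) (at_left (1::real))"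
    using eventually_at_left_real[of 0 1] by simp
  have ev2: "eventually (\<lambda>r. (\<Sum>k\<le>K. 2 / real k * r ^ k * (m k)\<^sup>2) \<le> c - ln r) (at_left 1)"
    using ev by eventually_elim (rule assms, auto)
  show ?thesis using tendsto_le[OF _ lim2 lim ev2] by simp
qed

text \<open>
  One half of the energy formula: integrate the pointwise bound of the Abel means by the kernel and
  let \<open>r\<close> tend to 1.
\<close>

lemma cheb_moments_le_energy:
  assumes \<rho>: "real_distribution \<rho>" and s: "0 < s" and b: "AE x in \<rho>. \<bar>x\<bar> \<le> 2 * s"
    and e: "finite_energy \<rho>"
  shows "cheb_sum s K \<rho> \<le> energy \<rho> + ln s"
proof -
  interpret real_distribution \<rho> by fact
  interpret pair_prob_space \<rho> \<rho> ..
  let ?N = "\<rho> \<Otimes>\<^sub>M \<rho>" and ?l = "\<lambda>z. - ln \<bar>fst z - snd z\<bar> :: real"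
  have bN: "AE z in ?N. \<bar>fst z\<bar> \<le> 2 * s \<and> \<bar>snd z\<bar> \<le> 2 * s"
    by (rule AE_pair_bounded[OF \<rho> b])
  have ae: "AE z in ?N. fst z \<noteq> snd z" and int: "integrable ?N ?l"
    using e by (auto simp: finite_energy_def)
  have *: "abel_sum s r K \<rho> \<le> energy \<rho> + ln s - ln r"
    if r: "0 < r" "r < 1" for r
  proof -
    have r': "0 \<le> r" using r by simp
    note I = integral_abel_kernel_sums[OF \<rho> r' r(2), of s]
    have "abel_sum s r K \<rho> \<le> (\<integral>z. abel_kernel s r (fst z) (snd z) \<partial>?N)"
      unfolding sums_unique[OF I(2)] by (rule sum_le_suminf) (use I(2) r in \<open>auto simp: sums_iff\<close>)
    also have "\<dots> \<le> (\<integral>z. ?l z + (ln s - ln r) \<partial>?N)"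
    proof (rule integral_mono_AE)
      show "AE z in ?N. abel_kernel s r (fst z) (snd z) \<le> ?l z + (ln s - ln r)"
        using bN ae by eventually_elim (use abel_kernel_le[OF s _ _ _ r] in force)
    qed (use I(1) int in auto)
    also have "\<dots> = energy \<rho> + ln s - ln r"
      using int P.prob_space by (simp add: energy_def)
    finally show ?thesis .
  qed
  show ?thesis by (rule cheb_sum_le_of_abel) (rule *)
qed

text \<open>
  The other half of the energy formula, by Fatou's lemma for the Abel means. Since these are infinite
  in the limit on the diagonal, the bound also shows that the diagonal is a null set, so finiteness
  of the energy is a conclusion here.
\<close>

lemma energy_le_cheb_moments:
  assumes \<rho>: "real_distribution \<rho>" and s: "0 < s" and b: "AE x in \<rho>. \<bar>x\<bar> \<le> 2 * s"
    and c: "\<And>K. cheb_sum s K \<rho> \<le> c + ln s"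
  shows "finite_energy \<rho>" "energy \<rho> \<le> c"
proof -
  interpret real_distribution \<rho> by fact
  interpret pair_prob_space \<rho> \<rho> ..
  let ?N = "\<rho> \<Otimes>\<^sub>M \<rho>" and ?l = "\<lambda>z. - ln \<bar>fst z - snd z\<bar> :: real"
  note [measurable_cong] = prob_space_pair_real_distribution(2)[OF \<rho>]
  have bN: "AE z in ?N. \<bar>fst z\<bar> \<le> 2 * s \<and> \<bar>snd z\<bar> \<le> 2 * s"
    by (rule AE_pair_bounded[OF \<rho> b])
  \<comment> \<open>Any sequence in the open unit interval tending to 1 would do. Adding \<open>2 * ln 2\<close> makes the
    Abel means nonnegative, as Fatou's lemma requires.\<close>
  define r where "r n = 1 - 1 / (real n + 2)" for n
  have r: "0 < r n" "r n < 1" for n by (auto simp: r_def field_simps)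
  have rlim: "r \<longlonglongrightarrow> 1" unfolding r_def by real_asymp
  define F where "F n z = ennreal (abel_kernel s (r n) (fst z) (snd z) + 2 * ln 2)" for n and z :: "real \<times> real"
  have [measurable]: "F n \<in> borel_measurable ?N" for n unfolding F_def by measurable
  have Fint: "(\<integral>\<^sup>+z. F n z \<partial>?N) \<le> ennreal (c + ln s + 2 * ln 2)" for n
  proof -
    note I = integral_abel_kernel_sums[of \<rho> "r n" s, OF \<rho> less_imp_le[OF r(1)] r(2)]
    have "(\<Sum>k. 2 / real k * r n ^ k * (cheb_moment s k \<rho>)\<^sup>2) \<le> c + ln s"
    proof (rule suminf_le_const)
      fix m
      have "(\<Sum>k<m. 2 / real k * r n ^ k * (cheb_moment s k \<rho>)\<^sup>2) \<le> (\<Sum>k\<le>m. 2 / real k * 1 * (cheb_moment s k \<rho>)\<^sup>2)"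
        by (rule sum_le_included[where i = id])
          (use r[of n] in \<open>auto intro!: bexI mult_right_mono divide_right_mono power_le_one\<close>)
      also have "\<dots> \<le> c + ln s" using c by simp
      finally show "(\<Sum>k<m. 2 / real k * r n ^ k * (cheb_moment s k \<rho>)\<^sup>2) \<le> c + ln s" .
    qed (use I in \<open>auto simp: sums_iff\<close>)
    then have J: "(\<integral>z. abel_kernel s (r n) (fst z) (snd z) \<partial>?N) \<le> c + ln s"
      using I(2) by (simp add: sums_iff)
    have "(\<integral>\<^sup>+z. F n z \<partial>?N) = ennreal (\<integral>z. abel_kernel s (r n) (fst z) (snd z) + 2 * ln 2 \<partial>?N)"
      unfolding F_def
    proof (rule nn_integral_eq_integral)
      show "AE z in ?N. 0 \<le> abel_kernel s (r n) (fst z) (snd z) + 2 * ln 2"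
      proof (rule AE_I2)
        fix z show "0 \<le> abel_kernel s (r n) (fst z) (snd z) + 2 * ln 2"
          using abel_kernel_ge[OF r, of s n "fst z" "snd z"] by linarith
      qed
    qed (use I in auto)
    also have "\<dots> \<le> ennreal (c + ln s + 2 * ln 2)"
      using J I(1) P.prob_space by (intro ennreal_leI) simp
    finally show ?thesis .
  qed
  have "(\<integral>\<^sup>+z. liminf (\<lambda>n. F n z) \<partial>?N) \<le> liminf (\<lambda>n. \<integral>\<^sup>+z. F n z \<partial>?N)"
    by (rule nn_integral_liminf) auto
  also have "\<dots> \<le> limsup (\<lambda>n. \<integral>\<^sup>+z. F n z \<partial>?N)"
    by (rule Liminf_le_Limsup) auto
  also have "\<dots> \<le> ennreal (c + ln s + 2 * ln 2)"
    by (rule Limsup_bounded) (use Fint in auto)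
  finally have G: "(\<integral>\<^sup>+z. liminf (\<lambda>n. F n z) \<partial>?N) \<le> ennreal (c + ln s + 2 * ln 2)" .
  have diag: "liminf (\<lambda>n. F n (x, x)) = \<infinity>" for x
  proof -
    have "liminf (\<lambda>n. ennreal (ln (real n + 2))) \<le> liminf (\<lambda>n. F n (x, x))"
    proof (rule Liminf_mono, rule always_eventually, rule allI)
      fix n
      have "ln (real n + 2) \<le> abel_kernel s (r n) x x + 2 * ln 2"
      proof -
        have "1 - r n = 1 / (real n + 2)" by (simp add: r_def)
        moreover have "ln (1 / (real n + 2)) = - ln (real n + 2)" by (simp add: ln_div)
        ultimately have "- ln (1 - r n) = ln (real n + 2)" by simp
        moreover have "0 \<le> ln (2::real)" by simp
        ultimately show ?thesis using abel_kernel_diag_ge[of "r n" s x, OF r] by linarith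
      qed
      then show "ennreal (ln (real n + 2)) \<le> F n (x, x)" unfolding F_def by (intro ennreal_leI) simp
    qed
    moreover have "(\<lambda>n. ennreal (ln (real n + 2))) \<longlonglongrightarrow> \<infinity>"
    proof -
      have "filterlim (\<lambda>n. ln (real n + 2)) at_top sequentially" by real_asymp
      then show ?thesis by (simp add: infinity_ennreal_def ennreal_tendsto_top_eq_at_top)
    qed
    then have "liminf (\<lambda>n. ennreal (ln (real n + 2))) = \<infinity>" by (rule lim_imp_Liminf[rotated]) auto
    ultimately show ?thesis by (simp add: top.extremum_unique)
  qed
  have off: "liminf (\<lambda>n. F n z) = ennreal (?l z + ln s + 2 * ln 2)"
    if "\<bar>fst z\<bar> \<le> 2 * s" "\<bar>snd z\<bar> \<le> 2 * s" "fst z \<noteq> snd z" for z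
  proof (rule lim_imp_Liminf)
    show "(\<lambda>n. F n z) \<longlonglongrightarrow> ennreal (?l z + ln s + 2 * ln 2)"
      unfolding F_def by (intro tendsto_ennrealI tendsto_add tendsto_const abel_kernel_tendsto s that rlim)
  qed auto
  have ae: "AE z in ?N. fst z \<noteq> snd z"
  proof -
    have "AE z in ?N. liminf (\<lambda>n. F n z) \<noteq> \<infinity>"
      by (rule nn_integral_noteq_infinite) (use G in \<open>auto simp: top_unique\<close>)
    then show ?thesis by eventually_elim (metis diag prod.collapse)
  qed
  have nn: "AE z in ?N. 0 \<le> ?l z + ln s + 2 * ln 2"
    using bN ae
  proof eventually_elim
    case (elim z)
    have "ln \<bar>fst z - snd z\<bar> \<le> ln (4 * s)" using elim by (intro ln_mono) auto
    also have "\<dots> = ln s + ln (2 * 2)" using s by (simp add: ln_mult)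
    also have "\<dots> = ln s + 2 * ln 2" by (subst ln_mult) auto
    finally show ?case by simp
  qed
  have H: "(\<integral>\<^sup>+z. ennreal (?l z + ln s + 2 * ln 2) \<partial>?N) \<le> ennreal (c + ln s + 2 * ln 2)"
  proof -
    have "(\<integral>\<^sup>+z. ennreal (?l z + ln s + 2 * ln 2) \<partial>?N) = (\<integral>\<^sup>+z. liminf (\<lambda>n. F n z) \<partial>?N)"
      by (rule nn_integral_cong_AE) (use bN ae in \<open>eventually_elim, simp add: off\<close>)
    with G show ?thesis by simp
  qed
  have int: "integrable ?N (\<lambda>z. ?l z + ln s + 2 * ln 2)"
    by (rule integrableI_nonneg) (use nn H in \<open>auto simp: le_less_trans\<close>)
  have "integrable ?N (\<lambda>z. (?l z + ln s + 2 * ln 2) - (ln s + 2 * ln 2))"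
    by (intro Bochner_Integration.integrable_diff int) auto
  then have intl: "integrable ?N ?l" by simp
  with ae show "finite_energy \<rho>" by (simp add: finite_energy_def)
  have "ennreal (\<integral>z. ?l z + ln s + 2 * ln 2 \<partial>?N) \<le> ennreal (c + ln s + 2 * ln 2)"
    using H nn_integral_eq_integral[OF int nn] by simp
  moreover have "0 \<le> (\<integral>z. ?l z + ln s + 2 * ln 2 \<partial>?N)" by (rule integral_nonneg_AE[OF nn])
  moreover have "0 \<le> c + ln s" using c[of 0] by simp
  ultimately have "(\<integral>z. ?l z + ln s + 2 * ln 2 \<partial>?N) \<le> c + ln s + 2 * ln 2"
    by (subst (asm) ennreal_le_iff) auto
  moreover have "(\<integral>z. ?l z + ln s + 2 * ln 2 \<partial>?N) = energy \<rho> + ln s + 2 * ln 2"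
    using intl P.prob_space by (simp add: energy_def)
  ultimately show "energy \<rho> \<le> c" by simp
qed

section \<open>Near-Fekete points\<close>

lemma AE_prob_measures_on:
  assumes "closed E" "\<rho> \<in> prob_measures_on E" shows "AE x in \<rho>. x \<in> E"
proof -
  interpret real_distribution \<rho> using assms by (simp add: prob_measures_on_def)
  have "prob E = 1" using assms by (simp add: prob_measures_on_def emeasure_eq_measure)
  then show ?thesis using assms by (subst AE_in_set_eq_1) auto
qed

lemma prob_measures_onI:
  assumes "closed E" "real_distribution \<rho>" "AE x in \<rho>. x \<in> E" shows "\<rho> \<in> prob_measures_on E"
proof -
  interpret real_distribution \<rho> by fact
  have "prob E = 1" using assms by (subst AE_in_set_eq_1[symmetric]) auto
  then show ?thesis using assms by (simp add: prob_measures_on_def emeasure_eq_measure)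
qed

lemma integral_average_ex_le:
  fixes g :: "real \<Rightarrow> real"
  assumes "prob_space M" "integrable M g" "AE x in M. P x"
  shows "\<exists>x. P x \<and> g x \<le> integral\<^sup>L M g"
proof (rule ccontr)
  interpret prob_space M by fact
  assume "\<not> ?thesis"
  then have less: "integral\<^sup>L M g < g x" if "P x" for x using that by (auto simp: not_le)
  have "AE x in M. integral\<^sup>L M g < g x" by (rule AE_mp[OF assms(3)]) (auto intro: less)
  then have "(\<integral>x. integral\<^sup>L M g \<partial>M) < integral\<^sup>L M g"
    by (intro integral_less_AE_space) (use assms(2) in \<open>auto simp: emeasure_space_1\<close>)
  then show False by (simp add: prob_space)
qed

text \<open>
  The mean of the pair energy of \<open>n\<close> independent points with law \<open>\<rho>\<close> is \<open>n (n - 1) / 2\<close> times the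
  energy of \<open>\<rho>\<close>, so some configuration is no worse. Instead of a product of \<open>n\<close> copies of \<open>\<rho>\<close> the
  points are chosen one after another, and what does not increase is the conditional mean of the pair
  energy given the points chosen so far: a point that is still to be chosen contributes its potential
  \<open>U\<close> at each chosen point, and two such points contribute the energy.
\<close>

lemma ex_points_energy_le:
  assumes \<rho>: "real_distribution \<rho>" and e: "finite_energy \<rho>" and E: "AE x in \<rho>. x \<in> E"
  shows "\<exists>x::nat \<Rightarrow> real. (\<forall>i<n. x i \<in> E) \<and> inj_on x {..<n} \<and>
     (\<Sum>i<n. \<Sum>j<i. - ln \<bar>x i - x j\<bar>) \<le> real n * (real n - 1) / 2 * energy \<rho>"
proof -
  interpret real_distribution \<rho> by fact
  interpret pair_prob_space \<rho> \<rho> ..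
  let ?N = "\<rho> \<Otimes>\<^sub>M \<rho>" 
  note [measurable_cong] = prob_space_pair_real_distribution(2)[OF \<rho>]
  define U where "U x = (\<integral>y. - ln \<bar>x - y\<bar> \<partial>\<rho>)" for x :: real
  have ae: "AE z in ?N. fst z \<noteq> snd z" and int: "integrable ?N (\<lambda>z. - ln \<bar>fst z - snd z\<bar>)"
    using e by (auto simp: finite_energy_def)
  have int': "integrable ?N (\<lambda>(x, y). - ln \<bar>x - y\<bar>)" using int by (simp add: case_prod_unfold)
  have good1: "AE x in \<rho>. integrable \<rho> (\<lambda>y. - ln \<bar>x - y\<bar>)"
    using AE_integrable_fst'[OF int] by simp
  have good2: "AE x in \<rho>. AE y in \<rho>. x \<noteq> y"
    using AE_pair[OF ae] by simp
  have Uint: "integrable \<rho> U" and Ueq: "integral\<^sup>L \<rho> U = energy \<rho>"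
    using integrable_fst'[OF int] integral_fst'[OF int] unfolding U_def energy_def by simp_all
  define G where "G x \<longleftrightarrow> x \<in> E \<and> integrable \<rho> (\<lambda>y. - ln \<bar>x - y\<bar>) \<and> (AE y in \<rho>. x \<noteq> y)" for x
  have G: "AE x in \<rho>. G x" using good1 good2 E by eventually_elim (simp add: G_def)
  have "\<exists>x::nat \<Rightarrow> real. (\<forall>i<m. G (x i)) \<and> inj_on x {..<m} \<and>
     (\<Sum>i<m. \<Sum>j<i. - ln \<bar>x i - x j\<bar>) + (real n - real m) * (\<Sum>i<m. U (x i))
       \<le> (real m * (real m - 1) / 2 + (real n - real m) * real m) * energy \<rho>" if "m \<le> n" for m
    using that
  proof (induction m)
    case 0 show ?case by simp
  next
    case (Suc m)
    then obtain x where x: "\<forall>i<m. G (x i)" "inj_on x {..<m}" 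
     "(\<Sum>i<m. \<Sum>j<i. - ln \<bar>x i - x j\<bar>) + (real n - real m) * (\<Sum>i<m. U (x i))
       \<le> (real m * (real m - 1) / 2 + (real n - real m) * real m) * energy \<rho>" by auto
    \<comment> \<open>The part of the conditional mean that depends on the next point \<open>y\<close>.\<close>
    define g where "g y = (\<Sum>i<m. - ln \<bar>x i - y\<bar>) + (real n - real m - 1) * U y" for y
    have gi: "integrable \<rho> g" unfolding g_def
      by (intro Bochner_Integration.integrable_add Bochner_Integration.integrable_sum integrable_mult_right Uint)
        (use x(1) in \<open>auto simp: G_def\<close>)
    have geq: "integral\<^sup>L \<rho> g = (\<Sum>i<m. U (x i)) + (real n - real m - 1) * energy \<rho>"
      unfolding g_def
      by (subst Bochner_Integration.integral_add, intro Bochner_Integration.integrable_sum,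
          use x(1) in \<open>simp add: G_def\<close>, use Uint in simp, subst Bochner_Integration.integral_sum,
          use x(1) in \<open>simp add: G_def\<close>, simp add: Ueq, simp add: U_def)
    have "AE y in \<rho>. \<forall>i<m. x i \<noteq> y"
      using x(1) unfolding G_def by (subst AE_all_countable[of "\<lambda>i y. i < m \<longrightarrow> x i \<noteq> y"]) auto
    then have "AE y in \<rho>. G y \<and> (\<forall>i<m. x i \<noteq> y)" using G by eventually_elim simp
    from integral_average_ex_le[OF real_distribution.axioms(1)[OF \<rho>] gi this] obtain y where
      y: "G y" "\<forall>i<m. x i \<noteq> y" "g y \<le> integral\<^sup>L \<rho> g" by blast
    let ?x = "x(m := y)"
    have 1: "\<forall>i<Suc m. G (?x i)" using x(1) y(1) by (auto simp: less_Suc_eq)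
    have 2: "inj_on ?x {..<Suc m}" using x(2) y(2) by (auto simp: lessThan_Suc inj_on_def)
    have e1: "(\<Sum>i<Suc m. \<Sum>j<i. - ln \<bar>?x i - ?x j\<bar>) = (\<Sum>i<m. \<Sum>j<i. - ln \<bar>x i - x j\<bar>) + (\<Sum>i<m. - ln \<bar>x i - y\<bar>)"
      by (simp add: abs_minus_commute)
    have e2: "(\<Sum>i<Suc m. U (?x i)) = (\<Sum>i<m. U (x i)) + U y" by simp
    have "(\<Sum>i<Suc m. \<Sum>j<i. - ln \<bar>?x i - ?x j\<bar>) + (real n - real (Suc m)) * (\<Sum>i<Suc m. U (?x i))
       = (\<Sum>i<m. \<Sum>j<i. - ln \<bar>x i - x j\<bar>) + (real n - real m) * (\<Sum>i<m. U (x i)) + (g y - (\<Sum>i<m. U (x i)))"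
      unfolding e1 e2 g_def by (simp add: algebra_simps)
    also have "\<dots> \<le> (real m * (real m - 1) / 2 + (real n - real m) * real m) * energy \<rho> + (real n - real m - 1) * energy \<rho>"
      using x(3) y(3) unfolding geq by linarith
    also have "\<dots> = (real (Suc m) * (real (Suc m) - 1) / 2 + (real n - real (Suc m)) * real (Suc m)) * energy \<rho>"
      by (simp add: field_simps)
    finally show ?case using 1 2 by blast
  qed
  from this[of n] show ?thesis by (auto simp: G_def)
qed

text \<open>
  Over ordered pairs, so each distance enters squared. A configuration maximising this is a Fekete set.
\<close>

definition pair_prod :: "nat \<Rightarrow> (nat \<Rightarrow> real) \<Rightarrow> real" where
  "pair_prod n x = (\<Prod>i<n. \<Prod>j\<in>{..<n} - {i}. \<bar>x i - x j\<bar>)"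

lemma sum_off_diag_symmetric:
  fixes f :: "nat \<Rightarrow> nat \<Rightarrow> real"
  assumes "\<And>i j. f i j = f j i"
  shows "(\<Sum>i<n. \<Sum>j\<in>{..<n} - {i}. f i j) = 2 * (\<Sum>i<n. \<Sum>j<i. f i j)"
proof (induction n)
  case (Suc n)
  have "(\<Sum>j\<in>{..<Suc n} - {i}. f i j) = (\<Sum>j\<in>{..<n} - {i}. f i j) + f i n" if "i < n" for i
  proof -
    have "{..<Suc n} - {i} = insert n ({..<n} - {i})" using that by auto
    then show ?thesis by simp
  qed
  moreover have "{..<Suc n} - {n} = {..<n}" by auto
  ultimately show ?case using Suc by (simp add: sum.distrib assms[of n])
qed simp

lemma ln_pair_prod:
  assumes "inj_on x {..<n}"
  shows "0 < pair_prod n x" and "ln (pair_prod n x) = (\<Sum>i<n. \<Sum>j\<in>{..<n} - {i}. ln \<bar>x i - x j\<bar>)"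
proof -
  have p: "0 < \<bar>x i - x j\<bar>" if "i < n" "j \<in> {..<n} - {i}" for i j
    using that assms by (auto simp: inj_on_def)
  show "0 < pair_prod n x" unfolding pair_prod_def by (intro prod_pos) (use p in auto)
  have "ln (pair_prod n x) = (\<Sum>i<n. ln (\<Prod>j\<in>{..<n} - {i}. \<bar>x i - x j\<bar>))"
    unfolding pair_prod_def by (intro ln_prod prod_pos) (use p in auto)
  also have "\<dots> = (\<Sum>i<n. \<Sum>j\<in>{..<n} - {i}. ln \<bar>x i - x j\<bar>)"
    by (intro sum.cong refl ln_prod) (use p in auto)
  finally show "ln (pair_prod n x) = (\<Sum>i<n. \<Sum>j\<in>{..<n} - {i}. ln \<bar>x i - x j\<bar>)" .
qed

text \<open>
  Isolates the dependence on the \<open>i\<close>-th point.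
\<close>

lemma pair_prod_split:
  assumes "i < n"
  shows "pair_prod n x = (\<Prod>j\<in>{..<n} - {i}. \<bar>x i - x j\<bar>)\<^sup>2 *
     (\<Prod>k\<in>{..<n} - {i}. \<Prod>j\<in>{..<n} - {k} - {i}. \<bar>x k - x j\<bar>)"
proof -
  have "pair_prod n x = (\<Prod>j\<in>{..<n} - {i}. \<bar>x i - x j\<bar>) * (\<Prod>k\<in>{..<n} - {i}. \<Prod>j\<in>{..<n} - {k}. \<bar>x k - x j\<bar>)"
    unfolding pair_prod_def by (rule prod.remove) (use assms in auto)
  also have "(\<Prod>k\<in>{..<n} - {i}. \<Prod>j\<in>{..<n} - {k}. \<bar>x k - x j\<bar>)
     = (\<Prod>k\<in>{..<n} - {i}. \<bar>x k - x i\<bar> * (\<Prod>j\<in>{..<n} - {k} - {i}. \<bar>x k - x j\<bar>))"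
    by (intro prod.cong refl prod.remove) (use assms in auto)
  finally show ?thesis by (simp add: prod.distrib power2_eq_square abs_minus_commute mult.assoc)
qed

text \<open>
  Each \<open>g j\<close> occurs for every \<open>i\<close> other than \<open>j\<close>.
\<close>

lemma prod_off_diag_power:
  fixes g :: "nat \<Rightarrow> real"
  assumes "n \<ge> 1"
  shows "(\<Prod>i<n. \<Prod>j\<in>{..<n} - {i}. g j) = (\<Prod>j<n. g j) ^ (n - 1)"
  using assms
proof (induction n rule: nat_induct_at_least)
  case base show ?case by (simp add: lessThan_Suc)
next
  case (Suc n)
  have "(\<Prod>j\<in>{..<Suc n} - {i}. g j) = (\<Prod>j\<in>{..<n} - {i}. g j) * g n" if "i < n" for i
  proof -
    have "{..<Suc n} - {i} = insert n ({..<n} - {i})" using that by auto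
    then show ?thesis by simp
  qed
  moreover have "{..<Suc n} - {n} = {..<n}" by auto
  ultimately have "(\<Prod>i<Suc n. \<Prod>j\<in>{..<Suc n} - {i}. g j) = (\<Prod>j<n. g j) ^ (n - 1) * g n ^ n * (\<Prod>j<n. g j)"
    using Suc by (simp add: prod.distrib)
  also have "\<dots> = (\<Prod>j<n. g j) ^ n * g n ^ n"
    using Suc.hyps by (cases n) auto
  finally show ?case by (simp add: power_mult_distrib)
qed

text \<open>
  Replacing the \<open>i\<close>-th point by \<open>y\<close> at most doubles the product over pairs, so the distances from \<open>y\<close>
  to the other points are controlled by those from \<open>x i\<close>. Multiplying these inequalities over all \<open>i\<close>
  gives the power \<open>n - 1\<close> of the polynomial with zeros \<open>x\<close> at \<open>y\<close> on the left and the product over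
  pairs on the right.
\<close>

lemma near_fekete_bound:
  assumes n: "n \<ge> 2" and inj: "inj_on x {..<n}" and xE: "\<And>i. i < n \<Longrightarrow> x i \<in> E"
    and max: "\<And>y. (\<And>i. i < n \<Longrightarrow> y i \<in> E) \<Longrightarrow> pair_prod n y \<le> 2 * pair_prod n x"
    and y: "y \<in> E"
  shows "(\<Prod>j<n. \<bar>y - x j\<bar>) \<le> exp (- (real n * (- ln (pair_prod n x) / (real n * (real n - 1)) - ln 2 / (real n - 1))))"
proof (cases "(\<Prod>j<n. \<bar>y - x j\<bar>) = 0")
  case True show ?thesis by (simp only: True exp_ge_zero)
next
  case False
  let ?F = "\<Prod>j<n. \<bar>y - x j\<bar>"
  have Fpos: "?F > 0" using False by (simp add: prod_nonneg less_le)
  have p: "0 < \<bar>x i - x j\<bar>" if "i < n" "j < n" "j \<noteq> i" for i j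
    using that inj by (auto simp: inj_on_def)
  have step: "(\<Prod>j\<in>{..<n} - {i}. \<bar>y - x j\<bar>) \<le> 2 * (\<Prod>j\<in>{..<n} - {i}. \<bar>x i - x j\<bar>)" if i: "i < n" for i
  proof -
    let ?R = "\<Prod>k\<in>{..<n} - {i}. \<Prod>j\<in>{..<n} - {k} - {i}. \<bar>x k - x j\<bar>"
    have R: "?R > 0" by (intro prod_pos) (use p in auto)
    have "pair_prod n (x(i := y)) = (\<Prod>j\<in>{..<n} - {i}. \<bar>y - x j\<bar>)\<^sup>2 * ?R"
      by (subst pair_prod_split[OF i]) simp
    moreover have "pair_prod n (x(i := y)) \<le> 2 * pair_prod n x"
      by (rule max) (use xE y in auto)
    ultimately have "(\<Prod>j\<in>{..<n} - {i}. \<bar>y - x j\<bar>)\<^sup>2 * ?R \<le> 2 * (\<Prod>j\<in>{..<n} - {i}. \<bar>x i - x j\<bar>)\<^sup>2 * ?R"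
      by (simp add: pair_prod_split[OF i, of x])
    then have "(\<Prod>j\<in>{..<n} - {i}. \<bar>y - x j\<bar>)\<^sup>2 \<le> 2 * (\<Prod>j\<in>{..<n} - {i}. \<bar>x i - x j\<bar>)\<^sup>2"
      using R by simp
    also have "\<dots> \<le> (2 * (\<Prod>j\<in>{..<n} - {i}. \<bar>x i - x j\<bar>))\<^sup>2" by (simp add: power_mult_distrib)
    finally show ?thesis by (rule power2_le_imp_le) (intro mult_nonneg_nonneg prod_nonneg, auto)
  qed
  have "?F ^ (n - 1) = (\<Prod>i<n. \<Prod>j\<in>{..<n} - {i}. \<bar>y - x j\<bar>)"
    by (rule prod_off_diag_power[symmetric]) (use n in simp)
  also have "\<dots> \<le> (\<Prod>i<n. 2 * (\<Prod>j\<in>{..<n} - {i}. \<bar>x i - x j\<bar>))"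
    by (rule prod_mono) (use step in \<open>auto intro: prod_nonneg\<close>)
  also have "\<dots> = 2 ^ n * pair_prod n x" by (simp add: prod.distrib pair_prod_def)
  finally have "ln (?F ^ (n - 1)) \<le> ln (2 ^ n * pair_prod n x)"
    using Fpos ln_pair_prod(1)[OF inj] by (intro ln_mono) auto
  then have "(real n - 1) * ln ?F \<le> real n * ln 2 + ln (pair_prod n x)"
    using Fpos ln_pair_prod(1)[OF inj] n by (simp add: ln_mult ln_realpow of_nat_diff)
  then have "ln ?F \<le> (real n * ln 2 + ln (pair_prod n x)) / (real n - 1)"
    using n by (simp add: field_simps)
  also have "\<dots> = - (real n * (- ln (pair_prod n x) / (real n * (real n - 1)) - ln 2 / (real n - 1)))"
  proof -
    have "real n * (- ln (pair_prod n x) / (real n * (real n - 1))) = - ln (pair_prod n x) / (real n - 1)"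
      using n by simp
    then show ?thesis by (simp add: right_diff_distrib add_divide_distrib)
  qed
  finally have "exp (ln ?F) \<le> exp (- (real n * (- ln (pair_prod n x) / (real n * (real n - 1)) - ln 2 / (real n - 1))))"
    by simp
  then show ?thesis using Fpos by simp
qed

text \<open>
  A configuration within a factor 2 of the supremum serves as well as a maximiser, since the factor
  disappears in the limit of roots of order \<open>n\<close>. The measure of finite energy guarantees that the
  supremum is positive.
\<close>

lemma near_fekete_exists:
  assumes B: "\<And>x. x \<in> E \<Longrightarrow> \<bar>x\<bar> \<le> B" and \<rho>: "real_distribution \<rho>" "finite_energy \<rho>" "AE x in \<rho>. x \<in> E"
  shows "\<exists>x. inj_on x {..<n} \<and> (\<forall>i<n. x i \<in> E) \<and>
    (\<forall>y. (\<forall>i<n. y i \<in> E) \<longrightarrow> pair_prod n y \<le> 2 * pair_prod n x)"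
proof -
  let ?C = "{x. \<forall>i<n. x i \<in> E}"
  have bdd: "bdd_above (pair_prod n ` ?C)"
  proof (rule bdd_aboveI2)
    fix x assume x: "x \<in> ?C"
    show "pair_prod n x \<le> (\<Prod>i<n. \<Prod>j\<in>{..<n} - {i}. 2 * B)"
      unfolding pair_prod_def
    proof (intro prod_mono conjI prod_nonneg)
      fix i j assume "i \<in> {..<n}" "j \<in> {..<n} - {i}"
      then have "\<bar>x i\<bar> \<le> B" "\<bar>x j\<bar> \<le> B" using x B by auto
      then show "\<bar>x i - x j\<bar> \<le> 2 * B" by linarith
    qed auto
  qed
  obtain x0 where x0: "x0 \<in> ?C" "inj_on x0 {..<n}" using ex_points_energy_le[OF \<rho>, of n] by auto
  let ?S = "SUP x\<in>?C. pair_prod n x"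
  have S: "pair_prod n x \<le> ?S" if "x \<in> ?C" for x using that bdd by (rule cSUP_upper)
  have "0 < ?S" using S[OF x0(1)] ln_pair_prod(1)[OF x0(2)] by linarith
  then have "?S / 2 < ?S" by simp
  then obtain x where x: "x \<in> ?C" "?S / 2 < pair_prod n x"
    using less_cSUP_iff[OF _ bdd, of "?S / 2"] x0(1) by blast
  have "inj_on x {..<n}"
  proof (rule ccontr)
    assume "\<not> inj_on x {..<n}"
    then obtain i j where "i < n" "j < n" "i \<noteq> j" "x i = x j" by (auto simp: inj_on_def)
    then have "(\<Prod>j\<in>{..<n} - {i}. \<bar>x i - x j\<bar>) = 0" by (intro prod_zero) auto
    then have "pair_prod n x = 0" unfolding pair_prod_def using \<open>i < n\<close> by (intro prod_zero) auto
    then show False using x(2) \<open>0 < ?S\<close> by simp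
  qed
  moreover have "pair_prod n y \<le> 2 * pair_prod n x" if "\<forall>i<n. y i \<in> E" for y
    using S[of y] that x(2) by simp
  ultimately show ?thesis using x(1) by blast
qed

section \<open>Uniqueness of the equilibrium measure\<close>

text \<open>
  The mixture is the law of a fair coin choosing between two independent samples.
\<close>

lemma mixture_distribution:
  assumes \<rho>: "real_distribution \<rho>" and \<sigma>: "real_distribution \<sigma>"
  shows "\<exists>\<tau>. real_distribution \<tau> \<and>
    (\<forall>f::real \<Rightarrow> real. f \<in> borel_measurable borel \<longrightarrow> (\<forall>x. \<bar>f x\<bar> \<le> 1) \<longrightarrow>
      integral\<^sup>L \<tau> f = (integral\<^sup>L \<rho> f + integral\<^sup>L \<sigma> f) / 2)"
proof -
  interpret \<rho>: real_distribution \<rho> by fact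
  interpret \<sigma>: real_distribution \<sigma> by fact
  let ?b = "measure_pmf (bernoulli_pmf (1 / 2))"
  interpret N: pair_prob_space \<rho> \<sigma> ..
  interpret b: prob_space ?b by (rule prob_space_measure_pmf)
  interpret B: pair_prob_space ?b "\<rho> \<Otimes>\<^sub>M \<sigma>" ..
  let ?h = "\<lambda>(b, x, y). if b then x else (y::real)"
  have [measurable]: "?h \<in> borel_measurable (?b \<Otimes>\<^sub>M (\<rho> \<Otimes>\<^sub>M \<sigma>))"
    by measurable
  let ?t = "distr (?b \<Otimes>\<^sub>M (\<rho> \<Otimes>\<^sub>M \<sigma>)) borel ?h"
  have t: "real_distribution ?t"
  proof -
    interpret prob_space ?t by (rule B.prob_space_distr) simp
    show ?thesis by unfold_locales simp
  qed
  have "integral\<^sup>L ?t f = (integral\<^sup>L \<rho> f + integral\<^sup>L \<sigma> f) / 2"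
    if [measurable]: "f \<in> borel_measurable borel" and f: "\<forall>x. \<bar>f x\<bar> \<le> 1" for f :: "real \<Rightarrow> real"
  proof -
    have "integral\<^sup>L ?t f = (\<integral>z. f (?h z) \<partial>(?b \<Otimes>\<^sub>M (\<rho> \<Otimes>\<^sub>M \<sigma>)))"
      by (rule integral_distr) auto
    also have "\<dots> = (\<integral>b. (\<integral>z. f (?h (b, z)) \<partial>(\<rho> \<Otimes>\<^sub>M \<sigma>)) \<partial>?b)"
      by (rule B.integral_fst'[symmetric], rule B.P.integrable_const_bound[of _ 1]) (use f in auto)
    also have "\<dots> = ((\<integral>z. f (fst z) \<partial>(\<rho> \<Otimes>\<^sub>M \<sigma>)) + (\<integral>z. f (snd z) \<partial>(\<rho> \<Otimes>\<^sub>M \<sigma>))) / 2"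
      by (subst integral_bernoulli_pmf) (auto simp: case_prod_unfold field_simps)
    also have "(\<integral>z. f (fst z) \<partial>(\<rho> \<Otimes>\<^sub>M \<sigma>)) = integral\<^sup>L \<rho> f"
    proof -
      have "(\<integral>z. f (fst z) \<partial>(\<rho> \<Otimes>\<^sub>M \<sigma>)) = (\<integral>x. (\<integral>y. f (fst (x, y)) \<partial>\<sigma>) \<partial>\<rho>)"
        by (rule N.integral_fst'[symmetric], rule N.P.integrable_const_bound[of _ 1]) (use f in auto)
      then show ?thesis using \<sigma>.prob_space by simp
    qed
    also have "(\<integral>z. f (snd z) \<partial>(\<rho> \<Otimes>\<^sub>M \<sigma>)) = integral\<^sup>L \<sigma> f"
    proof -
      have "(\<integral>z. f (snd z) \<partial>(\<rho> \<Otimes>\<^sub>M \<sigma>)) = (\<integral>x. (\<integral>y. f (snd (x, y)) \<partial>\<sigma>) \<partial>\<rho>)"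
        by (rule N.integral_fst'[symmetric], rule N.P.integrable_const_bound[of _ 1]) (use f in auto)
      then show ?thesis using \<rho>.prob_space by simp
    qed
    finally show ?thesis .
  qed
  with t show ?thesis by blast
qed

text \<open>
  The positive capacity of \<open>E\<close> enters as finiteness of the minimal energy. The interval of the
  Chebyshev coordinates is only required to contain \<open>E\<close>, since it must later contain the zeros too.
\<close>

locale positive_capacity =
  fixes E :: "real set" and s :: real
  assumes compact_E: "compact E" and s_pos: "0 < s" and E_bounded: "\<And>x. x \<in> E \<Longrightarrow> \<bar>x\<bar> \<le> 2 * s"
    and finite_min: "min_log_energy E \<noteq> \<infinity>"
begin

definition V :: real where "V = real_of_ereal (min_log_energy E)"

lemma closed_E: "closed E" using compact_E by (rule compact_imp_closed)

lemma prob_measures_on_E: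
  assumes "\<rho> \<in> prob_measures_on E"
  shows "real_distribution \<rho>" "AE x in \<rho>. x \<in> E" "AE x in \<rho>. \<bar>x\<bar> \<le> 2 * s"
proof -
  show "real_distribution \<rho>" using assms by (simp add: prob_measures_on_def)
  show a: "AE x in \<rho>. x \<in> E" using AE_prob_measures_on closed_E assms by blast
  show "AE x in \<rho>. \<bar>x\<bar> \<le> 2 * s" using a by eventually_elim (rule E_bounded)
qed

lemma finite_energy_iff:
  assumes "\<rho> \<in> prob_measures_on E"
  shows "log_energy \<rho> \<noteq> \<infinity> \<longleftrightarrow> finite_energy \<rho>"
  using finite_energyI_log_energy[OF _ s_pos] prob_measures_on_E[OF assms] log_energy_eq_energy by fastforce

lemma energy_ge:
  assumes "\<rho> \<in> prob_measures_on E" "finite_energy \<rho>" shows "- ln s \<le> energy \<rho>"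
  using cheb_moments_le_energy[OF _ s_pos _ assms(2), of 0] prob_measures_on_E[OF assms(1)] by simp

lemma min_log_energy_eq: "min_log_energy E = ereal V"
proof -
  have "ereal (- ln s) \<le> min_log_energy E"
    unfolding min_log_energy_def
  proof (rule INF_greatest)
    fix \<rho> assume \<rho>: "\<rho> \<in> prob_measures_on E"
    show "ereal (- ln s) \<le> log_energy \<rho>"
    proof (cases "finite_energy \<rho>")
      case True then show ?thesis using energy_ge[OF \<rho>] log_energy_eq_energy by simp
    next
      case False then show ?thesis using finite_energy_iff[OF \<rho>] by simp
    qed
  qed
  then have "min_log_energy E \<noteq> -\<infinity>" by auto
  with finite_min show ?thesis unfolding V_def by (cases "min_log_energy E") auto
qed

lemma V_le_energy:
  assumes "\<rho> \<in> prob_measures_on E" "finite_energy \<rho>" shows "V \<le> energy \<rho>"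
proof -
  have "min_log_energy E \<le> log_energy \<rho>" unfolding min_log_energy_def by (rule INF_lower) fact
  then show ?thesis using assms(2) by (simp add: min_log_energy_eq log_energy_eq_energy)
qed

lemma ex_energy_less:
  assumes "V < c"
  shows "\<exists>\<rho>\<in>prob_measures_on E. finite_energy \<rho> \<and> energy \<rho> < c"
proof -
  have "min_log_energy E < ereal c" using assms by (simp add: min_log_energy_eq)
  then obtain \<rho> where \<rho>: "\<rho> \<in> prob_measures_on E" "log_energy \<rho> < ereal c"
    unfolding min_log_energy_def by (auto simp: INF_less_iff)
  then have "finite_energy \<rho>" using finite_energy_iff[OF \<rho>(1)] by auto
  then show ?thesis using \<rho> log_energy_eq_energy by fastforce
qed

definition minimiser :: "real measure \<Rightarrow> bool" where
  "minimiser \<rho> \<longleftrightarrow> \<rho> \<in> prob_measures_on E \<and> finite_energy \<rho> \<and> energy \<rho> = V"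

text \<open>
  The energy is a sum of squares of moments, which depend linearly on the measure. By the
  parallelogram identity the mean of two minimisers has energy at most \<open>V\<close> minus a multiple of
  the squared differences of their moments, so all of these vanish.
\<close>

lemma minimiser_unique:
  assumes \<rho>: "minimiser \<rho>" and \<sigma>: "minimiser \<sigma>" shows "\<rho> = \<sigma>"
proof -
  note pr = prob_measures_on_E[of \<rho>] and ps = prob_measures_on_E[of \<sigma>]
  have \<rho>E: "\<rho> \<in> prob_measures_on E" "finite_energy \<rho>" "energy \<rho> = V"
    and \<sigma>E: "\<sigma> \<in> prob_measures_on E" "finite_energy \<sigma>" "energy \<sigma> = V"
    using \<rho> \<sigma> by (auto simp: minimiser_def)
  obtain \<tau> where \<tau>: "real_distribution \<tau>" 
    "\<And>f::real \<Rightarrow> real. f \<in> borel_measurable borel \<Longrightarrow> (\<And>x. \<bar>f x\<bar> \<le> 1) \<Longrightarrow>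
      integral\<^sup>L \<tau> f = (integral\<^sup>L \<rho> f + integral\<^sup>L \<sigma> f) / 2"
    using mixture_distribution[OF pr(1) ps(1)] \<rho>E \<sigma>E by blast
  interpret \<rho>: real_distribution \<rho> by (rule pr(1)[OF \<rho>E(1)])
  interpret \<sigma>: real_distribution \<sigma> by (rule ps(1)[OF \<sigma>E(1)])
  interpret \<tau>: real_distribution \<tau> by fact
  have Eb: "E \<in> sets borel" using closed_E by simp
  have "\<tau>.prob E = 1"
  proof -
    have "\<tau>.prob E = integral\<^sup>L \<tau> (indicator E)" using Eb by simp
    also have "\<dots> = (integral\<^sup>L \<rho> (indicator E) + integral\<^sup>L \<sigma> (indicator E)) / 2"
      by (rule \<tau>(2)) (use Eb in \<open>auto simp: indicator_def\<close>)
    also have "\<dots> = (\<rho>.prob E + \<sigma>.prob E) / 2" using Eb by simp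
    also have "\<dots> = 1" using \<rho>E(1) \<sigma>E(1)
      by (simp add: prob_measures_on_def \<rho>.emeasure_eq_measure \<sigma>.emeasure_eq_measure)
    finally show ?thesis .
  qed
  then have \<tau>E: "\<tau> \<in> prob_measures_on E" using \<tau>(1)
    by (simp add: prob_measures_on_def \<tau>.emeasure_eq_measure)
  have m\<tau>: "cheb_moment s k \<tau> = (cheb_moment s k \<rho> + cheb_moment s k \<sigma>) / 2" for k
    unfolding cheb_moment_def by (rule \<tau>(2)) (auto simp: abs_cheb_le_1)
  let ?d = "\<lambda>k. (cheb_moment s k \<rho> - cheb_moment s k \<sigma>)\<^sup>2"
  \<comment> \<open>The parallelogram identity for the moments of the mixture.\<close>
  have par: "2 / real k * (cheb_moment s k \<tau>)\<^sup>2 = (2 / real k * (cheb_moment s k \<rho>)\<^sup>2 + 2 / real k * (cheb_moment s k \<sigma>)\<^sup>2) / 2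
     - 1 / (2 * real k) * ?d k" for k
    unfolding m\<tau> by (cases "k = 0") (auto simp: field_simps power2_eq_square)
  have Sle: "cheb_sum s K \<tau> \<le> V + ln s - (\<Sum>k\<le>K. 1 / (2 * real k) * ?d k)" for K
  proof -
    have "cheb_sum s K \<rho> \<le> V + ln s"
      using cheb_moments_le_energy[OF pr(1) s_pos pr(3)] \<rho>E by force
    moreover have "cheb_sum s K \<sigma> \<le> V + ln s"
      using cheb_moments_le_energy[OF ps(1) s_pos ps(3)] \<sigma>E by force
    ultimately show ?thesis
      unfolding par by (simp add: sum_subtractf sum_divide_distrib[symmetric] sum.distrib)
  qed
  have d0: "?d k = 0" if "k > 0" for k
  proof (rule ccontr)
    assume "?d k \<noteq> 0"
    then have dk: "0 < 1 / (2 * real k) * ?d k" using that by simp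
    have mono: "1 / (2 * real k) * ?d k \<le> (\<Sum>j\<le>K. 1 / (2 * real j) * ?d j)" if "k \<le> K" for K
      by (rule member_le_sum) (use that in auto)
    have "(\<Sum>j\<le>K. 2 / real j * (cheb_moment s j \<tau>)\<^sup>2) \<le> (V - 1 / (2 * real k) * ?d k) + ln s" for K
    proof -
      have "(\<Sum>j\<le>K. 2 / real j * (cheb_moment s j \<tau>)\<^sup>2) \<le> (\<Sum>j\<le>max k K. 2 / real j * (cheb_moment s j \<tau>)\<^sup>2)"
        by (rule sum_mono2) auto
      also have "\<dots> \<le> V + ln s - (\<Sum>j\<le>max k K. 1 / (2 * real j) * ?d j)" by (rule Sle)
      also have "\<dots> \<le> (V - 1 / (2 * real k) * ?d k) + ln s" using mono[of "max k K"] by simp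
      finally show ?thesis .
    qed
    from energy_le_cheb_moments[OF \<tau>(1) s_pos prob_measures_on_E(3)[OF \<tau>E] this]
    have "finite_energy \<tau>" "energy \<tau> \<le> V - 1 / (2 * real k) * ?d k" .
    with V_le_energy[OF \<tau>E] dk show False by linarith
  qed
  have "cheb_moment s k \<rho> = cheb_moment s k \<sigma>" for k
  proof (cases "k = 0")
    case True then show ?thesis
      using \<rho>.prob_space \<sigma>.prob_space by (simp add: cheb_moment_def cheb_def)
  qed (use d0 in auto)
  then show ?thesis
    by (intro distribution_eqI_cheb_moments[OF pr(1) ps(1) s_pos pr(3) ps(3)] \<rho>E \<sigma>E)
qed

lemma equilibrium_measure_eqI:
  assumes "minimiser \<rho>" shows "equilibrium_measure E = \<rho>"
  unfolding equilibrium_measure_def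
proof (rule the_equality)
  show "\<rho> \<in> prob_measures_on E \<and> log_energy \<rho> = min_log_energy E"
    using assms by (auto simp: minimiser_def log_energy_eq_energy min_log_energy_eq)
next
  fix \<sigma> assume \<sigma>: "\<sigma> \<in> prob_measures_on E \<and> log_energy \<sigma> = min_log_energy E"
  then have "finite_energy \<sigma>" using finite_energy_iff[of \<sigma>] by (auto simp: min_log_energy_eq)
  then have "minimiser \<sigma>" using \<sigma> by (auto simp: minimiser_def log_energy_eq_energy min_log_energy_eq)
  with assms show "\<sigma> = \<rho>" by (blast intro: minimiser_unique)
qed

end

section \<open>Convergence of near-Fekete measures to the equilibrium measure\<close>

definition empirical :: "nat \<Rightarrow> (nat \<Rightarrow> real) \<Rightarrow> real measure" where
  "empirical n x = distr (uniform_count_measure {..<n}) borel x"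

lemma real_distribution_empirical:
  assumes "n \<ge> 1" shows "real_distribution (empirical n x)"
proof -
  interpret U: prob_space "uniform_count_measure {..<n}"
    by (rule prob_space_uniform_count_measure) (use assms in \<open>auto simp: lessThan_empty_iff\<close>)
  have "prob_space (empirical n x)" unfolding empirical_def
    by (rule U.prob_space_distr) (simp add: measurable_def sets_uniform_count_measure space_uniform_count_measure)
  then show ?thesis by (simp add: real_distribution_def real_distribution_axioms_def empirical_def)
qed

lemma integral_empirical:
  fixes f :: "real \<Rightarrow> real"
  assumes "n \<ge> 1" and [measurable]: "f \<in> borel_measurable borel"
  shows "integral\<^sup>L (empirical n x) f = (\<Sum>i<n. f (x i)) / real n"
proof -
  have "integral\<^sup>L (empirical n x) f = (\<integral>i. f (x i) \<partial>uniform_count_measure {..<n})"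
    unfolding empirical_def
    by (rule integral_distr[OF _ assms(2)])
      (simp add: measurable_def sets_uniform_count_measure space_uniform_count_measure)
  also have "\<dots> = (\<Sum>i<n. f (x i)) / real n"
    by (simp add: integral_uniform_count_measure)
  finally show ?thesis .
qed

lemma AE_empirical:
  assumes "n \<ge> 1" "\<And>i. i < n \<Longrightarrow> x i \<in> A" "A \<in> sets borel"
  shows "AE y in empirical n x. y \<in> A"
  unfolding empirical_def
  by (subst AE_distr_iff) 
     (use assms in \<open>auto simp: measurable_def sets_uniform_count_measure space_uniform_count_measure intro!: AE_I2\<close>)

lemma tight_bounded:
  assumes "\<And>n. real_distribution (M n)" "\<And>n. AE x in M n. \<bar>x\<bar> \<le> B" shows "tight M"
  unfolding tight_def
proof (intro conjI allI impI assms(1))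
  fix \<epsilon> :: real assume "\<epsilon> > 0"
  have "measure (M n) {- \<bar>B\<bar> - 1<..\<bar>B\<bar>} = 1" for n
  proof -
    interpret real_distribution "M n" by fact
    have "AE x in M n. x \<in> {- \<bar>B\<bar> - 1<..\<bar>B\<bar>}"
      using assms(2)[of n] by eventually_elim auto
    then show ?thesis by (subst (asm) AE_in_set_eq_1) auto
  qed
  then have "\<forall>n. 1 - \<epsilon> < measure (M n) {- \<bar>B\<bar> - 1<..\<bar>B\<bar>}" using \<open>\<epsilon> > 0\<close> by simp
  moreover have "- \<bar>B\<bar> - 1 < \<bar>B\<bar>" by linarith
  ultimately show "\<exists>a b. a < b \<and> (\<forall>n. 1 - \<epsilon> < measure (M n) {a<..b})" by blast
qed

text \<open>
  Test the weak convergence against the truncated distance to the closed set.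
\<close>

lemma weak_limit_supported:
  fixes A :: "real set"
  assumes "\<And>n. real_distribution (M n)" "real_distribution \<nu>" "weak_conv_m M \<nu>"
    and A: "closed A" "A \<noteq> {}" and ae: "\<And>n. AE x in M n. x \<in> A"
  shows "AE x in \<nu>. x \<in> A"
proof -
  interpret \<nu>: real_distribution \<nu> by fact
  let ?f = "\<lambda>x. min 1 (infdist x A)"
  have c: "continuous_on UNIV ?f" by (intro continuous_intros)
  have "(\<lambda>n. integral\<^sup>L (M n) ?f) \<longlonglongrightarrow> integral\<^sup>L \<nu> ?f"
    by (rule weak_conv_imp_integral_bdd_continuous_conv[OF assms(1-3), of _ 1])
      (use c in \<open>auto simp: continuous_on_eq_continuous_at infdist_nonneg\<close>)
  moreover have "integral\<^sup>L (M n) ?f = 0" for n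
    by (rule integral_eq_zero_AE) (use ae[of n] in \<open>eventually_elim, simp add: infdist_nonneg\<close>)
  ultimately have "integral\<^sup>L \<nu> ?f = 0" by (simp add: LIMSEQ_const_iff)
  moreover have "integrable \<nu> ?f"
    by (rule \<nu>.integrable_const_bound[of _ 1])
       (use borel_measurable_continuous_onI[OF c] in \<open>auto simp: infdist_nonneg\<close>)
  ultimately have "AE x in \<nu>. ?f x = 0"
    by (subst (asm) integral_nonneg_eq_0_iff_AE) (auto simp: infdist_nonneg)
  then show ?thesis
    by eventually_elim (use A in \<open>auto simp: in_closed_iff_infdist_zero min_def split: if_splits\<close>)
qed

lemma weak_conv_cheb_moment:
  assumes "\<And>n. real_distribution (M n)" "real_distribution \<nu>" "weak_conv_m M \<nu>"
  shows "(\<lambda>n. cheb_moment s k (M n)) \<longlonglongrightarrow> cheb_moment s k \<nu>"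
  unfolding cheb_moment_def
  by (rule weak_conv_imp_integral_bdd_continuous_conv[OF assms, of _ 1])
    (auto simp: abs_cheb_le_1 continuous_cheb)

text \<open>
  The Abel mean of the energy of an empirical measure is a double sum. Off-diagonal terms are bounded
  by the pair energy, and the \<open>n\<close> diagonal terms, each bounded by \<open>- 2 ln (1 - r)\<close>, are negligible
  after division by the square of \<open>n\<close>.
\<close>

lemma empirical_cheb_moments_le:
  assumes n: "n \<ge> 2" and s: "0 < s" and b: "\<And>i. i < n \<Longrightarrow> \<bar>x i\<bar> \<le> 2 * s" and inj: "inj_on x {..<n}"
    and r: "0 < r" "r < 1"
  shows "abel_sum s r K (empirical n x) \<le>
    (real n - 1) / real n * (- ln (pair_prod n x) / (real n * (real n - 1)) + ln s - ln r) - 2 * ln (1 - r) / real n"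
proof -
  have m: "cheb_moment s k (empirical n x) = (\<Sum>i<n. cheb s k (x i)) / real n" for k
    unfolding cheb_moment_def by (rule integral_empirical) (use n in auto)
  have sq: "(cheb_moment s k (empirical n x))\<^sup>2 = (\<Sum>i<n. \<Sum>j<n. cheb s k (x i) * cheb s k (x j)) / (real n)\<^sup>2" for k
    unfolding m by (simp add: power_divide power2_eq_square sum_product)
  have "(\<lambda>k. \<Sum>i<n. \<Sum>j<n. 2 / real k * r ^ k * (cheb s k (x i) * cheb s k (x j))) sums
     (\<Sum>i<n. \<Sum>j<n. abel_kernel s r (x i) (x j))"
    by (intro sums_sum abel_kernel_sums) (use r in auto)
  from sums_divide[OF this, of "(real n)\<^sup>2"]
  have S: "(\<lambda>k. 2 / real k * r ^ k * (cheb_moment s k (empirical n x))\<^sup>2) sums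
     ((\<Sum>i<n. \<Sum>j<n. abel_kernel s r (x i) (x j)) / (real n)\<^sup>2)"
    unfolding sq by (simp add: sum_distrib_left sum_divide_distrib)
  have "abel_sum s r K (empirical n x) \<le>
     (\<Sum>i<n. \<Sum>j<n. abel_kernel s r (x i) (x j)) / (real n)\<^sup>2"
    unfolding sums_unique[OF S] by (rule sum_le_suminf) (use S r in \<open>auto simp: sums_iff\<close>)
  also have "(\<Sum>i<n. \<Sum>j<n. abel_kernel s r (x i) (x j))
     \<le> (\<Sum>i<n. - 2 * ln (1 - r) + (\<Sum>j\<in>{..<n} - {i}. - ln \<bar>x i - x j\<bar> + ln s - ln r))"
  proof (rule sum_mono)
    fix i assume i: "i \<in> {..<n}"
    have "(\<Sum>j<n. abel_kernel s r (x i) (x j)) = abel_kernel s r (x i) (x i) + (\<Sum>j\<in>{..<n} - {i}. abel_kernel s r (x i) (x j))"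
      by (rule sum.remove) (use i in auto)
    also have "\<dots> \<le> - 2 * ln (1 - r) + (\<Sum>j\<in>{..<n} - {i}. - ln \<bar>x i - x j\<bar> + ln s - ln r)"
      by (intro add_mono sum_mono abel_kernel_le abel_kernel_le_diag)
        (use s b i inj r in \<open>auto simp: inj_on_def\<close>)
    finally show "(\<Sum>j<n. abel_kernel s r (x i) (x j)) \<le> - 2 * ln (1 - r) + (\<Sum>j\<in>{..<n} - {i}. - ln \<bar>x i - x j\<bar> + ln s - ln r)" .
  qed
  also have "\<dots> = - 2 * real n * ln (1 - r) - ln (pair_prod n x) + real n * (real n - 1) * (ln s - ln r)"
  proof -
    have "(\<Sum>j\<in>{..<n} - {i}. - ln \<bar>x i - x j\<bar> + ln s - ln r) = - (\<Sum>j\<in>{..<n} - {i}. ln \<bar>x i - x j\<bar>) + (real n - 1) * (ln s - ln r)"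
      if "i < n" for i
    proof -
      have "card ({..<n} - {i}) = n - 1" using that by simp
      then have "(\<Sum>j\<in>{..<n} - {i}. ln s - ln r) = (real n - 1) * (ln s - ln r)" 
        using n by (simp add: of_nat_diff)
      then show ?thesis by (simp add: sum_negf sum.distrib sum_subtractf algebra_simps)
    qed
    then have "(\<Sum>i<n. - 2 * ln (1 - r) + (\<Sum>j\<in>{..<n} - {i}. - ln \<bar>x i - x j\<bar> + ln s - ln r))
      = (\<Sum>i<n. - 2 * ln (1 - r) + (- (\<Sum>j\<in>{..<n} - {i}. ln \<bar>x i - x j\<bar>) + (real n - 1) * (ln s - ln r)))"
      by (intro sum.cong) auto
    also have "\<dots> = - 2 * real n * ln (1 - r) - ln (pair_prod n x) + real n * (real n - 1) * (ln s - ln r)"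
      unfolding ln_pair_prod(2)[OF inj] by (simp add: sum.distrib sum_negf sum_subtractf algebra_simps)
    finally show ?thesis .
  qed
  also have "(- 2 * real n * ln (1 - r) - ln (pair_prod n x) + real n * (real n - 1) * (ln s - ln r)) / (real n)\<^sup>2
     = (real n - 1) / real n * (- ln (pair_prod n x) / (real n * (real n - 1)) + ln s - ln r) - 2 * ln (1 - r) / real n"
  proof -
    define a where "a = real n"
    have a: "a \<noteq> 0" "a - 1 \<noteq> 0" using n by (auto simp: a_def)
    have "(a - 1) / a * (P / (a * (a - 1)) + Q) - 2 * L / a = (- 2 * a * L + P + a * (a - 1) * Q) / a\<^sup>2" for P Q L
    proof -
      have "(a - 1) / a * (P / (a * (a - 1))) = P / a\<^sup>2" using a by (simp add: power2_eq_square)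
      moreover have "(a - 1) / a * Q = a * (a - 1) * Q / a\<^sup>2" using a by (simp add: power2_eq_square)
      moreover have "2 * L / a = 2 * a * L / a\<^sup>2" using a by (simp add: power2_eq_square)
      ultimately show ?thesis by (simp add: distrib_left add_divide_distrib diff_divide_distrib)
    qed
    from this[of "- ln (pair_prod n x)" "ln s - ln r" "ln (1 - r)"] show ?thesis
      unfolding a_def by (simp add: algebra_simps)
  qed
  finally show ?thesis by (simp add: divide_right_mono)
qed

lemma eventually_less_of_tendsto:
  fixes f g :: "nat \<Rightarrow> real"
  assumes "f \<longlonglongrightarrow> a" "g \<longlonglongrightarrow> b" "a < b" shows "eventually (\<lambda>n. f n < g n) sequentially"
proof -
  obtain c where "a < c" "c < b" using dense assms(3) by blast
  then have "eventually (\<lambda>n. f n < c) sequentially" "eventually (\<lambda>n. c < g n) sequentially"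
    using order_tendstoD assms by blast+
  then show ?thesis by eventually_elim simp
qed

context positive_capacity
begin

definition fekete :: "nat \<Rightarrow> nat \<Rightarrow> real" where
  "fekete n = (SOME x. inj_on x {..<n} \<and> (\<forall>i<n. x i \<in> E) \<and>
    (\<forall>y. (\<forall>i<n. y i \<in> E) \<longrightarrow> pair_prod n y \<le> 2 * pair_prod n x))"

lemma fekete:
  shows "inj_on (fekete n) {..<n}" "\<And>i. i < n \<Longrightarrow> fekete n i \<in> E"
    "\<And>y. (\<And>i. i < n \<Longrightarrow> y i \<in> E) \<Longrightarrow> pair_prod n y \<le> 2 * pair_prod n (fekete n)"
proof -
  obtain \<rho> where \<rho>: "\<rho> \<in> prob_measures_on E" "finite_energy \<rho>"
    using ex_energy_less[of "V + 1"] by auto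
  have "\<exists>x. inj_on x {..<n} \<and> (\<forall>i<n. x i \<in> E) \<and>
    (\<forall>y. (\<forall>i<n. y i \<in> E) \<longrightarrow> pair_prod n y \<le> 2 * pair_prod n x)"
    by (rule near_fekete_exists[OF E_bounded]) (use \<rho> prob_measures_on_E in auto)
  from someI_ex[OF this, folded fekete_def]
  show "inj_on (fekete n) {..<n}" "\<And>i. i < n \<Longrightarrow> fekete n i \<in> E"
    "\<And>y. (\<And>i. i < n \<Longrightarrow> y i \<in> E) \<Longrightarrow> pair_prod n y \<le> 2 * pair_prod n (fekete n)" by auto
qed

text \<open>
  The mean of \<open>- ln |x - y|\<close> over ordered pairs of distinct points of the configuration.
\<close>

definition fekete_energy :: "nat \<Rightarrow> real" where
  "fekete_energy n = - ln (pair_prod n (fekete n)) / (real n * (real n - 1))"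

text \<open>
  A configuration chosen by averaging over a measure of almost minimal energy cannot be better than a
  near-Fekete set by more than the factor 2.
\<close>

lemma fekete_energy_le:
  assumes n: "n \<ge> 2" shows "fekete_energy n \<le> V + ln 2 / (real n * (real n - 1))"
proof -
  have n2: "0 < real n * (real n - 1)" using n by simp
  show ?thesis
  proof (rule ccontr)
    assume "\<not> ?thesis"
    then have "V < fekete_energy n - ln 2 / (real n * (real n - 1))" by simp
    then obtain \<rho> where \<rho>: "\<rho> \<in> prob_measures_on E" "finite_energy \<rho>"
      "energy \<rho> < fekete_energy n - ln 2 / (real n * (real n - 1))" using ex_energy_less by blast
    obtain x where x: "\<forall>i<n. x i \<in> E" "inj_on x {..<n}"
     "(\<Sum>i<n. \<Sum>j<i. - ln \<bar>x i - x j\<bar>) \<le> real n * (real n - 1) / 2 * energy \<rho>"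
      using ex_points_energy_le[OF prob_measures_on_E(1)[OF \<rho>(1)] \<rho>(2) prob_measures_on_E(2)[OF \<rho>(1)]] by blast
    have "- ln (pair_prod n x) = 2 * (\<Sum>i<n. \<Sum>j<i. - ln \<bar>x i - x j\<bar>)"
      unfolding ln_pair_prod(2)[OF x(2)]
      by (subst sum_off_diag_symmetric) (auto simp: abs_minus_commute sum_negf)
    then have "- ln (pair_prod n x) \<le> real n * (real n - 1) * energy \<rho>"
      using x(3) mult_left_mono[OF x(3), of 2] by simp
    moreover have "ln (pair_prod n x) \<le> ln (2 * pair_prod n (fekete n))"
      using fekete(3)[of n x] x(1) ln_pair_prod(1)[OF x(2)] by (intro ln_mono) auto
    moreover have "\<dots> = ln 2 + ln (pair_prod n (fekete n))"
      using ln_pair_prod(1)[OF fekete(1), of n] by (subst ln_mult) auto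
    ultimately have "- ln (pair_prod n (fekete n)) - ln 2 \<le> real n * (real n - 1) * energy \<rho>" by linarith
    then have "(- ln (pair_prod n (fekete n)) - ln 2) / (real n * (real n - 1)) \<le> energy \<rho>"
      using n2 by (subst pos_divide_le_eq) (auto simp: mult.commute)
    then show False using \<rho>(3) unfolding fekete_energy_def by (simp add: diff_divide_distrib)
  qed
qed

lemma fekete_polynomial_le:
  assumes "n \<ge> 2" "y \<in> E"
  shows "(\<Prod>j<n. \<bar>y - fekete n j\<bar>) \<le> exp (- (real n * (fekete_energy n - ln 2 / (real n - 1))))"
  unfolding fekete_energy_def by (rule near_fekete_bound) (use assms fekete in auto)

lemma E_nonempty: "E \<noteq> {}" using fekete(2)[of 0 1] by auto

text \<open>
  The shift by 2 avoids configurations without pairs, for which the mean pair energy is meaningless.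
\<close>

definition fekete_measure :: "nat \<Rightarrow> real measure" where
  "fekete_measure n = empirical (n + 2) (fekete (n + 2))"

lemma fekete_measure:
  shows "real_distribution (fekete_measure n)" "AE x in fekete_measure n. x \<in> E"
    "AE x in fekete_measure n. \<bar>x\<bar> \<le> 2 * s"
proof -
  show "real_distribution (fekete_measure n)" unfolding fekete_measure_def
    by (rule real_distribution_empirical) simp
  show a: "AE x in fekete_measure n. x \<in> E" unfolding fekete_measure_def
    by (rule AE_empirical) (use fekete closed_E in auto)
  show "AE x in fekete_measure n. \<bar>x\<bar> \<le> 2 * s" using a by eventually_elim (rule E_bounded)
qed

lemma fekete_cheb_moments_le:
  assumes "0 < r" "r < 1"
  shows "abel_sum s r K (fekete_measure n) \<le>
    (real (n + 2) - 1) / real (n + 2) * (fekete_energy (n + 2) + ln s - ln r) - 2 * ln (1 - r) / real (n + 2)"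
  unfolding fekete_energy_def fekete_measure_def
  by (rule empirical_cheb_moments_le) (use s_pos fekete E_bounded assms in auto)

text \<open>
  Finitely many moments pass to the weak limit, and by the energy formula finite partial sums of
  their squares are all that is needed to bound the energy of the limit by \<open>V\<close>.
\<close>

lemma fekete_weak_limit_minimiser:
  assumes t: "strict_mono t" and \<eta>: "real_distribution \<eta>" "weak_conv_m (fekete_measure \<circ> t) \<eta>"
  shows "minimiser \<eta>"
proof -
  have rd: "real_distribution ((fekete_measure \<circ> t) n)" for n by (simp add: fekete_measure)
  have aeE: "AE x in \<eta>. x \<in> E"
    by (rule weak_limit_supported[OF rd \<eta> closed_E E_nonempty])
       (simp only: comp_apply fekete_measure(2))
  then have \<eta>E: "\<eta> \<in> prob_measures_on E" by (rule prob_measures_onI[OF closed_E \<eta>(1)])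
  have "cheb_sum s K \<eta> \<le> V + ln s" for K
  proof (rule cheb_sum_le_of_abel)
    fix r :: real assume r: "0 < r" "r < 1"
    have tlim: "filterlim t at_top sequentially" using t by (rule filterlim_subseq)
    have "(\<lambda>n. abel_sum s r K ((fekete_measure \<circ> t) n))
      \<longlonglongrightarrow> abel_sum s r K \<eta>"
      by (intro tendsto_intros weak_conv_cheb_moment rd \<eta>)
    moreover have "(\<lambda>n. (real (t n + 2) - 1) / real (t n + 2) * 
        (V + ln 2 / (real (t n + 2) * (real (t n + 2) - 1)) + ln s - ln r) - 2 * ln (1 - r) / real (t n + 2))
       \<longlonglongrightarrow> V + ln s - ln r"
    proof -
      have "(\<lambda>n. (real (n + 2) - 1) / real (n + 2) * 
        (V + ln 2 / (real (n + 2) * (real (n + 2) - 1)) + ln s - ln r) - 2 * ln (1 - r) / real (n + 2))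
       \<longlonglongrightarrow> 1 * (V + 0 + ln s - ln r) - 0"
      proof (intro tendsto_intros)
        show "(\<lambda>n. (real (n + 2) - 1) / real (n + 2)) \<longlonglongrightarrow> 1" by real_asymp
        show "(\<lambda>n. ln 2 / (real (n + 2) * (real (n + 2) - 1))) \<longlonglongrightarrow> 0" by real_asymp
        show "(\<lambda>n. 2 * ln (1 - r) / real (n + 2)) \<longlonglongrightarrow> 0"
          by (rule real_tendsto_divide_at_top[OF tendsto_const]) real_asymp
      qed
      from filterlim_compose[OF this tlim] show ?thesis by simp
    qed
    moreover have "abel_sum s r K ((fekete_measure \<circ> t) n) \<le>
       (real (t n + 2) - 1) / real (t n + 2) * 
        (V + ln 2 / (real (t n + 2) * (real (t n + 2) - 1)) + ln s - ln r) - 2 * ln (1 - r) / real (t n + 2)" for n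
    proof -
      have "abel_sum s r K ((fekete_measure \<circ> t) n) \<le>
         (real (t n + 2) - 1) / real (t n + 2) * (fekete_energy (t n + 2) + ln s - ln r) - 2 * ln (1 - r) / real (t n + 2)"
        using fekete_cheb_moments_le[OF r] by simp
      also have "\<dots> \<le> (real (t n + 2) - 1) / real (t n + 2) * 
        (V + ln 2 / (real (t n + 2) * (real (t n + 2) - 1)) + ln s - ln r) - 2 * ln (1 - r) / real (t n + 2)"
        by (intro diff_right_mono mult_left_mono add_right_mono fekete_energy_le) auto
      finally show ?thesis .
    qed
    ultimately show "abel_sum s r K \<eta> \<le> V + ln s - ln r"
      by (intro LIMSEQ_le) auto
  qed
  from energy_le_cheb_moments[OF \<eta>(1) s_pos prob_measures_on_E(3)[OF \<eta>E] this]
  have "finite_energy \<eta>" "energy \<eta> \<le> V" .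
  then show ?thesis using V_le_energy[OF \<eta>E] \<eta>E by (simp add: minimiser_def)
qed

lemma minimiser_equilibrium_measure: "minimiser (equilibrium_measure E)"
proof -
  have "tight fekete_measure" by (rule tight_bounded[OF fekete_measure(1,3)])
  from tight_imp_convergent_subsubsequence[OF this strict_mono_id]
  obtain r \<eta> where "strict_mono r" "real_distribution \<eta>" "weak_conv_m (fekete_measure \<circ> r) \<eta>"
    by auto
  then have "minimiser \<eta>" by (rule fekete_weak_limit_minimiser)
  then show ?thesis using equilibrium_measure_eqI by simp
qed

lemma equilibrium_measure:
  shows "real_distribution (equilibrium_measure E)" "AE x in equilibrium_measure E. x \<in> E"
  using minimiser_equilibrium_measure prob_measures_on_E by (auto simp: minimiser_def)

lemma fekete_measure_weak_conv: "weak_conv_m fekete_measure (equilibrium_measure E)"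
proof (rule tight_subseq_weak_converge[OF fekete_measure(1) equilibrium_measure(1)])
  show "tight fekete_measure" by (rule tight_bounded[OF fekete_measure(1,3)])
  fix t \<eta> assume "strict_mono t" "real_distribution \<eta>" "weak_conv_m (fekete_measure \<circ> t) \<eta>"
  then show "weak_conv_m (fekete_measure \<circ> t) (equilibrium_measure E)"
    using equilibrium_measure_eqI[OF fekete_weak_limit_minimiser] by simp
qed

text \<open>
  If the energy of the limit exceeds \<open>c\<close>, so does a finite Abel sum of its moments. The corresponding
  sums for the near-Fekete measures converge to it and are bounded by the mean pair energies.
\<close>

lemma fekete_energy_eventually_gt:
  assumes "c < V" shows "eventually (\<lambda>n. c < fekete_energy (n + 2)) sequentially"
proof -
  let ?\<rho> = "equilibrium_measure E"
  note min = minimiser_equilibrium_measure[unfolded minimiser_def]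
  have rd: "real_distribution ?\<rho>" by (rule equilibrium_measure)
  obtain K where "\<not> cheb_sum s K ?\<rho> \<le> c + ln s"
    using energy_le_cheb_moments(2)[OF rd s_pos prob_measures_on_E(3), of c] min assms by force
  then obtain r where r: "0 < r" "r < 1" and
     gt: "c + ln s - ln r < abel_sum s r K ?\<rho>"
    using cheb_sum_le_of_abel[of "\<lambda>k. cheb_moment s k ?\<rho>" K "c + ln s"] by (meson not_le)
  have lim1: "(\<lambda>n. abel_sum s r K (fekete_measure n))
      \<longlonglongrightarrow> abel_sum s r K ?\<rho>"
    by (intro tendsto_intros weak_conv_cheb_moment fekete_measure fekete_measure_weak_conv rd)
  have lim2: "(\<lambda>n. (real (n + 2) - 1) / real (n + 2) * (c + ln s - ln r) - 2 * ln (1 - r) / real (n + 2))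
     \<longlonglongrightarrow> 1 * (c + ln s - ln r) - 0"
  proof (intro tendsto_intros)
    show "(\<lambda>n. (real (n + 2) - 1) / real (n + 2)) \<longlonglongrightarrow> 1" by real_asymp
    show "(\<lambda>n. 2 * ln (1 - r) / real (n + 2)) \<longlonglongrightarrow> 0"
      by (rule real_tendsto_divide_at_top[OF tendsto_const]) real_asymp
  qed
  have "eventually (\<lambda>n. (real (n + 2) - 1) / real (n + 2) * (c + ln s - ln r) - 2 * ln (1 - r) / real (n + 2)
     < abel_sum s r K (fekete_measure n)) sequentially"
    by (rule eventually_less_of_tendsto[OF lim2 lim1]) (use gt in simp)
  then show ?thesis
  proof eventually_elim
    case (elim n)
    then have "(real (n + 2) - 1) / real (n + 2) * (c + ln s - ln r)
      < (real (n + 2) - 1) / real (n + 2) * (fekete_energy (n + 2) + ln s - ln r)"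
      using fekete_cheb_moments_le[OF r, of n K] by linarith
    then have "c + ln s - ln r < fekete_energy (n + 2) + ln s - ln r"
      by (subst (asm) mult_less_cancel_left_pos) auto
    then show ?case by simp
  qed
qed

end

section \<open>Logarithmic potentials off the real line\<close>

abbreviation log_pot :: "real measure \<Rightarrow> complex \<Rightarrow> real" where
  "log_pot M z \<equiv> \<integral>x. ln (cmod (z - of_real x)) \<partial>M"

lemma measurable_ln_cmod_minus [measurable]:
  "(\<lambda>x::real. ln (cmod (z - of_real x))) \<in> borel_measurable borel"
  by measurable

lemma integral_ln_cmod_minus:
  assumes \<nu>: "real_distribution \<nu>" and s: "0 < s" and b: "AE x in \<nu>. \<bar>x\<bar> \<le> 2 * s" and w: "w \<noteq> 0" "cmod w < 1"
  shows "(\<integral>x. ln (cmod (of_real s * (w + 1 / w) - of_real x)) \<partial>\<nu>) =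
    ln s - ln (cmod w) - log_gen_int s w \<nu>"
proof -
  interpret real_distribution \<nu> by fact
  have "(\<integral>x. ln (cmod (of_real s * (w + 1 / w) - of_real x)) \<partial>\<nu>)
     = (\<integral>x. (ln s - ln (cmod w)) - log_gen w (joukowski_angle s x) \<partial>\<nu>)"
  proof (rule integral_cong_AE)
    show "AE x in \<nu>. ln (cmod (of_real s * (w + 1 / w) - of_real x)) = (ln s - ln (cmod w)) - log_gen w (joukowski_angle s x)"
      using b
    proof eventually_elim
      case (elim x)
      show ?case using log_gen_factor[OF s w, of "joukowski_angle s x"]
        by (simp only: cos_joukowski_angle[OF s elim])
    qed
  qed simp_all
  also have "\<dots> = (ln s - ln (cmod w)) - log_gen_int s w \<nu>"
    using integral_log_gen_sums(1)[OF \<nu> w(2)] prob_space by simp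
  finally show ?thesis .
qed

text \<open>
  The imaginary part is \<open>s (Im w) (1 - 1 / |w|\<^sup>2)\<close>, and \<open>|w| < 1\<close>.
\<close>

lemma Im_joukowski:
  assumes "0 < s" "cmod w < 1" "Im w \<noteq> 0" shows "Im (of_real s * (w + 1 / w)) \<noteq> 0"
proof -
  have w: "w \<noteq> 0" using assms by auto
  have c: "(cmod w)\<^sup>2 < 1" "0 < (cmod w)\<^sup>2" using assms w by (auto simp: power_less_one_iff abs_square_less_1)
  have "Im (of_real s * (w + 1 / w)) = s * Im w * (1 - 1 / (cmod w)\<^sup>2)"
    by (simp add: Im_divide cmod_power2 right_diff_distrib)
  then show ?thesis using c assms by auto
qed

text \<open>
  In the Joukowski coordinate \<open>w\<close> the difference of the two potentials is the negative real part of a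
  power series \<open>g\<close> whose coefficients are multiples of the differences of the Chebyshev moments. The
  hypothesis makes this real part nonpositive, and \<open>g\<close> vanishes at \<open>0\<close>, the image of infinity. By the
  open mapping theorem \<open>g\<close> vanishes identically.
\<close>

lemma distribution_eqI_log_potential:
  assumes \<nu>: "real_distribution \<nu>" and \<rho>: "real_distribution \<rho>" and s: "0 < s"
    and b: "AE x in \<nu>. \<bar>x\<bar> \<le> 2 * s" "AE x in \<rho>. \<bar>x\<bar> \<le> 2 * s"
    and le: "\<And>z. Im z \<noteq> 0 \<Longrightarrow> log_pot \<rho> z \<le> log_pot \<nu> z"
  shows "\<nu> = \<rho>"
proof -
  define a :: "nat \<Rightarrow> complex" where "a k = of_real (2 / real k * (cheb_moment s k \<nu> - cheb_moment s k \<rho>))" for k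
  define g where "g w = (\<Sum>k. a k * w ^ k)" for w
  have sums: "(\<lambda>k. a k * w ^ k) sums g w" if "cmod w < 1" for w
  proof -
    have bnd: "norm (a k * w ^ k) \<le> 4 * cmod w ^ k" for k
    proof -
      have "\<bar>cheb_moment s k \<nu> - cheb_moment s k \<rho>\<bar> \<le> 2"
        using abs_cheb_moment_le_1[OF \<nu>, of s k] abs_cheb_moment_le_1[OF \<rho>, of s k] by linarith
      moreover have "\<bar>2 / real k\<bar> \<le> 2" by (cases k) (auto simp: divide_le_eq)
      ultimately have "norm (a k) \<le> 2 * 2" unfolding a_def norm_of_real abs_mult
        by (intro mult_mono) auto
      then have "norm (a k) \<le> 4" by simp
      then show ?thesis unfolding norm_mult norm_power by (rule mult_right_mono) simp
    qed
    have "summable (\<lambda>k. 4 * cmod w ^ k)"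
      by (rule summable_mult[OF summable_geometric]) (use that in simp)
    then have "summable (\<lambda>k. a k * w ^ k)"
      by (rule summable_comparison_test'[OF _ bnd])
    then show ?thesis unfolding g_def by (rule summable_sums)
  qed
  have hol: "g holomorphic_on ball 0 1"
    by (rule power_series_holomorphic[of 0 1 a]) (use sums in \<open>auto simp: dist_norm\<close>)
  have Re_g: "Re (g w) = log_gen_int s w \<nu> - log_gen_int s w \<rho>"
    if "cmod w < 1" for w
  proof -
    have "(\<lambda>k. Re (a k * w ^ k)) sums Re (g w)" by (rule sums_Re[OF sums[OF that]])
    moreover have "(\<lambda>k. 2 / real k * Re (w ^ k) * cheb_moment s k \<nu> - 2 / real k * Re (w ^ k) * cheb_moment s k \<rho>) sums
      (log_gen_int s w \<nu> - log_gen_int s w \<rho>)"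
      by (intro sums_diff integral_log_gen_sums \<nu> \<rho> that)
    moreover have "Re (a k * w ^ k) = 2 / real k * Re (w ^ k) * cheb_moment s k \<nu> - 2 / real k * Re (w ^ k) * cheb_moment s k \<rho>" for k
      unfolding a_def by (simp add: algebra_simps)
    ultimately show ?thesis by (simp add: sums_iff)
  qed
  have neg: "Re (g w) \<le> 0" if w: "cmod w < 1" "Im w \<noteq> 0" for w
  proof -
    have "w \<noteq> 0" using w by auto
    from integral_ln_cmod_minus[OF \<nu> s b(1) this w(1)] integral_ln_cmod_minus[OF \<rho> s b(2) this w(1)]
      le[OF Im_joukowski[OF s w]] Re_g[OF w(1)]
    show ?thesis by simp
  qed
  have cont: "continuous_on (ball 0 1) g" using hol by (rule holomorphic_on_imp_continuous_on)
  have neg': "Re (g w) \<le> 0" if w: "cmod w < 1" for w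
  proof (cases "Im w = 0")
    case True
    \<comment> \<open>On the real axis the inequality follows by continuity, approaching \<open>w\<close> from above.\<close>
    let ?u = "\<lambda>n. w + \<i> * of_real ((1 - cmod w) / real (n + 2))"
    have lim: "?u \<longlonglongrightarrow> w"
    proof -
      have "(\<lambda>n. (1 - cmod w) / real (n + 2)) \<longlonglongrightarrow> 0" by real_asymp
      then have "?u \<longlonglongrightarrow> w + \<i> * of_real 0" by (intro tendsto_intros)
      then show ?thesis by simp
    qed
    have u: "cmod (?u n) < 1" "Im (?u n) \<noteq> 0" for n
    proof -
      have "cmod (?u n) \<le> cmod w + (1 - cmod w) / real (n + 2)"
      proof -
        have "cmod (w + \<i> * of_real c) \<le> cmod w + c" if "0 \<le> c" for c
          using norm_triangle_ineq[of w "\<i> * of_real c"] that by (simp add: norm_mult)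
        from this[of "(1 - cmod w) / real (n + 2)"] show ?thesis using w by (simp del: of_real_divide)
      qed
      also have "(1 - cmod w) / real (n + 2) < 1 - cmod w"
        using mult_strict_left_mono[of 1 "real (n + 2)" "1 - cmod w"] w by (simp add: divide_less_eq)
      finally show "cmod (?u n) < 1" by simp
      show "Im (?u n) \<noteq> 0" using True w by simp
    qed
    have "isCont g w" using cont w by (simp add: continuous_on_eq_continuous_at)
    then have "(\<lambda>n. g (?u n)) \<longlonglongrightarrow> g w" by (rule isCont_tendsto_compose[OF _ lim])
    then have "(\<lambda>n. Re (g (?u n))) \<longlonglongrightarrow> Re (g w)" by (rule tendsto_Re)
    then show ?thesis by (rule LIMSEQ_le_const2) (use neg[OF u] in auto)
  qed (use neg w in auto)
  have g0: "g 0 = 0"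
  proof -
    have "(\<lambda>k. a k * 0 ^ k) sums a 0" by (rule powser_sums_zero)
    moreover have "a 0 = 0" by (simp add: a_def)
    ultimately show ?thesis using sums[of 0] by (simp add: sums_iff)
  qed
  have "g constant_on ball 0 1"
  proof (rule ccontr)
    assume "\<not> g constant_on ball 0 1"
    then have "open (g ` ball 0 1)"
      by (intro open_mapping_thm[OF hol]) auto
    moreover have "0 \<in> g ` ball 0 1" using g0 by (intro image_eqI[of _ _ 0]) auto
    ultimately obtain e where e: "e > 0" "ball 0 e \<subseteq> g ` ball 0 1" by (meson openE)
    have "of_real (e / 2) \<in> ball (0::complex) e" using e(1) by simp
    with e(2) obtain w where "w \<in> ball 0 1" "of_real (e / 2) = g w" by blast
    then have "Re (g w) = e / 2" by (metis Re_complex_of_real)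
    then show False using neg'[of w] \<open>w \<in> ball 0 1\<close> e(1) by (simp add: dist_norm)
  qed
  then have gz: "g w = 0" if "cmod w < 1" for w
    using g0 that unfolding constant_on_def by (metis centre_in_ball mem_ball_0 zero_less_one)
  have a0: "a k = 0" if kpos: "k > 0" for k
  proof (rule ccontr)
    assume ak: "a k \<noteq> 0"
    obtain r where r: "0 < r" "\<And>z. z \<in> cball 0 r - {0} \<Longrightarrow> g z \<noteq> 0"
      by (rule powser_0_nonzero[of 1 0 a g k]) (use sums g0 kpos ak in \<open>auto simp: dist_norm\<close>)
    define q where "q = min r (1 / 2)"
    have q: "0 < q" "q \<le> r" "q < 1" using r(1) by (auto simp: q_def)
    have "g (of_real q) \<noteq> 0" by (rule r(2)) (use q in auto)
    then show False using gz[of "of_real q"] q by simp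
  qed
  have "cheb_moment s k \<nu> = cheb_moment s k \<rho>" for k
  proof (cases "k = 0")
    case True
    interpret \<nu>: real_distribution \<nu> by fact
    interpret \<rho>: real_distribution \<rho> by fact
    show ?thesis using True \<nu>.prob_space \<rho>.prob_space by (simp add: cheb_moment_def cheb_def)
  next
    case False then show ?thesis using a0[of k] by (simp add: a_def del: of_real_mult of_real_divide)
  qed
  then show ?thesis by (intro distribution_eqI_cheb_moments[OF \<nu> \<rho> s b])
qed

text \<open>
  The logarithm is unbounded at infinity, so it is modified outside the common interval.
\<close>

lemma log_potential_weak_conv:
  assumes M: "\<And>n. real_distribution (M n)" "\<And>n. AE x in M n. \<bar>x\<bar> \<le> B"
    and \<nu>: "real_distribution \<nu>" "AE x in \<nu>. \<bar>x\<bar> \<le> B" and conv: "weak_conv_m M \<nu>" and z: "Im z \<noteq> 0"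
  shows "(\<lambda>n. log_pot (M n) z) \<longlonglongrightarrow> log_pot \<nu> z"
proof -
  define f where "f x = ln (cmod (z - of_real (max (- B) (min B x))))" for x :: real
  have nz: "z - of_real x \<noteq> 0" for x using z by (auto simp: complex_eq_iff)
  have cf: "continuous_on UNIV f" unfolding f_def by (intro continuous_intros) (use nz in auto)
  have eq: "log_pot N z = integral\<^sup>L N f"
    if "real_distribution N" "AE x in N. \<bar>x\<bar> \<le> B" for N
  proof -
    interpret real_distribution N by fact
    show ?thesis
    proof (rule integral_cong_AE)
      show "AE x in N. ln (cmod (z - of_real x)) = f x"
        using that(2)
      proof eventually_elim
        case (elim x)
        then have "max (- B) (min B x) = x" by auto
        then show ?case by (simp add: f_def)
      qed
      show "f \<in> borel_measurable N" using borel_measurable_continuous_onI[OF cf] by simp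
    qed simp
  qed
  have "bounded (f ` UNIV)"
  proof -
    have c: "continuous_on {- \<bar>B\<bar>..\<bar>B\<bar>} (\<lambda>x. ln (cmod (z - of_real x)))"
      by (intro continuous_intros) (use nz in auto)
    have "bounded ((\<lambda>x. ln (cmod (z - of_real x))) ` {- \<bar>B\<bar>..\<bar>B\<bar>})"
      by (rule compact_imp_bounded[OF compact_continuous_image[OF c]]) simp
    then show ?thesis by (rule bounded_subset) (auto simp: f_def intro!: imageI)
  qed
  then obtain C where C: "\<And>x. norm (f x) \<le> C" by (auto simp: bounded_iff)
  have "(\<lambda>n. integral\<^sup>L (M n) f) \<longlonglongrightarrow> integral\<^sup>L \<nu> f"
    by (rule weak_conv_imp_integral_bdd_continuous_conv[OF M(1) \<nu>(1) conv _ C])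
       (use cf in \<open>auto simp: continuous_on_eq_continuous_at\<close>)
  then show ?thesis by (simp add: eq M \<nu>)
qed

context positive_capacity
begin

lemma fekete_potential_tendsto:
  assumes "Im z \<noteq> 0"
  shows "(\<lambda>n. (\<Sum>i<n + 2. ln (cmod (z - of_real (fekete (n + 2) i)))) / real (n + 2))
    \<longlonglongrightarrow> log_pot (equilibrium_measure E) z"
proof -
  have "AE x in equilibrium_measure E. \<bar>x\<bar> \<le> 2 * s"
    using equilibrium_measure(2) by eventually_elim (rule E_bounded)
  from log_potential_weak_conv[OF fekete_measure(1,3) equilibrium_measure(1) this fekete_measure_weak_conv assms]
  show ?thesis by (simp add: fekete_measure_def integral_empirical)
qed

text \<open>
  A one-sided asymptotic bound for the potentials off the real line suffices: it passes to every weak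
  limit point, which is thereby identified with the equilibrium measure.
\<close>

lemma weak_conv_equilibrium_measureI:
  assumes M: "\<And>n. real_distribution (M n)" "\<And>n. AE x in M n. \<bar>x\<bar> \<le> 2 * s"
    and b: "\<And>z. Im z \<noteq> 0 \<Longrightarrow> \<exists>b. b \<longlonglongrightarrow> log_pot (equilibrium_measure E) z \<and>
       (\<forall>\<^sub>F n in sequentially. b n \<le> log_pot (M n) z)"
  shows "weak_conv_m M (equilibrium_measure E)"
proof (rule tight_subseq_weak_converge[OF M(1) equilibrium_measure(1)])
  show "tight M" by (rule tight_bounded[OF M])
  fix t \<nu> assume t: "strict_mono t" and \<nu>: "real_distribution \<nu>" "weak_conv_m (M \<circ> t) \<nu>"
  have rd: "real_distribution ((M \<circ> t) n)" for n by (simp add: M)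
  have ae: "AE x in (M \<circ> t) n. \<bar>x\<bar> \<le> 2 * s" for n using M(2) by (simp only: comp_apply)
  have "AE x in \<nu>. x \<in> {- (2 * s)..2 * s}"
  proof (rule weak_limit_supported[OF rd \<nu>])
    fix n show "AE x in (M \<circ> t) n. x \<in> {- (2 * s)..2 * s}" using ae[of n] by eventually_elim auto
  qed (use s_pos in auto)
  then have ae\<nu>: "AE x in \<nu>. \<bar>x\<bar> \<le> 2 * s" by eventually_elim auto
  have "\<nu> = equilibrium_measure E"
  proof (rule distribution_eqI_log_potential[OF \<nu>(1) equilibrium_measure(1) s_pos ae\<nu>])
    show "AE x in equilibrium_measure E. \<bar>x\<bar> \<le> 2 * s"
      using equilibrium_measure(2) by eventually_elim (rule E_bounded)
    fix z :: complex assume z: "Im z \<noteq> 0"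
    obtain b where b: "b \<longlonglongrightarrow> log_pot (equilibrium_measure E) z"
       "\<forall>\<^sub>F n in sequentially. b n \<le> log_pot (M n) z" using b[OF z] by blast
    have tlim: "filterlim t at_top sequentially" using t by (rule filterlim_subseq)
    have 1: "(\<lambda>n. b (t n)) \<longlonglongrightarrow> log_pot (equilibrium_measure E) z"
      by (rule filterlim_compose[OF b(1) tlim])
    have 2: "(\<lambda>n. log_pot ((M \<circ> t) n) z) \<longlonglongrightarrow> log_pot \<nu> z"
      by (rule log_potential_weak_conv[OF rd ae \<nu>(1) ae\<nu> \<nu>(2) z])
    have 3: "\<forall>\<^sub>F n in sequentially. b (t n) \<le> log_pot ((M \<circ> t) n) z"
      using eventually_compose_filterlim[OF b(2) tlim] by simp
    show "log_pot (equilibrium_measure E) z \<le> log_pot \<nu> z"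
      by (rule tendsto_le[OF _ 2 1 3]) simp
  qed
  then show "weak_conv_m (M \<circ> t) (equilibrium_measure E)" using \<nu>(2) by simp
qed

end

section \<open>Positive semi-definite matrices\<close>

definition cdot :: "complex^'n \<Rightarrow> complex^'n \<Rightarrow> complex" where
  "cdot u v = (\<Sum>i\<in>UNIV. cnj (u $ i) * v $ i)"

lemma cdot_add_left: "cdot (u + u') v = cdot u v + cdot u' v"
  and cdot_add_right: "cdot u (v + v') = cdot u v + cdot u v'"
  and cdot_diff_right: "cdot u (v - v') = cdot u v - cdot u v'"
  by (simp_all add: cdot_def algebra_simps sum.distrib sum_subtractf)

lemma cdot_scale_left: "cdot (c *s u) v = cnj c * cdot u v"
  and cdot_scale_right: "cdot u (c *s v) = c * cdot u v"
  by (simp_all add: cdot_def sum_distrib_left mult_ac)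

lemma cdot_zero [simp]: "cdot 0 v = 0" "cdot u 0 = 0"
  by (simp_all add: cdot_def)

lemma cdot_sum_right: "cdot u (\<Sum>i\<in>I. f i) = (\<Sum>i\<in>I. cdot u (f i))"
  by (induction I rule: infinite_finite_induct) (simp_all add: cdot_add_right)

lemma cnj_cdot: "cnj (cdot u v) = cdot v u"
  by (simp add: cdot_def mult.commute)

lemma cdot_self: "cdot v v = of_real ((norm v)\<^sup>2)"
proof -
  have "cdot v v = of_real (\<Sum>i\<in>UNIV. (norm (v $ i))\<^sup>2)"
    by (simp add: cdot_def complex_norm_square[symmetric] mult.commute)
  also have "(\<Sum>i\<in>UNIV. (norm (v $ i))\<^sup>2) = (norm v)\<^sup>2"
    by (simp add: norm_vec_def L2_set_def sum_nonneg)
  finally show ?thesis .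
qed

lemma cdot_eqI: "(\<And>u. cdot u v = cdot u w) \<Longrightarrow> v = w"
proof -
  assume "\<And>u. cdot u v = cdot u w"
  then have "cdot (v - w) (v - w) = 0" by (simp add: cdot_diff_right)
  then show "v = w" by (simp add: cdot_self)
qed

lemma cmod_cdot_le: "cmod (cdot u v) \<le> norm u * norm v"
proof -
  have "cmod (cdot u v) \<le> (\<Sum>i\<in>UNIV. \<bar>norm (u $ i)\<bar> * \<bar>norm (v $ i)\<bar>)"
    unfolding cdot_def by (rule order_trans[OF norm_sum]) (simp add: norm_mult)
  also have "\<dots> \<le> L2_set (\<lambda>i. norm (u $ i)) UNIV * L2_set (\<lambda>i. norm (v $ i)) UNIV"
    by (rule L2_set_mult_ineq)
  finally show ?thesis by (simp add: norm_vec_def)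
qed

lemma cdot_hermitian_adjoint: "cdot u (A *v v) = cdot (hermitian_adjoint A *v u) v"
proof -
  have "cdot u (A *v v) = (\<Sum>i\<in>UNIV. \<Sum>j\<in>UNIV. cnj (u $ i) * A $ i $ j * v $ j)"
    by (simp add: cdot_def matrix_vector_mult_def sum_distrib_left mult_ac)
  also have "\<dots> = (\<Sum>j\<in>UNIV. \<Sum>i\<in>UNIV. cnj (u $ i) * A $ i $ j * v $ j)"
    by (rule sum.swap)
  also have "\<dots> = cdot (hermitian_adjoint A *v u) v"
    by (simp add: cdot_def matrix_vector_mult_def hermitian_adjoint_def sum_distrib_right sum_distrib_left mult_ac)
  finally show ?thesis .
qed

lemma cdot_matrix_sum: "cdot u (A *v v) = (\<Sum>i\<in>UNIV. \<Sum>j\<in>UNIV. cnj (u $ i) * A $ i $ j * v $ j)"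
  by (simp add: cdot_def matrix_vector_mult_def sum_distrib_left mult_ac)

lemma hermitian_adjoint_involutive [simp]: "hermitian_adjoint (hermitian_adjoint A) = A"
  by (simp add: hermitian_adjoint_def vec_eq_iff)

lemma pos_semidef_alt: "pos_semidef A \<longleftrightarrow> hermitian_adjoint A = A \<and> (\<forall>v. 0 \<le> Re (cdot v (A *v v)))"
  by (simp add: pos_semidef_def cdot_matrix_sum)

lemma cdot_axis_left: "cdot (axis i 1) v = v $ i"
  by (simp add: cdot_def axis_def if_distrib[of cnj] if_distrib[of "\<lambda>x. x * _"] cong: if_cong)

lemma matrix_mult_axis_nth: "(A *v axis j 1) $ i = A $ i $ (j::'n::finite)" for A :: "complex^'n^'m"
  by (simp add: matrix_vector_mult_def axis_def if_distrib[of "\<lambda>x. _ * x"] cong: if_cong)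

lemma matrix_vector_mult_scale: "A *v (c *s v) = c *s (A *v v)" for A :: "complex^'n^'m"
  by (simp add: matrix_vector_mult_def vec_eq_iff sum_distrib_left mult_ac)

text \<open>
  Test positivity with the vectors \<open>e\<^sub>i + d e\<^sub>j\<close> for unimodular \<open>d\<close>. The estimate makes every entry
  of a matrix-valued measure absolutely continuous with respect to the trace measure.
\<close>

lemma pos_semidef_entry_le_trace:
  fixes A :: "complex^'l^'l"
  assumes A: "pos_semidef A" and c: "cmod c = 1"
  shows "\<bar>Re (c * A $ i $ j)\<bar> \<le> Re (trace A)"
proof -
  have pos: "0 \<le> Re (cdot v (A *v v))" for v using A by (simp add: pos_semidef_alt)
  have herm: "A $ j $ i = cnj (A $ i $ j)" for i j
    using A by (simp add: pos_semidef_alt hermitian_adjoint_def vec_eq_iff)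
  have diag: "0 \<le> Re (A $ k $ k)" for k
    using pos[of "axis k 1"] by (simp add: cdot_axis_left matrix_mult_axis_nth)
  have le1: "Re (A $ k $ k) \<le> Re (trace A)" for k
    unfolding trace_def Re_sum by (rule member_le_sum) (use diag in auto)
  have le: "Re (A $ i $ i) + Re (A $ j $ j) \<le> 2 * Re (trace A)" using le1[of i] le1[of j] by simp
  have "0 \<le> Re (A $ i $ i) + Re (A $ j $ j) + 2 * Re (d * A $ i $ j)" if d: "cmod d = 1" for d
  proof -
    let ?v = "axis i 1 + d *s axis j 1"
    have "cdot ?v (A *v ?v) = A $ i $ i + d * A $ i $ j + cnj d * A $ j $ i + (cnj d * d) * A $ j $ j"
      by (simp add: matrix_vector_right_distrib matrix_vector_mult_scale cdot_add_left cdot_add_right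
         cdot_scale_left cdot_scale_right cdot_axis_left matrix_mult_axis_nth algebra_simps)
    also have "cnj d * d = 1" using d by (metis complex_norm_square mult.commute of_real_1 one_power2)
    also have "cnj d * A $ j $ i = cnj (d * A $ i $ j)" by (simp add: herm[of j i])
    finally have "cdot ?v (A *v ?v) = A $ i $ i + d * A $ i $ j + cnj (d * A $ i $ j) + A $ j $ j" by simp
    then have "Re (cdot ?v (A *v ?v)) = Re (A $ i $ i) + Re (A $ j $ j) + 2 * Re (d * A $ i $ j)"
      by simp
    with pos[of ?v] show ?thesis by simp
  qed
  from this[of c] this[of "- c"] c le show ?thesis by (simp add: abs_le_iff)
qed

text \<open>
  The Cauchy-Schwarz inequality in additive form, which survives integration without square roots. It
  is positivity at \<open>t u + d v\<close> with a unimodular \<open>d\<close> that makes the mixed term negative.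
\<close>

lemma pos_semidef_cdot_le:
  fixes A :: "complex^'l^'l"
  assumes A: "pos_semidef A" and t: "0 < t"
  shows "2 * cmod (cdot u (A *v v)) \<le> t * Re (cdot u (A *v u)) + Re (cdot v (A *v v)) / t"
proof -
  let ?c = "cdot u (A *v v)"
  \<comment> \<open>Chosen such that \<open>d * ?c\<close> is minus the modulus of \<open>?c\<close>.\<close>
  define d where "d = (if ?c = 0 then 1 else - cnj ?c / of_real (cmod ?c))"
  have d: "d * ?c = - of_real (cmod ?c)" "cnj d * d = 1"
  proof -
    have sq: "cnj ?c * ?c = of_real (cmod ?c) * of_real (cmod ?c)"
      by (metis complex_norm_square mult.commute power2_eq_square of_real_power)
    show "d * ?c = - of_real (cmod ?c)"
      using sq by (auto simp: d_def divide_simps)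
    show "cnj d * d = 1"
      using sq by (auto simp: d_def divide_simps mult.commute)
  qed
  let ?w = "of_real t *s u + d *s v"
  have h: "cdot v (A *v u) = cnj ?c"
    using A unfolding pos_semidef_alt by (metis cdot_hermitian_adjoint cnj_cdot)
  have e: "cdot ?w (A *v ?w) = of_real (t * t) * cdot u (A *v u) + of_real t * (d * ?c) + of_real t * cnj (d * ?c) + (cnj d * d) * cdot v (A *v v)"
    by (simp add: matrix_vector_right_distrib matrix_vector_mult_scale cdot_add_left cdot_add_right
         cdot_scale_left cdot_scale_right h algebra_simps)
  have "Re (cdot ?w (A *v ?w)) = t * (t * Re (cdot u (A *v u)) - 2 * cmod ?c) + Re (cdot v (A *v v))"
    unfolding e d by (simp add: algebra_simps)
  moreover have "0 \<le> Re (cdot ?w (A *v ?w))" using A by (simp add: pos_semidef_alt)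
  ultimately have "0 \<le> (t * (t * Re (cdot u (A *v u)) - 2 * cmod ?c) + Re (cdot v (A *v v))) / t"
    using t by simp
  then show ?thesis using t by (simp add: add_divide_distrib)
qed

section \<open>Densities of matrix-valued measures\<close>

lemma finite_measure_of_sums:
  fixes g :: "real set \<Rightarrow> real"
  assumes nn: "\<And>A. A \<in> sets borel \<Longrightarrow> 0 \<le> g A"
    and sums: "\<And>A::nat \<Rightarrow> real set. range A \<subseteq> sets borel \<Longrightarrow> disjoint_family A \<Longrightarrow> (\<lambda>n. g (A n)) sums g (\<Union>n. A n)"
  defines "N \<equiv> measure_of UNIV (sets borel) (\<lambda>A. ennreal (g A))"
  shows "sets N = sets borel" "space N = UNIV" "A \<in> sets borel \<Longrightarrow> emeasure N A = ennreal (g A)"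
    "finite_measure N"
proof -
  have sa: "sigma_algebra UNIV (sets borel :: real set set)"
    by (metis sets.sigma_algebra_axioms space_borel)
  show sN: "sets N = sets borel" and sp: "space N = UNIV"
    unfolding N_def using sigma_algebra.sigma_sets_eq[OF sa] by (auto simp: sets_measure_of_conv)
  have g0: "g {} = 0"
  proof -
    have "(\<lambda>n::nat. g {}) sums g (\<Union>n::nat. {})" by (rule sums) (auto simp: disjoint_family_on_def)
    then have "summable (\<lambda>n::nat. g {})" by (rule sums_summable)
    then show ?thesis by (simp add: summable_const_iff)
  qed
  show e: "A \<in> sets borel \<Longrightarrow> emeasure N A = ennreal (g A)" for A
    unfolding N_def
  proof (rule emeasure_measure_of_sigma[OF sa])
    show "positive (sets borel) (\<lambda>A. ennreal (g A))" by (simp add: positive_def g0)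
    show "countably_additive (sets borel) (\<lambda>A. ennreal (g A))"
      unfolding countably_additive_def
    proof (intro allI impI)
      fix A :: "nat \<Rightarrow> real set" assume A: "range A \<subseteq> sets borel" "disjoint_family A" "\<Union> (range A) \<in> sets borel"
      show "(\<Sum>i. ennreal (g (A i))) = ennreal (g (\<Union> (range A)))"
        by (rule suminf_ennreal_eq[OF nn sums[OF A(1,2)]]) (use A(1) in auto)
    qed
  qed
  show "finite_measure N" by (rule finite_measureI) (simp add: sp e)
qed

text \<open>
  The Radon-Nikodym theorem for a signed measure dominated by \<open>\<tau>\<close>. Adding \<open>\<tau>\<close> itself makes it
  positive, and 1 is subtracted from the density afterwards.
\<close>

lemma signed_density_exists:
  fixes S :: "real set \<Rightarrow> real"
  assumes \<tau>: "finite_measure \<tau>" and st: "sets \<tau> = sets borel"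
    and le: "\<And>A. A \<in> sets borel \<Longrightarrow> \<bar>S A\<bar> \<le> measure \<tau> A"
    and sums: "\<And>A::nat \<Rightarrow> real set. range A \<subseteq> sets borel \<Longrightarrow> disjoint_family A \<Longrightarrow> (\<lambda>n. S (A n)) sums S (\<Union>n. A n)"
  shows "\<exists>f. integrable \<tau> f \<and> (\<forall>A\<in>sets borel. S A = set_lebesgue_integral \<tau> A f)"
proof -
  interpret \<tau>: finite_measure \<tau> by fact
  let ?g = "\<lambda>A. S A + measure \<tau> A"
  have "(\<lambda>n. measure \<tau> (A n)) sums measure \<tau> (\<Union>n. A n)" if "range A \<subseteq> sets borel" "disjoint_family A" for A :: "nat \<Rightarrow> real set"
    by (rule \<tau>.finite_measure_UNION) (use that st in auto)
  then have s: "(\<lambda>n. ?g (A n)) sums ?g (\<Union>n. A n)" if "range A \<subseteq> sets borel" "disjoint_family A" for A :: "nat \<Rightarrow> real set"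
    using that by (intro sums_add sums) auto
  define N where "N = measure_of UNIV (sets borel) (\<lambda>A. ennreal (?g A))"
  have nn: "0 \<le> ?g A" if "A \<in> sets borel" for A using le[OF that] by linarith
  note N = finite_measure_of_sums[of ?g, OF nn s, folded N_def]
  have [simp]: "sets N = sets borel" by (rule N(1)) auto
  have eN: "emeasure N A = ennreal (?g A)" if "A \<in> sets borel" for A by (rule N(3)) (use that in auto)
  have fN: "finite_measure N" by (rule N(4)) auto
  have ac: "absolutely_continuous \<tau> N"
  proof -
    have "A \<in> null_sets N" if "A \<in> null_sets \<tau>" for A
    proof -
      have A: "A \<in> sets borel" "measure \<tau> A = 0" using that st by (auto simp: null_sets_def measure_def)
      then have "S A = 0" using le[of A] by simp
      then show ?thesis using eN[OF A(1)] A by (simp add: null_sets_def)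
    qed
    then show ?thesis by (auto simp: absolutely_continuous_def)
  qed
  have sNt: "sets N = sets \<tau>" using st by simp
  obtain D where D: "D \<in> borel_measurable \<tau>" "AE x in \<tau>. RN_deriv \<tau> N x = ennreal (D x)" "\<And>x. 0 \<le> D x"
    using \<tau>.real_RN_deriv[OF fN ac sNt] by blast
  have dN: "emeasure N A = (\<integral>\<^sup>+x. ennreal (D x) * indicator A x \<partial>\<tau>)" if "A \<in> sets borel" for A
  proof -
    have "N = density \<tau> (RN_deriv \<tau> N)" using \<tau>.density_RN_deriv[OF ac] st by simp
    then have "emeasure N A = (\<integral>\<^sup>+x. RN_deriv \<tau> N x * indicator A x \<partial>\<tau>)"
      using that st by (metis emeasure_density borel_measurable_RN_deriv)
    also have "\<dots> = (\<integral>\<^sup>+x. ennreal (D x) * indicator A x \<partial>\<tau>)"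
      by (rule nn_integral_cong_AE) (use D(2) in \<open>eventually_elim, simp\<close>)
    finally show ?thesis .
  qed
  have intD: "integrable \<tau> D"
  proof (rule integrableI_nonneg)
    have "(\<integral>\<^sup>+x. ennreal (D x) \<partial>\<tau>) = emeasure N UNIV" by (simp add: dN)
    also have "\<dots> < \<infinity>" by (simp add: eN)
    finally show "(\<integral>\<^sup>+x. ennreal (D x) \<partial>\<tau>) < \<infinity>" .
  qed (use D in auto)
  have "S A = set_lebesgue_integral \<tau> A (\<lambda>x. D x - 1)" if A: "A \<in> sets borel" for A
  proof -
    have As: "A \<in> sets \<tau>" using A st by simp
    have iD: "integrable \<tau> (\<lambda>x. indicator A x * D x)" and i1: "integrable \<tau> (\<lambda>x. indicator A x * (1::real))"
      using integrable_mult_indicator[OF As intD] integrable_mult_indicator[OF As, of "\<lambda>x. 1::real"] by auto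
    have "ennreal (?g A) = (\<integral>\<^sup>+x. ennreal (indicator A x * D x) \<partial>\<tau>)"
      unfolding eN[OF A, symmetric] dN[OF A] by (rule nn_integral_cong) (simp split: split_indicator)
    also have "\<dots> = ennreal (\<integral>x. indicator A x * D x \<partial>\<tau>)"
      by (rule nn_integral_eq_integral[OF iD]) (use D in auto)
    finally have "?g A = (\<integral>x. indicator A x * D x \<partial>\<tau>)"
      using nn[OF A] D(3) by (subst (asm) ennreal_inj) (auto intro!: integral_nonneg_AE)
    moreover have "(\<integral>x. indicator A x * D x - indicator A x * 1 \<partial>\<tau>) = (\<integral>x. indicator A x * D x \<partial>\<tau>) - (\<integral>x. indicator A x * 1 \<partial>\<tau>)"
      by (rule Bochner_Integration.integral_diff[OF iD i1])
    moreover have "(\<integral>x. indicator A x * 1 \<partial>\<tau>) = measure \<tau> A" using As by simp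
    ultimately show ?thesis by (simp add: set_lebesgue_integral_def algebra_simps)
  qed
  moreover have "integrable \<tau> (\<lambda>x. D x - 1)" using intD by simp
  ultimately show ?thesis by blast
qed

lemma bounded_linear_matrix_nth: "bounded_linear (\<lambda>M :: complex^'l^'l::finite. M $ i $ j)"
  by (rule bounded_linear_compose[OF bounded_linear_vec_nth bounded_linear_vec_nth])

lemma integral_matrix_nth:
  fixes f :: "'a \<Rightarrow> complex^'l^'l"
  assumes "integrable M f"
  shows "integral\<^sup>L M f $ i $ j = (\<integral>x. f x $ i $ j \<partial>M)" "integrable M (\<lambda>x. f x $ i $ j)"
  using integral_bounded_linear[OF bounded_linear_matrix_nth assms] integrable_bounded_linear[OF bounded_linear_matrix_nth assms]
  by auto

lemma integrable_matrixI:
  fixes f :: "'a \<Rightarrow> complex^'l^'l::finite"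
  assumes "\<And>i j. integrable M (\<lambda>x. f x $ i $ j)"
  shows "integrable M f"
proof -
  have bl: "bounded_linear (\<lambda>c::complex. axis i (axis j c) :: complex^'l^'l)" for i j
    unfolding linear_conv_bounded_linear[symmetric]
    by (rule linearI) (auto simp: axis_def vec_eq_iff)
  have "f x = (\<Sum>p\<in>UNIV. axis (fst p) (axis (snd p) (f x $ fst p $ snd p)))" for x
  proof -
    have ax: "axis (fst p) (axis (snd p) c) $ k $ m = (if p = (k, m) then c else 0)"
      for p :: "'l \<times> 'l" and c :: complex and k m :: 'l
      by (cases p) (auto simp: axis_def)
    show ?thesis by (simp add: vec_eq_iff ax)
  qed
  then have "f = (\<lambda>x. \<Sum>p\<in>UNIV. axis (fst p) (axis (snd p) (f x $ fst p $ snd p)))" by blast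
  moreover have "integrable M (\<lambda>x. \<Sum>p\<in>UNIV. axis (fst p) (axis (snd p) (f x $ fst p $ snd p)) :: complex^'l^'l)"
    by (intro Bochner_Integration.integrable_sum integrable_bounded_linear[OF bl] assms)
  ultimately show ?thesis by simp
qed

lemma continuous_on_nth:
  fixes f :: "'a::topological_space \<Rightarrow> complex^'l::finite"
  shows "continuous_on S f \<Longrightarrow> continuous_on S (\<lambda>x. f x $ i)"
  by (rule bounded_linear.continuous_on[OF bounded_linear_vec_nth])

lemma bounded_linear_Re_trace: "bounded_linear (\<lambda>M :: complex^'l^'l::finite. Re (trace M))"
  unfolding trace_def Re_sum
  by (intro bounded_linear_sum bounded_linear_compose[OF bounded_linear_Re bounded_linear_matrix_nth])

lemma trace_measure:
  fixes \<mu> :: "real set \<Rightarrow> complex^'l^'l::finite"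
  assumes "matrix_measure \<mu>"
  shows "sets (trace_measure \<mu>) = sets borel" "space (trace_measure \<mu>) = UNIV"
    "A \<in> sets borel \<Longrightarrow> measure (trace_measure \<mu>) A = Re (trace (\<mu> A))"
    "finite_measure (trace_measure \<mu>)"
proof -
  have nn: "0 \<le> Re (trace (\<mu> A))" if "A \<in> sets borel" for A
    using assms that pos_semidef_entry_le_trace[of "\<mu> A" 1] by (fastforce simp: matrix_measure_def)
  have s: "(\<lambda>n. Re (trace (\<mu> (A n)))) sums Re (trace (\<mu> (\<Union>n. A n)))"
    if "range A \<subseteq> sets borel" "disjoint_family A" for A :: "nat \<Rightarrow> real set"
    by (rule bounded_linear.sums[OF bounded_linear_Re_trace]) (use assms that in \<open>simp add: matrix_measure_def\<close>)
  note N = finite_measure_of_sums[of "\<lambda>A. Re (trace (\<mu> A))", OF nn s, folded trace_measure_def]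
  show "sets (trace_measure \<mu>) = sets borel" by (rule N(1)) auto
  show "space (trace_measure \<mu>) = UNIV" by (rule N(2)) auto
  show "finite_measure (trace_measure \<mu>)" by (rule N(4)) auto
  assume A: "A \<in> sets borel"
  have "emeasure (trace_measure \<mu>) A = ennreal (Re (trace (\<mu> A)))" by (rule N(3)) (use A in auto)
  then show "measure (trace_measure \<mu>) A = Re (trace (\<mu> A))" using nn[OF A] by (simp add: measure_def)
qed

text \<open>
  The real and imaginary parts of the entries are dominated by the trace measure; the imaginary part of
  \<open>c\<close> is the real part of \<open>- \<i> c\<close>.
\<close>

lemma matrix_density_exists:
  fixes \<mu> :: "real set \<Rightarrow> complex^'l^'l::finite"
  assumes \<mu>: "matrix_measure \<mu>"
  shows "\<exists>W. integrable (trace_measure \<mu>) W \<and>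
     (\<forall>A\<in>sets borel. \<mu> A = set_lebesgue_integral (trace_measure \<mu>) A W)"
proof -
  let ?\<tau> = "trace_measure \<mu>"
  note T = trace_measure[OF \<mu>]
  have psd: "pos_semidef (\<mu> A)" if "A \<in> sets borel" for A using \<mu> that by (simp add: matrix_measure_def)
  have "\<exists>f. integrable ?\<tau> f \<and> (\<forall>A\<in>sets borel. Re (c * \<mu> A $ i $ j) = set_lebesgue_integral ?\<tau> A f)"
    if c: "cmod c = 1" for c i j
  proof (rule signed_density_exists[OF T(4,1)])
    show "\<bar>Re (c * \<mu> A $ i $ j)\<bar> \<le> measure ?\<tau> A" if "A \<in> sets borel" for A
      using pos_semidef_entry_le_trace[OF psd[OF that] c] T(3)[OF that] by simp
    have "bounded_linear (\<lambda>M :: complex^'l^'l. Re (c * M $ i $ j))"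
      by (intro bounded_linear_compose[OF bounded_linear_Re] bounded_linear_compose[OF bounded_linear_mult_right] bounded_linear_matrix_nth)
    from bounded_linear.sums[OF this]
    show "(\<lambda>n. Re (c * \<mu> (A n) $ i $ j)) sums Re (c * \<mu> (\<Union>n. A n) $ i $ j)"
      if "range A \<subseteq> sets borel" "disjoint_family A" for A :: "nat \<Rightarrow> real set"
      using \<mu> that by (auto simp: matrix_measure_def)
  qed
  from this[of 1] this[of "- \<i>"] have "\<forall>i j. \<exists>f. integrable ?\<tau> f \<and> (\<forall>A\<in>sets borel. Re (\<mu> A $ i $ j) = set_lebesgue_integral ?\<tau> A f)"
    "\<forall>i j. \<exists>f. integrable ?\<tau> f \<and> (\<forall>A\<in>sets borel. Im (\<mu> A $ i $ j) = set_lebesgue_integral ?\<tau> A f)"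
    by simp_all
  then obtain f g where f: "\<And>i j. integrable ?\<tau> (f i j)" "\<And>i j A. A \<in> sets borel \<Longrightarrow> Re (\<mu> A $ i $ j) = set_lebesgue_integral ?\<tau> A (f i j)"
    and g: "\<And>i j. integrable ?\<tau> (g i j)" "\<And>i j A. A \<in> sets borel \<Longrightarrow> Im (\<mu> A $ i $ j) = set_lebesgue_integral ?\<tau> A (g i j)"
    by metis
  define W where "W x = (\<chi> i j. Complex (f i j x) (g i j x))" for x
  have iW: "integrable ?\<tau> W"
  proof (rule integrable_matrixI)
    fix i j
    have "integrable ?\<tau> (\<lambda>x. of_real (f i j x) + \<i> * of_real (g i j x))" 
      using f(1) g(1) by (intro Bochner_Integration.integrable_add integrable_mult_right integrable_of_real)
    then show "integrable ?\<tau> (\<lambda>x. W x $ i $ j)" by (simp add: W_def Complex_eq)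
  qed
  have "\<mu> A = set_lebesgue_integral ?\<tau> A W" if A: "A \<in> sets borel" for A
  proof -
    have As: "A \<in> sets ?\<tau>" using A T(1) by simp
    have iA: "integrable ?\<tau> (\<lambda>x. indicator A x *\<^sub>R W x)" by (rule integrable_mult_indicator[OF As iW])
    have "set_lebesgue_integral ?\<tau> A W $ i $ j = \<mu> A $ i $ j" for i j
    proof -
      have e: "set_lebesgue_integral ?\<tau> A W $ i $ j = (\<integral>x. indicator A x *\<^sub>R W x $ i $ j \<partial>?\<tau>)"
        unfolding set_lebesgue_integral_def using integral_matrix_nth(1)[OF iA] by simp
      have i2: "integrable ?\<tau> (\<lambda>x. indicator A x *\<^sub>R W x $ i $ j)"
        using integral_matrix_nth(2)[OF iA] by simp
      show ?thesis unfolding e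
      proof (rule complex_eqI)
        show "Re (\<integral>x. indicator A x *\<^sub>R W x $ i $ j \<partial>?\<tau>) = Re (\<mu> A $ i $ j)"
          using i2 by (simp add: f(2)[OF A] set_lebesgue_integral_def W_def flip: integral_Re)
        show "Im (\<integral>x. indicator A x *\<^sub>R W x $ i $ j \<partial>?\<tau>) = Im (\<mu> A $ i $ j)"
          using i2 by (simp add: g(2)[OF A] set_lebesgue_integral_def W_def flip: integral_Im)
      qed
    qed
    then show ?thesis by (simp add: vec_eq_iff)
  qed
  with iW show ?thesis by blast
qed

lemma bounded_linear_cdot_matrix: "bounded_linear (\<lambda>M :: complex^'l^'l::finite. cdot u (M *v v))"
  unfolding cdot_matrix_sum
  by (intro bounded_linear_sum bounded_linear_compose[OF bounded_linear_mult_left]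
     bounded_linear_compose[OF bounded_linear_mult_right] bounded_linear_matrix_nth)

text \<open>
  The constant \<open>a\<close> bounds the support and thereby the multiplication by \<open>x\<close> in the inner product.
\<close>

locale compact_matrix_measure =
  fixes \<mu> :: "real set \<Rightarrow> complex^'l^'l::finite" and a :: real
  assumes \<mu>: "matrix_measure \<mu>" and normalised: "\<mu> UNIV = mat 1"
    and compact_supp: "compact (matrix_supp \<mu>)" and a_pos: "0 < a"
    and supp_bounded: "\<And>x. x \<in> matrix_supp \<mu> \<Longrightarrow> \<bar>x\<bar> \<le> a"
begin

abbreviation "\<tau> \<equiv> trace_measure \<mu>"
abbreviation "W \<equiv> matrix_density \<mu>"

lemma sets_\<tau> [measurable_cong]: "sets \<tau> = sets borel" using trace_measure[OF \<mu>] by simp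

lemma W_integrable: "integrable \<tau> W"
  and W_density: "A \<in> sets borel \<Longrightarrow> \<mu> A = set_lebesgue_integral \<tau> A W"
  using someI_ex[OF matrix_density_exists[OF \<mu>], folded matrix_density_def] by auto

lemma finite_measure_\<tau>: "finite_measure \<tau>" using trace_measure[OF \<mu>] by simp

text \<open>
  For a single vector the quadratic form of the density is nonnegative almost everywhere because its
  integral over every Borel set is. A countable dense set of vectors takes care of all of them.
\<close>

lemma AE_pos_semidef_W: "AE x in \<tau>. pos_semidef (W x)"
proof -
  interpret finite_measure \<tau> by (rule finite_measure_\<tau>)
  have psd: "pos_semidef (\<mu> A)" if "A \<in> sets borel" for A using \<mu> that by (simp add: matrix_measure_def)
  have set_int: "set_lebesgue_integral \<tau> A (\<lambda>x. h (W x)) = h (\<mu> A)"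
    if h: "bounded_linear h" and A: "A \<in> sets borel" for h :: "complex^'l^'l \<Rightarrow> 'b::{banach, second_countable_topology}" and A
  proof -
    have As: "A \<in> sets \<tau>" using A sets_\<tau> by simp
    have "h (\<mu> A) = (\<integral>x. h (indicator A x *\<^sub>R W x) \<partial>\<tau>)"
      unfolding W_density[OF A] set_lebesgue_integral_def
      by (rule integral_bounded_linear[OF h integrable_mult_indicator[OF As W_integrable], symmetric])
    also have "\<dots> = set_lebesgue_integral \<tau> A (\<lambda>x. h (W x))"
      unfolding set_lebesgue_integral_def using linear_scale[OF bounded_linear.linear[OF h]] by simp
    finally show ?thesis by simp
  qed
  have herm: "AE x in \<tau>. W x $ j $ i = cnj (W x $ i $ j)" for i j
  proof -
    have b1: "bounded_linear (\<lambda>M :: complex^'l^'l. M $ j $ i)" by (rule bounded_linear_matrix_nth)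
    have b2: "bounded_linear (\<lambda>M :: complex^'l^'l. cnj (M $ i $ j))" 
      by (rule bounded_linear_compose[OF bounded_linear_cnj bounded_linear_matrix_nth])
    show ?thesis
    proof (rule density_unique_banach)
      show "integrable \<tau> (\<lambda>x. W x $ j $ i)" "integrable \<tau> (\<lambda>x. cnj (W x $ i $ j))"
        using integrable_bounded_linear[OF b1 W_integrable] integrable_bounded_linear[OF b2 W_integrable] by auto
      fix A assume "A \<in> sets \<tau>"
      then have A: "A \<in> sets borel" using sets_\<tau> by simp
      show "set_lebesgue_integral \<tau> A (\<lambda>x. W x $ j $ i) = set_lebesgue_integral \<tau> A (\<lambda>x. cnj (W x $ i $ j))"
        using set_int[OF b1 A] set_int[OF b2 A] psd[OF A]
        by (simp add: pos_semidef_def hermitian_adjoint_def vec_eq_iff)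
    qed
  qed
  have "AE x in \<tau>. \<forall>p\<in>(UNIV :: ('l \<times> 'l) set). W x $ snd p $ fst p = cnj (W x $ fst p $ snd p)"
    by (rule AE_finite_allI) (use herm in auto)
  then have H: "AE x in \<tau>. hermitian_adjoint (W x) = W x"
  proof eventually_elim
    case (elim x)
    have h: "cnj (W x $ j $ i) = W x $ i $ j" for i j using bspec[OF elim, of "(j, i)"] by simp
    show ?case unfolding hermitian_adjoint_def vec_eq_iff by (simp add: h)
  qed
  have pos: "AE x in \<tau>. 0 \<le> Re (cdot v (W x *v v))" for v
  proof (rule density_nonneg)
    have b: "bounded_linear (\<lambda>M :: complex^'l^'l. Re (cdot v (M *v v)))"
      by (rule bounded_linear_compose[OF bounded_linear_Re bounded_linear_cdot_matrix])
    show "integrable \<tau> (\<lambda>x. Re (cdot v (W x *v v)))" by (rule integrable_bounded_linear[OF b W_integrable])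
    fix A assume "A \<in> sets \<tau>"
    then have A: "A \<in> sets borel" using sets_\<tau> by simp
    show "0 \<le> set_lebesgue_integral \<tau> A (\<lambda>x. Re (cdot v (W x *v v)))"
      using set_int[OF b A] psd[OF A] by (simp add: pos_semidef_alt)
  qed
  obtain D :: "(complex^'l) set" where D: "countable D" "\<And>X. open X \<Longrightarrow> X \<noteq> {} \<Longrightarrow> \<exists>d\<in>D. d \<in> X"
    by (rule countable_dense_setE) blast
  have "AE x in \<tau>. \<forall>v\<in>D. 0 \<le> Re (cdot v (W x *v v))"
    by (subst AE_ball_countable[OF D(1)]) (auto intro: pos)
  then have "AE x in \<tau>. \<forall>v. 0 \<le> Re (cdot v (W x *v v))"
  proof eventually_elim
    case (elim x)
    have c: "continuous_on UNIV (\<lambda>v. Re (cdot v (W x *v v)))"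
      unfolding cdot_matrix_sum by (intro continuous_intros)
    have o: "open {v. Re (cdot v (W x *v v)) < 0}"
      by (rule open_Collect_less) (use c in auto)
    show ?case
    proof (rule ccontr)
      assume "\<not> ?thesis"
      then have "{v. Re (cdot v (W x *v v)) < 0} \<noteq> {}" by (auto simp: not_le)
      from D(2)[OF o this] elim show False by force
    qed
  qed
  with H show ?thesis by eventually_elim (simp add: pos_semidef_alt)
qed

text \<open>
  By the Lindelof property countably many open null sets cover the complement of the support.
\<close>

lemma AE_supp: "AE x in \<tau>. x \<in> matrix_supp \<mu>"
proof -
  interpret finite_measure \<tau> by (rule finite_measure_\<tau>)
  let ?\<U> = "{U. open U \<and> \<mu> U = 0}"
  obtain \<V> where V: "\<V> \<subseteq> ?\<U>" "countable \<V>" "\<Union>\<V> = \<Union>?\<U>"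
    by (rule Lindelof[of ?\<U>]) auto
  have "AE x in \<tau>. \<forall>U\<in>\<V>. x \<notin> U"
  proof (subst AE_ball_countable[OF V(2)], intro ballI)
    fix U assume "U \<in> \<V>"
    then have U: "open U" "\<mu> U = 0" using V(1) by auto
    have "U \<in> null_sets \<tau>"
      using U trace_measure(3)[OF \<mu>, of U] by (simp add: null_sets_def sets_\<tau> emeasure_eq_measure trace_def)
    then show "AE x in \<tau>. x \<notin> U" by (rule AE_not_in)
  qed
  then show ?thesis
  proof eventually_elim
    case (elim x)
    then have "x \<notin> \<Union>?\<U>" using V(3) by auto
    then show ?case by (auto simp: matrix_supp_def)
  qed
qed

section \<open>The inner product of vector functions\<close>

text \<open>
  The integral of \<open>F(x)\<^sup>\<dagger> d\<mu>(x) G(x)\<close> for vector functions on the complex plane, of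
  which only the values on the real line matter. Vector polynomials are treated as functions so that
  they can be evaluated off the real line.
\<close>

definition form :: "(complex \<Rightarrow> complex^'l) \<Rightarrow> (complex \<Rightarrow> complex^'l) \<Rightarrow> complex" where
  "form F G = (\<integral>x. cdot (F (of_real x)) (W x *v G (of_real x)) \<partial>\<tau>)"

abbreviation cont :: "(complex \<Rightarrow> complex^'l) \<Rightarrow> bool" where
  "cont F \<equiv> continuous_on UNIV F"

lemma cont_of_real_compose: "cont F \<Longrightarrow> continuous_on UNIV (\<lambda>x::real. F (of_real x))"
  by (rule continuous_on_compose2[of UNIV F]) (auto intro: continuous_intros)

lemma form_integrable:
  assumes F: "cont F" and G: "cont G"
  shows "integrable \<tau> (\<lambda>x. cdot (F (of_real x)) (W x *v G (of_real x)))"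
proof -
  have "integrable \<tau> (\<lambda>x. cnj (F (of_real x) $ i) * W x $ i $ j * G (of_real x) $ j)" for i j
  proof -
    let ?h = "\<lambda>x. cnj (F (of_real x) $ i) * G (of_real x) $ j"
    have ch: "continuous_on UNIV ?h"
      by (intro continuous_intros continuous_on_nth cont_of_real_compose F G)
    have "compact (?h ` matrix_supp \<mu>)"
      by (rule compact_continuous_image[OF continuous_on_subset[OF ch] compact_supp]) simp
    then obtain C where C: "\<And>x. x \<in> matrix_supp \<mu> \<Longrightarrow> norm (?h x) \<le> C"
      by (meson bounded_iff compact_imp_bounded imageI)
    have [measurable]: "?h \<in> borel_measurable \<tau>"
      using borel_measurable_continuous_onI[OF ch] by (simp cong: measurable_cong_sets add: sets_\<tau>)
    have iW: "integrable \<tau> (\<lambda>x. W x $ i $ j)" by (rule integral_matrix_nth(2)[OF W_integrable])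
    have "integrable \<tau> (\<lambda>x. ?h x * W x $ i $ j)"
    proof (rule Bochner_Integration.integrable_bound)
      show "integrable \<tau> (\<lambda>x. C *\<^sub>R norm (W x $ i $ j))" using iW by (intro integrable_scaleR_right integrable_norm)
      show "(\<lambda>x. ?h x * W x $ i $ j) \<in> borel_measurable \<tau>"
        using borel_measurable_integrable[OF iW] by measurable
      show "AE x in \<tau>. norm (?h x * W x $ i $ j) \<le> norm (C *\<^sub>R norm (W x $ i $ j))"
        using AE_supp
      proof eventually_elim
        case (elim x)
        then have "norm (?h x) * norm (W x $ i $ j) \<le> C * norm (W x $ i $ j)" "0 \<le> C"
          using C[of x] order_trans[OF norm_ge_zero C[of x]] by (auto intro!: mult_right_mono simp: norm_mult)
        then show ?case by (simp add: norm_mult)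
      qed
    qed
    then show ?thesis by (simp add: mult_ac)
  qed
  then show ?thesis unfolding cdot_matrix_sum by (intro Bochner_Integration.integrable_sum)
qed

lemma form_add_right: "cont F \<Longrightarrow> cont G \<Longrightarrow> cont H \<Longrightarrow> form F (\<lambda>z. G z + H z) = form F G + form F H"
  unfolding form_def by (simp add: matrix_vector_right_distrib cdot_add_right form_integrable)

lemma form_cnj: "cont F \<Longrightarrow> cont G \<Longrightarrow> form G F = cnj (form F G)"
proof -
  assume c: "cont F" "cont G"
  have "form G F = (\<integral>x. cnj (cdot (F (of_real x)) (W x *v G (of_real x))) \<partial>\<tau>)"
    unfolding form_def
  proof (rule integral_cong_AE)
    show "AE x in \<tau>. cdot (G (of_real x)) (W x *v F (of_real x)) = cnj (cdot (F (of_real x)) (W x *v G (of_real x)))"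
      using AE_pos_semidef_W
    proof eventually_elim
      case (elim x)
      then have "hermitian_adjoint (W x) = W x" by (simp add: pos_semidef_def)
      then show ?case by (metis cdot_hermitian_adjoint cnj_cdot)
    qed
    show "(\<lambda>x. cdot (G (of_real x)) (W x *v F (of_real x))) \<in> borel_measurable \<tau>"
      by (rule borel_measurable_integrable[OF form_integrable[OF c(2,1)]])
    show "(\<lambda>x. cnj (cdot (F (of_real x)) (W x *v G (of_real x)))) \<in> borel_measurable \<tau>"
      by (rule borel_measurable_integrable[OF integrable_bounded_linear[OF bounded_linear_cnj form_integrable[OF c]]])
  qed
  then show ?thesis by (simp add: form_def)
qed

lemma form_zero_right: "form F (\<lambda>z. 0) = 0" by (simp add: form_def)

lemma form_sum_right:
  "finite I \<Longrightarrow> cont F \<Longrightarrow> (\<And>i. i \<in> I \<Longrightarrow> cont (G i)) \<Longrightarrow> form F (\<lambda>z. \<Sum>i\<in>I. G i z) = (\<Sum>i\<in>I. form F (G i))"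
  by (induction I rule: finite_induct) (auto simp: form_zero_right form_add_right continuous_on_sum)

text \<open>
  Multiplication by the variable is symmetric because the measure lives on the real line.
\<close>

lemma form_mult_real_axis: "form (\<lambda>z. z *s F z) G = form F (\<lambda>z. z *s G z)"
  unfolding form_def by (simp add: matrix_vector_mult_scale cdot_scale_left cdot_scale_right)

text \<open>
  Multiplication by the variable has norm at most \<open>a\<close>.
\<close>

lemma form_x_le:
  assumes F: "cont F" and G: "cont G" and t: "0 < t"
  shows "2 * cmod (form F (\<lambda>z. z *s G z)) \<le> a * (t * Re (form F F) + Re (form G G) / t)"
proof -
  have xG: "cont (\<lambda>z. z *s G z)" unfolding vector_scalar_mult_def
    by (intro continuous_intros continuous_on_vec_lambda continuous_on_nth G)
  note i = form_integrable[OF F F] form_integrable[OF G G] form_integrable[OF F xG]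
  have "2 * cmod (form F (\<lambda>z. z *s G z)) \<le> 2 * (\<integral>x. cmod (cdot (F (of_real x)) (W x *v (of_real x *s G (of_real x)))) \<partial>\<tau>)"
    unfolding form_def by (intro mult_left_mono integral_norm_bound) auto
  also have "\<dots> = (\<integral>x. 2 * cmod (cdot (F (of_real x)) (W x *v (of_real x *s G (of_real x)))) \<partial>\<tau>)"
    by simp
  also have "\<dots> \<le> (\<integral>x. a * (t * Re (cdot (F (of_real x)) (W x *v F (of_real x))) + Re (cdot (G (of_real x)) (W x *v G (of_real x))) / t) \<partial>\<tau>)"
  proof (rule integral_mono_AE)
    show "AE x in \<tau>. 2 * cmod (cdot (F (of_real x)) (W x *v (of_real x *s G (of_real x)))) \<le>
      a * (t * Re (cdot (F (of_real x)) (W x *v F (of_real x))) + Re (cdot (G (of_real x)) (W x *v G (of_real x))) / t)"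
      using AE_pos_semidef_W AE_supp
    proof eventually_elim
      case (elim x)
      have "2 * cmod (cdot (F (of_real x)) (W x *v (of_real x *s G (of_real x))))
         = \<bar>x\<bar> * (2 * cmod (cdot (F (of_real x)) (W x *v G (of_real x))))"
        by (simp add: matrix_vector_mult_scale cdot_scale_right norm_mult)
      also have "\<dots> \<le> a * (t * Re (cdot (F (of_real x)) (W x *v F (of_real x))) + Re (cdot (G (of_real x)) (W x *v G (of_real x))) / t)"
        by (intro mult_mono pos_semidef_cdot_le elim t supp_bounded) (use a_pos in auto)
      finally show ?case .
    qed
    show "integrable \<tau> (\<lambda>x. 2 * cmod (cdot (F (of_real x)) (W x *v (of_real x *s G (of_real x)))))"
      by (intro integrable_mult_right integrable_norm i)
    show "integrable \<tau> (\<lambda>x. a * (t * Re (cdot (F (of_real x)) (W x *v F (of_real x))) + Re (cdot (G (of_real x)) (W x *v G (of_real x))) / t))"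
      by (intro integrable_mult_right Bochner_Integration.integrable_add integrable_divide integrable_Re i)
  qed
  also have "\<dots> = a * (t * Re (form F F) + Re (form G G) / t)"
    unfolding form_def using i by (simp add: integrable_Re flip: integral_Re)
  finally show ?thesis .
qed

lemma form_scalar_le:
  assumes q: "continuous_on UNIV q" "\<And>x. x \<in> matrix_supp \<mu> \<Longrightarrow> cmod (q (of_real x)) \<le> 1"
  shows "Re (form (\<lambda>z. q z *s v) (\<lambda>z. q z *s v)) \<le> (norm v)\<^sup>2"
proof -
  have c: "cont (\<lambda>z. q z *s v)" "cont (\<lambda>z. v)" unfolding vector_scalar_mult_def
    by (intro continuous_intros continuous_on_vec_lambda q)+
  have "form (\<lambda>z. v) (\<lambda>z. v) = cdot v v"
  proof -
    have "form (\<lambda>z. v) (\<lambda>z. v) = cdot v (integral\<^sup>L \<tau> W *v v)"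
      unfolding form_def by (rule integral_bounded_linear[OF bounded_linear_cdot_matrix W_integrable])
    also have "integral\<^sup>L \<tau> W = \<mu> UNIV" using W_density[of UNIV] by (simp add: set_lebesgue_integral_def)
    finally show ?thesis by (simp add: normalised)
  qed
  then have "(norm v)\<^sup>2 = Re (form (\<lambda>z. v) (\<lambda>z. v))" by (simp add: cdot_self)
  also have "\<dots> = (\<integral>x. Re (cdot v (W x *v v)) \<partial>\<tau>)"
    unfolding form_def by (rule integral_Re[symmetric, OF form_integrable[OF c(2,2)]])
  finally have v: "(norm v)\<^sup>2 = (\<integral>x. Re (cdot v (W x *v v)) \<partial>\<tau>)" .
  have "Re (form (\<lambda>z. q z *s v) (\<lambda>z. q z *s v)) = (\<integral>x. Re (cdot (q (of_real x) *s v) (W x *v (q (of_real x) *s v))) \<partial>\<tau>)"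
    unfolding form_def by (rule integral_Re[symmetric, OF form_integrable[OF c(1,1)]])
  also have "\<dots> \<le> (\<integral>x. Re (cdot v (W x *v v)) \<partial>\<tau>)"
  proof (rule integral_mono_AE)
    show "AE x in \<tau>. Re (cdot (q (of_real x) *s v) (W x *v (q (of_real x) *s v))) \<le> Re (cdot v (W x *v v))"
      using AE_pos_semidef_W AE_supp
    proof eventually_elim
      case (elim x)
      have "cdot (q (of_real x) *s v) (W x *v (q (of_real x) *s v)) = of_real ((cmod (q (of_real x)))\<^sup>2) * cdot v (W x *v v)"
      proof -
        have "of_real ((cmod (q (of_real x)))\<^sup>2) = cnj (q (of_real x)) * q (of_real x)"
          by (metis complex_norm_square mult.commute)
        then show ?thesis
          by (simp only: matrix_vector_mult_scale cdot_scale_left cdot_scale_right mult_ac)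
      qed
      then have "Re (cdot (q (of_real x) *s v) (W x *v (q (of_real x) *s v))) = (cmod (q (of_real x)))\<^sup>2 * Re (cdot v (W x *v v))"
        by simp
      also have "\<dots> \<le> 1 * Re (cdot v (W x *v v))"
        using elim q(2)[of x] by (intro mult_right_mono power_le_one) (auto simp: pos_semidef_alt)
      finally show ?case by simp
    qed
    show "integrable \<tau> (\<lambda>x. Re (cdot (q (of_real x) *s v) (W x *v (q (of_real x) *s v))))"
      by (rule integrable_Re[OF form_integrable[OF c(1,1)]])
    show "integrable \<tau> (\<lambda>x. Re (cdot v (W x *v v)))"
      by (rule integrable_Re[OF form_integrable[OF c(2,2)]])
  qed
  finally show ?thesis using v by simp
qed

lemma continuous_eval_mp: "continuous_on UNIV (\<lambda>z. eval_mp f z *v v)"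
  unfolding matrix_vector_mult_def eval_mp_def
  by (intro continuous_on_vec_lambda) (auto intro!: continuous_intros)

text \<open>
  This reduces the matrix-valued inner product to the scalar one.
\<close>

lemma cdot_inner_R:
  "cdot u (inner_R \<mu> f g *v v) = form (\<lambda>z. eval_mp f z *v u) (\<lambda>z. eval_mp g z *v v)"
proof -
  let ?M = "\<lambda>x::real. hermitian_adjoint (eval_mp f (of_real x)) ** W x ** eval_mp g (of_real x)"
  have pt: "cdot u (?M x *v v) = cdot (eval_mp f (of_real x) *v u) (W x *v (eval_mp g (of_real x) *v v))" for x u v
    by (simp add: matrix_vector_mul_assoc[symmetric] matrix_mul_assoc[symmetric] cdot_hermitian_adjoint[of u])
  have "integrable \<tau> ?M"
  proof (rule integrable_matrixI)
    fix i j
    have "?M x $ i $ j = cdot (axis i 1) (?M x *v axis j 1)" for x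
      by (simp add: cdot_axis_left matrix_mult_axis_nth)
    then show "integrable \<tau> (\<lambda>x. ?M x $ i $ j)"
      unfolding pt using form_integrable[OF continuous_eval_mp continuous_eval_mp] by simp
  qed
  then have "cdot u (inner_R \<mu> f g *v v) = (\<integral>x. cdot u (?M x *v v) \<partial>\<tau>)"
    unfolding inner_R_def by (rule integral_bounded_linear[OF bounded_linear_cdot_matrix, symmetric])
  then show ?thesis unfolding pt form_def .
qed

end

section \<open>Orthonormal matrix polynomials off the real line\<close>

lemma scale_sum: "c *s (\<Sum>i\<in>I. f i) = (\<Sum>i\<in>I. c *s f i)" for f :: "'a \<Rightarrow> complex^'n"
  by (induction I rule: infinite_finite_induct) (simp_all add: vector_add_ldistrib)

lemma inj_matrix_vector_mult_imp_right_inverse: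
  fixes M :: "complex^'l^'l::finite"
  assumes "\<And>v. M *v v = 0 \<Longrightarrow> v = 0"
  obtains N where "M ** N = mat 1" "N ** M = mat 1"
proof -
  have "inj ((*v) M)"
  proof (rule injI)
    fix x y assume "M *v x = M *v y"
    then have "M *v (x - y) = 0" by (simp add: matrix_vector_mult_diff_distrib)
    then show "x = y" using assms by fastforce
  qed
  then obtain N where "N ** M = mat 1" using matrix_left_invertible_injective by blast
  then show ?thesis using that matrix_left_right_inverse by blast
qed

lemma eval_times_x: "eval_mp (times_x f) z *v v = z *s (eval_mp f z *v v)"
  by (simp add: eval_mp_def times_x_def matrix_vector_mult_def vec_eq_iff sum_distrib_left mult_ac)

lemma poly_eq_sum_atMost: fixes q :: "complex poly" shows "degree q \<le> n \<Longrightarrow> poly q z = (\<Sum>k\<le>n. coeff q k * z ^ k)"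
  unfolding poly_altdef by (rule sum.mono_neutral_left) (auto simp: coeff_eq_0)

text \<open>
  Vector polynomials are kept as functions, as they are evaluated both on the real line, in the inner
  product, and off it.
\<close>

definition vpoly :: "nat \<Rightarrow> (complex \<Rightarrow> complex^'l) \<Rightarrow> bool" where
  "vpoly n F \<longleftrightarrow> (\<exists>c. \<forall>z. F z = (\<Sum>k\<le>n. z ^ k *s c k))"

lemma vpolyI: "(\<And>z. F z = (\<Sum>k\<le>n. z ^ k *s c k)) \<Longrightarrow> vpoly n F"
  unfolding vpoly_def by (rule exI[of _ c]) simp

lemma vpoly_times: "vpoly n F \<Longrightarrow> vpoly (Suc n) (\<lambda>z. z *s F z)"
proof -
  assume "vpoly n F"
  then obtain c where c: "\<And>z. F z = (\<Sum>k\<le>n. z ^ k *s c k)" by (auto simp: vpoly_def)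
  have "z *s F z = (\<Sum>k\<le>Suc n. z ^ k *s (case k of 0 \<Rightarrow> 0 | Suc j \<Rightarrow> c j))" for z
    by (subst sum.atMost_Suc_shift) (simp add: c scale_sum vector_smult_assoc)
  then show ?thesis unfolding vpoly_def by blast
qed

locale orthonormal_matrix_polynomials = compact_matrix_measure \<mu> a
  for \<mu> :: "real set \<Rightarrow> complex^'l^'l::finite" and a :: real +
  fixes p :: "nat \<Rightarrow> 'l mat_poly"
  assumes orthonormal: "right_orthonormal \<mu> p"
begin

definition P :: "nat \<Rightarrow> complex \<Rightarrow> complex^'l^'l" where "P n z = eval_mp (p n) z"

definition lead :: "nat \<Rightarrow> complex^'l^'l" where "lead n = (\<chi> i j. coeff (p n $ i $ j) n)"

abbreviation A :: "nat \<Rightarrow> complex^'l^'l" where "A n \<equiv> jacobi_A \<mu> p n"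

definition B :: "nat \<Rightarrow> complex^'l^'l" where "B n = inner_R \<mu> (p n) (times_x (p n))"

lemma degree_p: "degree (p n $ i $ j) \<le> n"
proof -
  have "degree (p n $ i $ j) \<le> degree_mp (p n)"
    unfolding degree_mp_def by (rule Max_ge) (auto intro: image_eqI[of _ _ "(i, j)"])
  then show ?thesis using orthonormal by (simp add: right_orthonormal_def)
qed

lemma cont_P: "cont (\<lambda>z. P n z *v v)" unfolding P_def by (rule continuous_eval_mp)

lemma P_0: "P 0 z = mat 1"
  using orthonormal by (simp add: right_orthonormal_def P_def eval_mp_def mat_def vec_eq_iff)

lemma lead_0: "lead 0 = mat 1"
  using orthonormal by (simp add: right_orthonormal_def lead_def mat_def vec_eq_iff)

lemma form_P: "form (\<lambda>z. P n z *v u) (\<lambda>z. P m z *v v) = (if n = m then cdot u v else 0)"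
proof -
  have "form (\<lambda>z. P n z *v u) (\<lambda>z. P m z *v v) = cdot u (inner_R \<mu> (p n) (p m) *v v)"
    by (simp add: cdot_inner_R P_def)
  then show ?thesis using orthonormal by (simp add: right_orthonormal_def)
qed

lemma cdot_A: "cdot u (A (Suc n) *v v) = form (\<lambda>z. P n z *v u) (\<lambda>z. z *s (P (Suc n) z *v v))"
  by (simp add: jacobi_A_def cdot_inner_R P_def eval_times_x)

lemma cdot_B: "cdot u (B n *v v) = form (\<lambda>z. P n z *v u) (\<lambda>z. z *s (P n z *v v))"
  by (simp add: B_def cdot_inner_R P_def eval_times_x)

lemma cont_scale: "cont F \<Longrightarrow> continuous_on UNIV q \<Longrightarrow> cont (\<lambda>z. q z *s F z)"
  unfolding vector_scalar_mult_def by (intro continuous_intros continuous_on_vec_lambda continuous_on_nth)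

lemma cont_xP: "cont (\<lambda>z. z *s (P n z *v v))"
  by (intro cont_scale cont_P continuous_intros)

lemma form_xP: "form (\<lambda>z. P n z *v u) (\<lambda>z. z *s (P m z *v v)) = cnj (form (\<lambda>z. P m z *v v) (\<lambda>z. z *s (P n z *v u)))"
proof -
  have "form (\<lambda>z. P n z *v u) (\<lambda>z. z *s (P m z *v v)) = cnj (form (\<lambda>z. z *s (P m z *v v)) (\<lambda>z. P n z *v u))"
    by (rule form_cnj[OF cont_xP cont_P])
  then show ?thesis by (simp only: form_mult_real_axis)
qed

lemma P_expand: "P n z *v v = (\<Sum>k\<le>n. z ^ k *s ((\<chi> i j. coeff (p n $ i $ j) k) *v v))"
proof -
  have "(P n z *v v) $ i = (\<Sum>k\<le>n. z ^ k *s ((\<chi> i j. coeff (p n $ i $ j) k) *v v)) $ i" for i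
  proof -
    have "poly (p n $ i $ j) z = (\<Sum>k\<le>n. coeff (p n $ i $ j) k * z ^ k)" for j
      by (rule poly_eq_sum_atMost[OF degree_p])
    then have "(P n z *v v) $ i = (\<Sum>j\<in>UNIV. \<Sum>k\<le>n. coeff (p n $ i $ j) k * z ^ k * v $ j)"
      by (simp add: P_def eval_mp_def matrix_vector_mult_def sum_distrib_right)
    also have "\<dots> = (\<Sum>k\<le>n. \<Sum>j\<in>UNIV. coeff (p n $ i $ j) k * z ^ k * v $ j)" by (rule sum.swap)
    finally show ?thesis by (simp add: matrix_vector_mult_def sum_distrib_left mult_ac)
  qed
  then show ?thesis by (simp add: vec_eq_iff)
qed

lemma vpoly_P: "vpoly n (\<lambda>z. P n z *v v)" unfolding vpoly_def P_expand by (rule exI, rule allI, rule refl)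

text \<open>
  The coefficients of an expansion in the orthonormal polynomials are read off from inner products.
\<close>

lemma form_P_sum: "form (\<lambda>z. P m z *v u) (\<lambda>z. \<Sum>j\<le>n. P j z *v d j) = (if m \<le> n then cdot u (d m) else 0)"
  by (subst form_sum_right) (auto simp: cont_P form_P)

text \<open>
  Both facts are proved in one induction. If the leading coefficient kills \<open>v\<close>, then \<open>p\<^sub>n v\<close> has
  smaller degree, so it is a combination of the earlier polynomials, to which it is orthogonal; hence
  its norm, which is that of \<open>v\<close>, is zero. An injective leading coefficient is surjective and can be
  used to lower the degree of an arbitrary vector polynomial.
\<close>

lemma lead_inj_and_span:
  "(\<forall>v. lead n *v v = 0 \<longrightarrow> v = 0) \<and> (\<forall>F. vpoly n F \<longrightarrow> (\<exists>d. \<forall>z. F z = (\<Sum>j\<le>n. P j z *v d j)))"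
proof (induction n)
  case 0
  show ?case by (auto simp: lead_0 P_0 vpoly_def)
next
  case (Suc n)
  have inj: "v = 0" if v: "lead (Suc n) *v v = 0" for v
  proof -
    have "vpoly n (\<lambda>z. P (Suc n) z *v v)"
      unfolding vpoly_def P_expand using v by (auto simp: lead_def)
    then obtain d where d: "\<And>z. P (Suc n) z *v v = (\<Sum>j\<le>n. P j z *v d j)" using Suc by blast
    have "cdot v v = form (\<lambda>z. P (Suc n) z *v v) (\<lambda>z. P (Suc n) z *v v)" by (simp add: form_P)
    also have "\<dots> = form (\<lambda>z. P (Suc n) z *v v) (\<lambda>z. \<Sum>j\<le>n. P j z *v d j)" by (simp add: d)
    also have "\<dots> = 0" by (simp add: form_P_sum)
    finally show "v = 0" by (simp add: cdot_self)
  qed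
  obtain N where N: "lead (Suc n) ** N = mat 1"
    using inj_matrix_vector_mult_imp_right_inverse[of "lead (Suc n)"] inj by metis
  have "\<exists>d. \<forall>z. F z = (\<Sum>j\<le>Suc n. P j z *v d j)" if F: "vpoly (Suc n) F" for F
  proof -
    obtain c where c: "\<And>z. F z = (\<Sum>k\<le>Suc n. z ^ k *s c k)" using F unfolding vpoly_def by blast
    define v where "v = N *v c (Suc n)"
    have lv: "lead (Suc n) *v v = c (Suc n)" by (simp add: v_def matrix_vector_mul_assoc N)
    have "F z - P (Suc n) z *v v = (\<Sum>k\<le>n. z ^ k *s (c k - (\<chi> i j. coeff (p (Suc n) $ i $ j) k) *v v))" for z
      unfolding c P_expand using lv by (simp add: lead_def vector_sub_rdistrib vector_ssub_ldistrib sum_subtractf)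
    then have "vpoly n (\<lambda>z. F z - P (Suc n) z *v v)" by (rule vpolyI)
    then obtain d where d: "\<And>z. F z - P (Suc n) z *v v = (\<Sum>j\<le>n. P j z *v d j)" using Suc by blast
    have "F z = (\<Sum>j\<le>Suc n. P j z *v (d(Suc n := v)) j)" for z
    proof -
      have "(\<Sum>j\<le>n. P j z *v (d(Suc n := v)) j) = (\<Sum>j\<le>n. P j z *v d j)"
        by (rule sum.cong) auto
      then show ?thesis using d[of z] by (simp add: algebra_simps)
    qed
    then show ?thesis by blast
  qed
  with inj show ?case by blast
qed

text \<open>
  Expand \<open>z p\<^sub>n(z) v\<close> in the orthonormal polynomials. The coefficients below \<open>n - 1\<close> vanish by the
  symmetry of the multiplication by the variable.
\<close>

lemma three_term:
  "z *s (P n z *v v) = P (Suc n) z *v (hermitian_adjoint (A (Suc n)) *v v) + P n z *v (B n *v v) +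
     (if n = 0 then 0 else P (n - 1) z *v (A n *v v))"
proof -
  obtain d where d: "\<And>z. z *s (P n z *v v) = (\<Sum>j\<le>Suc n. P j z *v d j)"
    using lead_inj_and_span[of "Suc n"] vpoly_times[OF vpoly_P, of n v] by blast
  have cd: "cdot u (d j) = form (\<lambda>z. P j z *v u) (\<lambda>z. z *s (P n z *v v))" if "j \<le> Suc n" for u j
    unfolding d using that by (simp add: form_P_sum del: sum.atMost_Suc)
  have d1: "d (Suc n) = hermitian_adjoint (A (Suc n)) *v v"
  proof (rule cdot_eqI)
    fix u
    have "cdot u (d (Suc n)) = cnj (cdot v (A (Suc n) *v u))" by (simp add: cd cdot_A form_xP[of "Suc n"])
    also have "\<dots> = cdot u (hermitian_adjoint (A (Suc n)) *v v)"
      by (simp add: cnj_cdot cdot_hermitian_adjoint)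
    finally show "cdot u (d (Suc n)) = cdot u (hermitian_adjoint (A (Suc n)) *v v)" .
  qed
  have d0: "d n = B n *v v" by (rule cdot_eqI) (simp add: cd cdot_B)
  show ?thesis
  proof (cases n)
    case 0 then show ?thesis unfolding d using d1 d0 by (simp add: add.commute)
  next
    case (Suc m)
    have dm: "d m = A (Suc m) *v v" by (rule cdot_eqI) (simp add: cd Suc cdot_A)
    have dz: "d j = 0" if "j < m" for j
    proof (rule cdot_eqI)
      fix u
      obtain e where e: "\<And>z. z *s (P j z *v u) = (\<Sum>k\<le>Suc j. P k z *v e k)"
        using lead_inj_and_span[of "Suc j"] vpoly_times[OF vpoly_P, of j u] by blast
      have "cdot u (d j) = cnj (form (\<lambda>z. P n z *v v) (\<lambda>z. z *s (P j z *v u)))"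
        using that Suc by (simp add: cd form_xP[of j])
      also have "\<dots> = 0" unfolding e using that Suc by (simp add: form_P_sum del: sum.atMost_Suc)
      finally show "cdot u (d j) = cdot u 0" by simp
    qed
    have "(\<Sum>j\<le>Suc n. P j z *v d j) = (\<Sum>j<m. P j z *v d j) + P m z *v d m + P n z *v d n + P (Suc n) z *v d (Suc n)"
      by (simp add: Suc lessThan_Suc_atMost[symmetric])
    also have "(\<Sum>j<m. P j z *v d j) = 0" by (rule sum.neutral) (simp add: dz)
    finally show ?thesis unfolding d using d1 d0 dm Suc by (simp add: add_ac)
  qed
qed

text \<open>
  Compare the coefficients of order \<open>n + 1\<close> in the three-term recurrence.
\<close>

lemma lead_Suc: "lead n = lead (Suc n) ** hermitian_adjoint (A (Suc n))"
proof -
  \<comment> \<open>The entries of \<open>p\<^sub>m v\<close> as formal polynomials, whose coefficients can be compared.\<close>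
  define vp where "vp m v i = (\<Sum>j\<in>UNIV. smult (v $ j) (p m $ i $ j))" for m and v :: "complex^'l" and i
  have poly_vp: "poly (vp m v i) z = (P m z *v v) $ i" for m v i z
    by (simp add: vp_def P_def eval_mp_def matrix_vector_mult_def poly_sum mult.commute)
  have coeff_vp: "coeff (vp m v i) m = (lead m *v v) $ i" for m v i
    by (simp add: vp_def lead_def matrix_vector_mult_def coeff_sum mult.commute)
  have coeff_vp0: "coeff (vp m v i) k = 0" if "m < k" for m v i k
    unfolding vp_def coeff_sum using that le_less_trans[OF degree_p]
    by (intro sum.neutral) (auto intro!: coeff_eq_0)
  have "lead n *v v = lead (Suc n) *v (hermitian_adjoint (A (Suc n)) *v v)" for v
  proof -
    let ?A = "hermitian_adjoint (A (Suc n)) *v v"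
    have "(lead n *v v) $ i = (lead (Suc n) *v ?A) $ i" for i
    proof -
      have "pCons 0 (vp n v i) = vp (Suc n) ?A i + vp n (B n *v v) i + (if n = 0 then 0 else vp (n - 1) (A n *v v) i)"
        (is "?l = ?r")
      proof -
        have "poly ?l z = poly ?r z" for z
          using arg_cong[OF three_term[of z n v], of "\<lambda>u. u $ i"] by (auto simp: poly_vp split: if_splits)
        then have "poly ?l = poly ?r" by blast
        then show ?thesis by (simp only: poly_eq_poly_eq_iff)
      qed
      then have "coeff (pCons 0 (vp n v i)) (Suc n) = coeff (vp (Suc n) ?A i + vp n (B n *v v) i + (if n = 0 then 0 else vp (n - 1) (A n *v v) i)) (Suc n)"
        by simp
      then show ?thesis by (auto simp: coeff_vp coeff_vp0 split: if_splits)
    qed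
    then show ?thesis by (simp add: vec_eq_iff)
  qed
  then show ?thesis
    by (metis matrix_eq matrix_vector_mul_assoc)
qed

text \<open>
  For fixed \<open>z\<close> and \<open>w\<close> these vectors satisfy the adjoint of the three-term recurrence: they are a
  formal eigenvector of the block Jacobi matrix with eigenvalue the conjugate of \<open>z\<close>.
\<close>

definition \<phi> :: "complex \<Rightarrow> complex^'l \<Rightarrow> nat \<Rightarrow> complex^'l" where
  "\<phi> z w j = hermitian_adjoint (P j z) *v w"

lemma cdot_P: "cdot w (P j z *v v) = cdot (\<phi> z w j) v"
  unfolding \<phi>_def by (rule cdot_hermitian_adjoint)

lemma \<phi>_0: "\<phi> z w 0 = w"
proof -
  have "hermitian_adjoint (mat 1 :: complex^'l^'l) = mat 1" by (auto simp: hermitian_adjoint_def mat_def vec_eq_iff)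
  then show ?thesis by (simp add: \<phi>_def P_0)
qed

definition \<alpha> :: "complex \<Rightarrow> complex^'l \<Rightarrow> nat \<Rightarrow> complex" where
  "\<alpha> z w n = cdot (\<phi> z w n) (A (Suc n) *v \<phi> z w (Suc n))"

definition \<beta> :: "complex \<Rightarrow> complex^'l \<Rightarrow> nat \<Rightarrow> complex" where
  "\<beta> z w n = cdot (\<phi> z w n) (B n *v \<phi> z w n)"

text \<open>
  The diagonal of the Christoffel-Darboux kernel, applied to \<open>w\<close>.
\<close>

definition K :: "complex \<Rightarrow> complex^'l \<Rightarrow> nat \<Rightarrow> real" where
  "K z w N = (\<Sum>n\<le>N. (norm (\<phi> z w n))\<^sup>2)"

lemma phi_rec:
  "z * of_real ((norm (\<phi> z w n))\<^sup>2) = cnj (\<alpha> z w n) + \<beta> z w n + (if n = 0 then 0 else \<alpha> z w (n - 1))"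
proof -
  have "z * of_real ((norm (\<phi> z w n))\<^sup>2) = cdot w (z *s (P n z *v \<phi> z w n))"
    by (simp add: cdot_scale_right cdot_P cdot_self)
  also have "\<dots> = cdot (\<phi> z w (Suc n)) (hermitian_adjoint (A (Suc n)) *v \<phi> z w n) + cdot (\<phi> z w n) (B n *v \<phi> z w n)
     + (if n = 0 then 0 else cdot (\<phi> z w (n - 1)) (A n *v \<phi> z w n))"
    unfolding three_term by (simp add: cdot_add_right cdot_P)
  also have "cdot (\<phi> z w (Suc n)) (hermitian_adjoint (A (Suc n)) *v \<phi> z w n) = cnj (\<alpha> z w n)"
    unfolding \<alpha>_def by (simp add: cnj_cdot cdot_hermitian_adjoint)
  finally show ?thesis by (cases n) (auto simp: \<alpha>_def \<beta>_def)
qed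

lemma form_P_norm: "Re (form (\<lambda>z. P n z *v v) (\<lambda>z. P n z *v v)) = (norm v)\<^sup>2"
  by (simp add: form_P cdot_self)

lemma alpha_le: "0 < t \<Longrightarrow> 2 * cmod (\<alpha> z w n) \<le> a * (t * (norm (\<phi> z w n))\<^sup>2 + (norm (\<phi> z w (Suc n)))\<^sup>2 / t)"
  unfolding \<alpha>_def cdot_A using form_x_le[OF cont_P cont_P] by (simp add: form_P_norm)

lemma beta_le: "cmod (\<beta> z w n) \<le> a * (norm (\<phi> z w n))\<^sup>2"
  unfolding \<beta>_def cdot_B using form_x_le[OF cont_P cont_P, of 1 n "\<phi> z w n" n "\<phi> z w n"] by (simp add: form_P_norm)

lemma Im_beta: "Im (\<beta> z w n) = 0"
proof -
  have "\<beta> z w n = cnj (\<beta> z w n)" unfolding \<beta>_def cdot_B by (rule form_xP)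
  then show ?thesis by (simp add: complex_eq_iff)
qed

text \<open>
  Summing the recurrence, the off-diagonal terms pair up to real numbers, except for the last one.
\<close>

lemma christoffel_darboux:
  "z * of_real (K z w N) = cnj (\<alpha> z w N) + of_real ((\<Sum>n\<le>N. Re (\<beta> z w n)) + 2 * (\<Sum>n<N. Re (\<alpha> z w n)))"
proof (induction N)
  case 0
  have "\<beta> z w 0 = of_real (Re (\<beta> z w 0))" using Im_beta by (simp add: complex_eq_iff)
  then show ?case using phi_rec[of z w 0] by (simp add: K_def)
next
  case (Suc N)
  have b: "\<beta> z w (Suc N) = of_real (Re (\<beta> z w (Suc N)))" using Im_beta by (simp add: complex_eq_iff)
  have "z * of_real (K z w (Suc N)) = z * of_real (K z w N) + z * of_real ((norm (\<phi> z w (Suc N)))\<^sup>2)"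
    by (simp add: K_def distrib_left)
  also have "\<dots> = cnj (\<alpha> z w (Suc N)) + of_real (Re (\<beta> z w (Suc N))) + (\<alpha> z w N + cnj (\<alpha> z w N))
     + of_real ((\<Sum>n\<le>N. Re (\<beta> z w n)) + 2 * (\<Sum>n<N. Re (\<alpha> z w n)))"
    unfolding Suc.IH phi_rec using b by simp
  also have "\<alpha> z w N + cnj (\<alpha> z w N) = of_real (2 * Re (\<alpha> z w N))" by (rule complex_add_cnj)
  finally show ?case by (simp add: add_ac)
qed

lemma K_nonneg: "0 \<le> K z w N" unfolding K_def by (intro sum_nonneg) simp

text \<open>
  The imaginary part of the Christoffel-Darboux identity bounds \<open>|Im z| K\<close> by the last off-diagonal
  term. The additive Cauchy-Schwarz inequality with weight \<open>|Im z| / a\<close> splits it so that the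
  contribution of the \<open>N\<close>-th vector is absorbed in half of the left-hand side.
\<close>

lemma phi_Suc_ge:
  assumes z: "Im z \<noteq> 0"
  shows "(\<bar>Im z\<bar> / a)\<^sup>2 * K z w N \<le> (norm (\<phi> z w (Suc N)))\<^sup>2"
proof -
  let ?y = "\<bar>Im z\<bar>"
  have "Im z * K z w N = - Im (\<alpha> z w N)"
    using arg_cong[OF christoffel_darboux[of z w N], of Im] by simp
  then have "?y * K z w N \<le> cmod (\<alpha> z w N)"
    using abs_Im_le_cmod[of "\<alpha> z w N"] K_nonneg[of z w N] by (metis abs_minus abs_mult abs_of_nonneg)
  then have "2 * ?y * K z w N \<le> a * (?y / a * (norm (\<phi> z w N))\<^sup>2 + (norm (\<phi> z w (Suc N)))\<^sup>2 / (?y / a))"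
    using alpha_le[of "?y / a" z w N] z a_pos by simp
  also have "\<dots> = ?y * (norm (\<phi> z w N))\<^sup>2 + a\<^sup>2 / ?y * (norm (\<phi> z w (Suc N)))\<^sup>2"
    using z a_pos by (simp add: field_simps power2_eq_square)
  also have "(norm (\<phi> z w N))\<^sup>2 \<le> K z w N"
    unfolding K_def by (rule member_le_sum) auto
  finally have "?y * K z w N \<le> a\<^sup>2 / ?y * (norm (\<phi> z w (Suc N)))\<^sup>2" by (simp add: mult_left_mono)
  then have "(?y / a\<^sup>2) * (?y * K z w N) \<le> (?y / a\<^sup>2) * (a\<^sup>2 / ?y * (norm (\<phi> z w (Suc N)))\<^sup>2)"
    by (rule mult_left_mono) auto
  then show ?thesis using z a_pos by (simp add: power_divide power2_eq_square)
qed

text \<open>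
  The expansion coefficients \<open>d j\<close> of \<open>q(x) w\<close> satisfy Parseval's identity, so the sum of their squared
  norms is the squared norm of \<open>q(x) w\<close>, at most that of \<open>w\<close>. Evaluating the expansion at \<open>z\<close> and
  pairing with \<open>w\<close> gives the bound by the Cauchy-Schwarz inequality.
\<close>

lemma K_ge:
  assumes q: "degree q \<le> N" "\<And>x. x \<in> matrix_supp \<mu> \<Longrightarrow> cmod (poly q (of_real x)) \<le> 1"
  shows "(cmod (poly q z))\<^sup>2 * (norm w)\<^sup>2 \<le> K z w N"
proof (cases "w = 0")
  case True then show ?thesis using K_nonneg by simp
next
  case False
  let ?F = "\<lambda>z. poly q z *s w"
  have cq: "continuous_on UNIV (poly q)" by (intro continuous_intros)
  have cF: "cont ?F" by (intro cont_scale cq continuous_intros)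
  have "?F z = (\<Sum>k\<le>N. z ^ k *s (coeff q k *s w))" for z
    unfolding poly_eq_sum_atMost[OF q(1)] by (simp add: vec_eq_iff sum_distrib_left mult_ac)
  then have "vpoly N ?F" by (rule vpolyI)
  then obtain d where d: "\<And>z. ?F z = (\<Sum>j\<le>N. P j z *v d j)" using lead_inj_and_span by blast
  have "form ?F ?F = form ?F (\<lambda>z. \<Sum>j\<le>N. P j z *v d j)" by (simp only: d)
  also have "\<dots> = (\<Sum>j\<le>N. form ?F (\<lambda>z. P j z *v d j))"
    by (rule form_sum_right) (auto simp: cF cont_P)
  also have "\<dots> = (\<Sum>j\<le>N. cdot (d j) (d j))"
  proof (rule sum.cong[OF refl])
    fix j assume j: "j \<in> {..N}"
    have "form ?F (\<lambda>z. P j z *v d j) = cnj (form (\<lambda>z. P j z *v d j) ?F)" by (rule form_cnj[OF cont_P cF])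
    also have "\<dots> = cnj (cdot (d j) (d j))" using j by (simp only: d form_P_sum) simp
    finally show "form ?F (\<lambda>z. P j z *v d j) = cdot (d j) (d j)" by (simp add: cnj_cdot)
  qed
  finally have "Re (form ?F ?F) = (\<Sum>j\<le>N. (norm (d j))\<^sup>2)" by (simp add: cdot_self)
  then have dle: "(\<Sum>j\<le>N. (norm (d j))\<^sup>2) \<le> (norm w)\<^sup>2" using form_scalar_le[OF cq q(2), of w] by simp
  have "poly q z * of_real ((norm w)\<^sup>2) = cdot w (?F z)" by (simp add: cdot_scale_right cdot_self)
  also have "\<dots> = (\<Sum>j\<le>N. cdot (\<phi> z w j) (d j))" unfolding d by (simp add: cdot_sum_right cdot_P)
  finally have "cmod (poly q z) * (norm w)\<^sup>2 = cmod (\<Sum>j\<le>N. cdot (\<phi> z w j) (d j))"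
    by (metis norm_mult norm_of_real abs_of_nonneg zero_le_power2)
  also have "\<dots> \<le> (\<Sum>j\<le>N. norm (\<phi> z w j) * norm (d j))"
    by (rule order_trans[OF norm_sum]) (intro sum_mono cmod_cdot_le)
  finally have "(cmod (poly q z) * (norm w)\<^sup>2)\<^sup>2 \<le> (\<Sum>j\<le>N. norm (\<phi> z w j) * norm (d j))\<^sup>2"
    by (rule power_mono) simp
  also have "\<dots> \<le> K z w N * (\<Sum>j\<le>N. (norm (d j))\<^sup>2)"
    unfolding K_def by (rule Cauchy_Schwarz_ineq_sum)
  also have "\<dots> \<le> K z w N * (norm w)\<^sup>2" by (rule mult_left_mono[OF dle K_nonneg])
  finally have "(norm w)\<^sup>2 * ((cmod (poly q z))\<^sup>2 * (norm w)\<^sup>2) \<le> (norm w)\<^sup>2 * K z w N"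
    by (simp add: power_mult_distrib power2_eq_square mult_ac)
  then show ?thesis using False by (subst (asm) mult_le_cancel_left_pos) auto
qed

lemma norm_adjoint_P_ge:
  assumes z: "Im z \<noteq> 0" and q: "degree q \<le> N" "\<And>x. x \<in> matrix_supp \<mu> \<Longrightarrow> cmod (poly q (of_real x)) \<le> 1"
  shows "\<bar>Im z\<bar> / a * cmod (poly q z) * norm w \<le> norm (hermitian_adjoint (P (Suc N) z) *v w)"
proof -
  have "(\<bar>Im z\<bar> / a * cmod (poly q z) * norm w)\<^sup>2 = (\<bar>Im z\<bar> / a)\<^sup>2 * ((cmod (poly q z))\<^sup>2 * (norm w)\<^sup>2)"
    by (simp add: power_mult_distrib power_divide)
  also have "\<dots> \<le> (\<bar>Im z\<bar> / a)\<^sup>2 * K z w N" by (intro mult_left_mono K_ge q) auto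
  also have "\<dots> \<le> (norm (\<phi> z w (Suc N)))\<^sup>2" by (rule phi_Suc_ge[OF z])
  finally show ?thesis unfolding \<phi>_def by (rule power2_le_imp_le) simp
qed

text \<open>
  If the vector of index \<open>N + 1\<close> vanishes, the boundary term in the Christoffel-Darboux identity
  vanishes too, and \<open>z\<close> is the Rayleigh quotient of a hermitian block tridiagonal matrix whose three
  diagonals have blocks of norm at most \<open>a\<close>.
\<close>

lemma zero_real_bounded:
  assumes w: "w \<noteq> 0" "\<phi> z w (Suc N) = 0"
  shows "Im z = 0" "\<bar>Re z\<bar> \<le> 3 * a"
proof -
  have Kpos: "0 < K z w N"
  proof -
    have "(norm (\<phi> z w 0))\<^sup>2 \<le> K z w N" unfolding K_def by (rule member_le_sum) auto
    moreover have "0 < (norm (\<phi> z w 0))\<^sup>2" using w by (simp add: \<phi>_0)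
    ultimately show ?thesis by linarith
  qed
  have "\<alpha> z w N = 0" by (simp add: \<alpha>_def w)
  then have e: "z * of_real (K z w N) = of_real ((\<Sum>n\<le>N. Re (\<beta> z w n)) + 2 * (\<Sum>n<N. Re (\<alpha> z w n)))"
    using christoffel_darboux[of z w N] by simp
  show "Im z = 0" using arg_cong[OF e, of Im] Kpos by simp
  have "\<bar>Re z\<bar> * K z w N = \<bar>(\<Sum>n\<le>N. Re (\<beta> z w n)) + 2 * (\<Sum>n<N. Re (\<alpha> z w n))\<bar>"
  proof -
    have "Re z * K z w N = (\<Sum>n\<le>N. Re (\<beta> z w n)) + 2 * (\<Sum>n<N. Re (\<alpha> z w n))"
      using arg_cong[OF e, of Re] by simp
    then show ?thesis using Kpos by (metis abs_mult abs_of_pos)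
  qed
  also have "\<dots> \<le> (\<Sum>n\<le>N. a * (norm (\<phi> z w n))\<^sup>2) + (\<Sum>n<N. a * ((norm (\<phi> z w n))\<^sup>2 + (norm (\<phi> z w (Suc n)))\<^sup>2))"
  proof -
    have "\<bar>\<Sum>n\<le>N. Re (\<beta> z w n)\<bar> \<le> (\<Sum>n\<le>N. a * (norm (\<phi> z w n))\<^sup>2)"
      by (rule order_trans[OF sum_abs sum_mono]) (metis abs_Re_le_cmod beta_le order_trans)
    moreover have "\<bar>2 * (\<Sum>n<N. Re (\<alpha> z w n))\<bar> \<le> (\<Sum>n<N. a * ((norm (\<phi> z w n))\<^sup>2 + (norm (\<phi> z w (Suc n)))\<^sup>2))"
      unfolding sum_distrib_left
    proof (rule order_trans[OF sum_abs sum_mono])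
      fix n show "\<bar>2 * Re (\<alpha> z w n)\<bar> \<le> a * ((norm (\<phi> z w n))\<^sup>2 + (norm (\<phi> z w (Suc n)))\<^sup>2)"
        using alpha_le[of 1 z w n] abs_Re_le_cmod[of "\<alpha> z w n"] by simp
    qed
    ultimately show ?thesis by linarith
  qed
  also have "\<dots> \<le> a * K z w N + a * (K z w N + K z w N)"
  proof -
    have "(\<Sum>n<N. (norm (\<phi> z w n))\<^sup>2) \<le> K z w N" unfolding K_def by (rule sum_mono2) auto
    moreover have "(\<Sum>n<N. (norm (\<phi> z w (Suc n)))\<^sup>2) \<le> K z w N" unfolding K_def
      by (subst sum.atMost_shift) simp
    ultimately show ?thesis using a_pos
      by (auto simp: sum_distrib_left[symmetric] sum.distrib K_def[symmetric] intro!: add_mono)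
  qed
  finally have "\<bar>Re z\<bar> * K z w N \<le> (3 * a) * K z w N" by simp
  then show "\<bar>Re z\<bar> \<le> 3 * a" using Kpos by simp
qed

end

section \<open>Determinants and their zeros\<close>

text \<open>
  The inverse matrix has entries of modulus at most \<open>1 / c\<close>; bound its determinant by the Leibniz
  formula. The factorial is harmless, as it does not depend on the degree of the polynomials.
\<close>

lemma det_ge_of_norm_ge:
  fixes M :: "complex^'l^'l::finite"
  assumes c: "0 < c" and le: "\<And>w. c * norm w \<le> norm (M *v w)"
  shows "c ^ CARD('l) / fact CARD('l) \<le> cmod (det M)"
proof -
  have "v = 0" if "M *v v = 0" for v
    using le[of v] c that by (simp add: mult_le_0_iff)
  then obtain N where N: "M ** N = mat 1" by (rule inj_matrix_vector_mult_imp_right_inverse) auto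
  have entry: "cmod (N $ i $ j) \<le> 1 / c" for i j
  proof -
    have "c * cmod (N $ i $ j) \<le> c * norm (N *v axis j 1)"
      using Finite_Cartesian_Product.norm_nth_le[of "N *v axis j 1" i] c by (simp add: matrix_mult_axis_nth)
    also have "\<dots> \<le> norm (M *v (N *v axis j 1))" by (rule le)
    also have "M *v (N *v axis j 1) = axis j 1" by (simp add: matrix_vector_mul_assoc N)
    also have "norm (axis j 1 :: complex^'l) = 1" by (simp add: norm_axis_1)
    finally show ?thesis using c by (simp add: field_simps)
  qed
  let ?Q = "{q. q permutes (UNIV :: 'l set)}"
  have "cmod (det N) \<le> (\<Sum>q\<in>?Q. (1 / c) ^ CARD('l))"
    unfolding det_def
  proof (rule order_trans[OF norm_sum sum_mono])
    fix q assume "q \<in> ?Q"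
    have "cmod (of_int (sign q) * (\<Prod>i\<in>UNIV. N $ i $ q i)) = (\<Prod>i\<in>UNIV. cmod (N $ i $ q i))"
      by (simp add: norm_mult prod_norm sign_def)
    also have "\<dots> \<le> (\<Prod>i\<in>(UNIV :: 'l set). 1 / c)" by (rule prod_mono) (simp add: entry)
    finally show "cmod (of_int (sign q) * (\<Prod>i\<in>UNIV. N $ i $ q i)) \<le> (1 / c) ^ CARD('l)" by simp
  qed
  also have "\<dots> = fact CARD('l) / c ^ CARD('l)"
    by (simp add: card_permutations power_one_over divide_inverse power_inverse)
  finally have dN: "cmod (det N) \<le> fact CARD('l) / c ^ CARD('l)" .
  have "det M * det N = 1" using det_mul[of M N] N by simp
  then have "cmod (det M) * cmod (det N) = 1" by (metis norm_mult norm_one)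
  then have "1 \<le> cmod (det M) * (fact CARD('l) / c ^ CARD('l))"
    using mult_left_mono[OF dN norm_ge_zero[of "det M"]] by simp
  then show ?thesis using c by (simp add: field_simps)
qed

lemma det_hermitian_adjoint: "det (hermitian_adjoint M) = cnj (det M)" for M :: "complex^'l^'l::finite"
proof -
  have "hermitian_adjoint M = transpose (\<chi> i j. cnj (M $ i $ j))"
    by (simp add: hermitian_adjoint_def transpose_def)
  then have "det (hermitian_adjoint M) = det (\<chi> i j. cnj (M $ i $ j))" by simp
  also have "\<dots> = cnj (det M)" by (simp add: det_def)
  finally show ?thesis .
qed

lemma poly_det: "poly (det Q) z = det (eval_mp Q z)"
  by (simp add: det_def eval_mp_def poly_sum poly_prod)

lemma eval_left_mp: "eval_mp (left_mp f) z = hermitian_adjoint (eval_mp f (cnj z))"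
proof -
  have "poly (map_poly cnj q) z = cnj (poly q (cnj z))" for q
    using poly_cnj[of q "cnj z"] by simp
  then show ?thesis by (simp add: eval_mp_def left_mp_def hermitian_adjoint_def vec_eq_iff)
qed

lemma coeff_prod_degree_le:
  fixes f :: "'i \<Rightarrow> complex poly"
  assumes "finite S" "\<And>i. i \<in> S \<Longrightarrow> degree (f i) \<le> n"
  shows "degree (prod f S) \<le> n * card S \<and> coeff (prod f S) (n * card S) = (\<Prod>i\<in>S. coeff (f i) n)"
  using assms
proof (induction S rule: finite_induct)
  case (insert x S)
  have mult: "coeff (p * q) (i + j) = coeff p i * coeff q j" if "degree p \<le> i" "degree q \<le> j" for p q :: "complex poly" and i j
  proof (cases "degree p = i \<and> degree q = j")
    case True then show ?thesis using coeff_mult_degree_sum by blast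
  next
    case False
    then have "degree p < i \<or> degree q < j" using that by auto
    moreover have "degree (p * q) < i + j" using degree_mult_le[of p q] that False by linarith
    ultimately show ?thesis by (auto simp: coeff_eq_0)
  qed
  have IH: "degree (prod f S) \<le> n * card S" "coeff (prod f S) (n * card S) = (\<Prod>i\<in>S. coeff (f i) n)"
    using insert by auto
  have "degree (f x * prod f S) \<le> n + n * card S"
    using degree_mult_le[of "f x" "prod f S"] IH(1) insert.prems[of x] by simp
  moreover have "coeff (f x * prod f S) (n + n * card S) = coeff (f x) n * (\<Prod>i\<in>S. coeff (f i) n)"
    using mult[of "f x" n "prod f S" "n * card S"] IH insert.prems by simp
  ultimately show ?case using insert.hyps by simp
qed simp

text \<open>
  In the Leibniz formula every product has degree at most \<open>n l\<close>, and its coefficient of that order is the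
  product of the coefficients of order \<open>n\<close>.
\<close>

lemma degree_det_le:
  fixes Q :: "'l::finite mat_poly"
  assumes "\<And>i j. degree (Q $ i $ j) \<le> n"
  shows "degree (det Q) \<le> n * CARD('l)" "coeff (det Q) (n * CARD('l)) = det (\<chi> i j. coeff (Q $ i $ j) n)"
proof -
  have pr: "degree (\<Prod>i\<in>UNIV. Q $ i $ q i) \<le> n * CARD('l)"
    "coeff (\<Prod>i\<in>UNIV. Q $ i $ q i) (n * CARD('l)) = (\<Prod>i\<in>UNIV. coeff (Q $ i $ q i) n)" for q :: "'l \<Rightarrow> 'l"
    using coeff_prod_degree_le[of UNIV "\<lambda>i. Q $ i $ q i" n] assms by auto
  have s: "of_int (sign q) * f = smult (of_int (sign q)) f" for q :: "'l \<Rightarrow> 'l" and f :: "complex poly"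
    by (simp add: sign_def)
  show "degree (det Q) \<le> n * CARD('l)"
    unfolding det_def s by (rule degree_sum_le) (auto simp: pr(1))
  show "coeff (det Q) (n * CARD('l)) = det (\<chi> i j. coeff (Q $ i $ j) n)"
    unfolding det_def s coeff_sum coeff_smult pr(2) by simp
qed

text \<open>
  The potential of the zeros is read off from the factorisation of the polynomial. All of its zeros
  being real, the real zeros alone account for the full degree, so the total mass is 1.
\<close>

lemma real_zero_counting:
  fixes D :: "complex poly"
  assumes D: "D \<noteq> 0" "degree D = m" "m > 0" and zeros: "\<And>z. poly D z = 0 \<Longrightarrow> Im z = 0 \<and> \<bar>Re z\<bar> \<le> B"
  defines "Z \<equiv> distr (point_measure {x::real. poly D (of_real x) = 0}
        (\<lambda>x. ennreal (real (order (of_real x) D) / real m))) borel (\<lambda>x. x)"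
  shows "real_distribution Z" "AE x in Z. \<bar>x\<bar> \<le> B"
    "Im z \<noteq> 0 \<Longrightarrow> log_pot Z z = (ln (cmod (poly D z)) - ln (cmod (lead_coeff D))) / real m"
proof -
  let ?X = "{x::real. poly D (of_real x) = 0}"
  let ?o = "\<lambda>x::real. order (of_real x :: complex) D"
  let ?P = "point_measure ?X (\<lambda>x. ennreal (real (?o x) / real m))"
  have img: "{z. poly D z = 0} = of_real ` ?X"
  proof (intro set_eqI iffI)
    fix z assume "z \<in> {z. poly D z = 0}"
    then have "z = of_real (Re z)" "poly D z = 0" using zeros[of z] by (auto simp: complex_eq_iff)
    then show "z \<in> of_real ` ?X" by (metis (mono_tags, lifting) imageI mem_Collect_eq)
  qed auto
  have inj: "inj_on (of_real :: real \<Rightarrow> complex) ?X" by (auto simp: inj_on_def)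
  have fin: "finite ?X"
    using poly_roots_finite[OF D(1)] unfolding img by (rule finite_imageD[OF _ inj])
  have dec: "D = smult (lead_coeff D) (\<Prod>x\<in>?X. [:- of_real x, 1:] ^ ?o x)"
    using complex_poly_decompose[of D] unfolding img by (simp add: prod.reindex[OF inj])
  have deg: "(\<Sum>x\<in>?X. ?o x) = m"
  proof -
    have "degree D = (\<Sum>x\<in>?X. degree ([:- of_real x, 1:] ^ ?o x :: complex poly))"
      using D(1) by (subst dec) (simp add: degree_prod_sum_eq)
    also have "\<dots> = (\<Sum>x\<in>?X. ?o x)" by (intro sum.cong refl) (simp add: degree_power_eq)
    finally show ?thesis using D(2) by simp
  qed
  have sum1: "(\<Sum>x\<in>?X. real (?o x) / real m) = 1"
  proof -
    have "(\<Sum>x\<in>?X. real (?o x) / real m) = real (\<Sum>x\<in>?X. ?o x) / real m"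
      by (simp add: sum_divide_distrib)
    then show ?thesis using deg D(3) by simp
  qed
  have meas: "(\<lambda>x. x) \<in> measurable ?P borel" by (simp add: measurable_def sets_point_measure space_point_measure)
  have pP: "prob_space ?P"
  proof (rule prob_spaceI)
    have "emeasure ?P ?X = (\<Sum>x\<in>?X. ennreal (real (?o x) / real m))"
      by (rule emeasure_point_measure_finite[OF fin]) simp
    also have "\<dots> = 1" by (simp add: sum_ennreal sum1)
    finally show "emeasure ?P (space ?P) = 1" by (simp add: space_point_measure)
  qed
  have "prob_space Z" unfolding Z_def by (rule prob_space.prob_space_distr[OF pP meas])
  then show "real_distribution Z" by (simp add: real_distribution_def real_distribution_axioms_def Z_def)
  have bX: "\<bar>x\<bar> \<le> B" if "x \<in> ?X" for x using zeros[of "of_real x"] that by simp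
  show "AE x in Z. \<bar>x\<bar> \<le> B" unfolding Z_def
    by (subst AE_distr_iff[OF meas]) (use bX in \<open>auto simp: space_point_measure intro!: AE_I2\<close>)
  assume z: "Im z \<noteq> 0"
  have nz: "z - of_real x \<noteq> 0" for x using z by (auto simp: complex_eq_iff)
  have "log_pot Z z = log_pot ?P z"
    unfolding Z_def by (rule integral_distr[OF meas]) simp
  also have "\<dots> = (\<Sum>x\<in>?X. real (?o x) / real m * ln (cmod (z - of_real x)))"
    by (subst lebesgue_integral_point_measure_finite[OF fin]) auto
  also have "\<dots> = (\<Sum>x\<in>?X. real (?o x) * ln (cmod (z - of_real x))) / real m"
    by (simp add: sum_divide_distrib)
  also have "(\<Sum>x\<in>?X. real (?o x) * ln (cmod (z - of_real x))) = ln (cmod (poly D z)) - ln (cmod (lead_coeff D))"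
  proof -
    have lc: "0 < cmod (lead_coeff D)" using D(1) by simp
    have "poly D z = lead_coeff D * (\<Prod>x\<in>?X. (z - of_real x) ^ ?o x)"
      by (subst dec) (simp add: poly_prod poly_power)
    then have "cmod (poly D z) = cmod (lead_coeff D) * (\<Prod>x\<in>?X. cmod (z - of_real x) ^ ?o x)"
      by (simp add: norm_mult prod_norm[symmetric] norm_power)
    moreover have pos: "0 < cmod (z - of_real x) ^ ?o x" for x using nz[of x] by simp
    moreover have "ln (\<Prod>x\<in>?X. cmod (z - of_real x) ^ ?o x) = (\<Sum>x\<in>?X. ln (cmod (z - of_real x) ^ ?o x))"
      by (rule ln_prod[OF fin]) (metis pos less_irrefl)
    moreover have "0 < (\<Prod>x\<in>?X. cmod (z - of_real x) ^ ?o x)" by (rule prod_pos) (rule pos)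
    moreover have "ln (cmod (z - of_real x) ^ ?o x) = real (?o x) * ln (cmod (z - of_real x))" for x
      using nz[of x] by (simp add: ln_realpow)
    ultimately show ?thesis using lc by (simp only: ln_mult_pos)
  qed
  finally show "log_pot Z z = (ln (cmod (poly D z)) - ln (cmod (lead_coeff D))) / real m" .
qed

context orthonormal_matrix_polynomials
begin

definition D :: "nat \<Rightarrow> complex poly" where "D n = det (left_mp (p n))"

lemma poly_D: "poly (D n) z = det (hermitian_adjoint (P n (cnj z)))"
  by (simp add: D_def poly_det eval_left_mp P_def)

text \<open>
  The product of the Jacobi matrices telescopes against the leading coefficients.
\<close>

lemma det_lead: "det (lead n) * cnj (det (jacobi_prod \<mu> p n)) = 1"
proof (induction n)
  case 0 then show ?case by (simp add: lead_0)
next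
  case (Suc n)
  have "det (lead n) = det (lead (Suc n)) * cnj (det (A (Suc n)))"
    unfolding lead_Suc[of n] by (simp only: det_mul det_hermitian_adjoint)
  then show ?case using Suc by (simp add: det_mul mult_ac)
qed

lemma degree_D: "degree (D n) = n * CARD('l)" and lead_coeff_D: "cmod (lead_coeff (D n)) = 1 / cmod (det (jacobi_prod \<mu> p n))"
proof -
  have dl: "degree (left_mp (p n) $ i $ j) \<le> n" for i j
    unfolding left_mp_def using degree_p[of n j i] by (simp add: degree_map_poly)
  have "(\<chi> i j. coeff (left_mp (p n) $ i $ j) n) = hermitian_adjoint (lead n)"
    by (simp add: left_mp_def hermitian_adjoint_def lead_def vec_eq_iff coeff_map_poly)
  then have co: "coeff (D n) (n * CARD('l)) = cnj (det (lead n))"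
    unfolding D_def degree_det_le(2)[OF dl] by (simp add: det_hermitian_adjoint)
  have ne: "det (lead n) \<noteq> 0" using det_lead[of n] by auto
  have "n * CARD('l) \<le> degree (D n)" by (rule le_degree) (simp add: co ne)
  then show dg: "degree (D n) = n * CARD('l)" using degree_det_le(1)[OF dl] by (simp add: D_def)
  have "cmod (det (lead n)) * cmod (det (jacobi_prod \<mu> p n)) = 1"
    using arg_cong[OF det_lead[of n], of cmod] by (simp add: norm_mult)
  then show "cmod (lead_coeff (D n)) = 1 / cmod (det (jacobi_prod \<mu> p n))"
    unfolding dg co by (auto simp: divide_simps)
qed

lemma det_jacobi_prod_nonzero: "det (jacobi_prod \<mu> p n) \<noteq> 0"
  using det_lead[of n] by auto

lemma zeros_D:
  assumes "poly (D (Suc N)) z = 0" shows "Im z = 0 \<and> \<bar>Re z\<bar> \<le> 3 * a"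
proof -
  let ?M = "hermitian_adjoint (P (Suc N) (cnj z))"
  have "\<exists>w. w \<noteq> 0 \<and> ?M *v w = 0"
  proof (rule ccontr)
    assume "\<not> ?thesis"
    then obtain R where "?M ** R = mat 1"
      using inj_matrix_vector_mult_imp_right_inverse[of ?M] by metis
    then have "det ?M * det R = 1" using det_mul[of ?M R] by simp
    then show False using assms by (simp add: poly_D)
  qed
  then obtain w where "w \<noteq> 0" "\<phi> (cnj z) w (Suc N) = 0" unfolding \<phi>_def by blast
  from zero_real_bounded[OF this] show ?thesis by simp
qed

lemma zero_counting:
  shows "real_distribution (zero_counting_measure p (Suc N))"
    "AE x in zero_counting_measure p (Suc N). \<bar>x\<bar> \<le> 3 * a"
    "Im z \<noteq> 0 \<Longrightarrow> log_pot (zero_counting_measure p (Suc N)) z =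
       (ln (cmod (poly (D (Suc N)) z)) + ln (cmod (det (jacobi_prod \<mu> p (Suc N))))) / real (Suc N * CARD('l))"
proof -
  have D0: "D (Suc N) \<noteq> 0" using degree_D[of "Suc N"] by auto
  have m: "0 < Suc N * CARD('l)" by simp
  have Z: "zero_counting_measure p (Suc N) = distr (point_measure {x::real. poly (D (Suc N)) (of_real x) = 0}
        (\<lambda>x. ennreal (real (order (of_real x) (D (Suc N))) / real (Suc N * CARD('l))))) borel (\<lambda>x. x)"
    by (simp only: zero_counting_measure_def D_def)
  note R = real_zero_counting[OF D0 degree_D m zeros_D, folded Z]
  show "real_distribution (zero_counting_measure p (Suc N))" by (rule R(1))
  show "AE x in zero_counting_measure p (Suc N). \<bar>x\<bar> \<le> 3 * a" by (rule R(2))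
  assume "Im z \<noteq> 0"
  moreover have "ln (cmod (lead_coeff (D (Suc N)))) = - ln (cmod (det (jacobi_prod \<mu> p (Suc N))))"
    unfolding lead_coeff_D using det_jacobi_prod_nonzero by (simp add: ln_div)
  ultimately show "log_pot (zero_counting_measure p (Suc N)) z =
       (ln (cmod (poly (D (Suc N)) z)) + ln (cmod (det (jacobi_prod \<mu> p (Suc N))))) / real (Suc N * CARD('l))"
    using R(3) by simp
qed

text \<open>
  The polynomial \<open>q\<close> is evaluated at the conjugate point because the left polynomial at \<open>z\<close> is the
  adjoint of the right one at the conjugate of \<open>z\<close>.
\<close>

lemma ln_cmod_D_ge:
  assumes z: "Im z \<noteq> 0" and q: "degree q \<le> N" "\<And>x. x \<in> matrix_supp \<mu> \<Longrightarrow> cmod (poly q (of_real x)) \<le> 1"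
    and nz: "poly q (cnj z) \<noteq> 0"
  shows "real CARD('l) * (ln (\<bar>Im z\<bar> / a) + ln (cmod (poly q (cnj z)))) - ln (fact CARD('l)) \<le> ln (cmod (poly (D (Suc N)) z))"
proof -
  let ?c = "\<bar>Im z\<bar> / a * cmod (poly q (cnj z))"
  have c: "0 < ?c" using z nz a_pos by simp
  have "?c ^ CARD('l) / fact CARD('l) \<le> cmod (poly (D (Suc N)) z)"
    unfolding poly_D
    by (rule det_ge_of_norm_ge[OF c]) (use norm_adjoint_P_ge[of "cnj z", OF _ q] z in simp)
  then have "ln (?c ^ CARD('l) / fact CARD('l)) \<le> ln (cmod (poly (D (Suc N)) z))"
    using c by (intro ln_mono) auto
  moreover have "ln (c ^ CARD('l) / fact CARD('l)) = real CARD('l) * ln c - ln (fact CARD('l))" if "0 < c" for c :: real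
    using that by (simp add: ln_div ln_realpow)
  note this[OF c]
  moreover have "ln ?c = ln (\<bar>Im z\<bar> / a) + ln (cmod (poly q (cnj z)))"
    using z nz a_pos by (intro ln_mult_pos) auto
  ultimately show ?thesis by simp
qed

end

context positive_capacity
begin

section \<open>Convergence of the zero counting measures\<close>

lemma fekete_energy_tendsto: "(\<lambda>n. fekete_energy (n + 2)) \<longlonglongrightarrow> V"
proof (rule order_tendstoI)
  fix c assume "c < V" then show "\<forall>\<^sub>F n in sequentially. c < fekete_energy (n + 2)"
    by (rule fekete_energy_eventually_gt)
next
  fix c assume c: "V < c"
  have "(\<lambda>n. ln 2 / (real (n + 2) * (real (n + 2) - 1))) \<longlonglongrightarrow> 0" by real_asymp
  then have "(\<lambda>n. V + ln 2 / (real (n + 2) * (real (n + 2) - 1))) \<longlonglongrightarrow> V + 0" by (intro tendsto_intros)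
  then have "\<forall>\<^sub>F n in sequentially. V + ln 2 / (real (n + 2) * (real (n + 2) - 1)) < c"
    by (rule order_tendstoD) (use c in simp)
  then show "\<forall>\<^sub>F n in sequentially. fekete_energy (n + 2) < c"
  proof eventually_elim
    case (elim n)
    have "fekete_energy (n + 2) \<le> V + ln 2 / (real (n + 2) * (real (n + 2) - 1))" by (rule fekete_energy_le) simp
    with elim show ?case by linarith
  qed
qed

lemma log_capacity_eq: "log_capacity E = exp (- V)"
  using finite_min by (simp add: log_capacity_def V_def)

text \<open>
  The polynomial with the near-Fekete points as zeros is at most \<open>exp (- m * fekete_level m)\<close> on \<open>E\<close>.
\<close>

definition fekete_level :: "nat \<Rightarrow> real" where
  "fekete_level m = fekete_energy m - ln 2 / (real m - 1)"

definition fekete_poly :: "nat \<Rightarrow> complex poly" where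
  "fekete_poly m = smult (of_real (exp (real m * fekete_level m))) (\<Prod>j<m. [:- of_real (fekete m j), 1:])"

lemma degree_fekete_poly: "degree (fekete_poly m) \<le> m"
proof -
  have "degree (\<Prod>j<m. [:- of_real (fekete m j), 1:] :: complex poly) = m"
    by (subst degree_prod_sum_eq) auto
  then show ?thesis unfolding fekete_poly_def using degree_smult_le by metis
qed

lemma cmod_fekete_poly:
  "cmod (poly (fekete_poly m) z) = exp (real m * fekete_level m) * (\<Prod>j<m. cmod (z - of_real (fekete m j)))"
  by (simp add: fekete_poly_def poly_prod norm_mult prod_norm[symmetric])

lemma fekete_poly_le_1:
  assumes "m \<ge> 2" "x \<in> E" shows "cmod (poly (fekete_poly m) (of_real x)) \<le> 1"
proof -
  have "cmod (of_real x - of_real y) = \<bar>x - y\<bar>" for y by (metis norm_of_real of_real_diff)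
  then have "cmod (poly (fekete_poly m) (of_real x)) = exp (real m * fekete_level m) * (\<Prod>j<m. \<bar>x - fekete m j\<bar>)"
    by (simp add: cmod_fekete_poly)
  also have "\<dots> \<le> exp (real m * fekete_level m) * exp (- (real m * fekete_level m))"
    using fekete_polynomial_le[OF assms] unfolding fekete_level_def by (intro mult_left_mono) auto
  also have "\<dots> = 1" by (simp add: exp_minus)
  finally show ?thesis .
qed

lemma fekete_poly_nonreal:
  assumes "Im z \<noteq> 0"
  shows "poly (fekete_poly m) (cnj z) \<noteq> 0"
    "ln (cmod (poly (fekete_poly m) (cnj z))) = real m * fekete_level m + (\<Sum>j<m. ln (cmod (z - of_real (fekete m j))))"
proof -
  have pos: "0 < cmod (z - of_real x)" for x using assms by (auto simp: complex_eq_iff)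
  have "cmod (cnj z - of_real x) = cmod (z - of_real x)" for x
    by (metis complex_cnj_complex_of_real complex_cnj_diff complex_mod_cnj)
  then have e: "cmod (poly (fekete_poly m) (cnj z)) = exp (real m * fekete_level m) * (\<Prod>j<m. cmod (z - of_real (fekete m j)))"
    by (simp add: cmod_fekete_poly)
  moreover have p: "0 < (\<Prod>j<m. cmod (z - of_real (fekete m j)))" by (intro prod_pos) (use pos in auto)
  ultimately have "0 < cmod (poly (fekete_poly m) (cnj z))" by simp
  then show "poly (fekete_poly m) (cnj z) \<noteq> 0" by simp
  have "ln (\<Prod>j<m. cmod (z - of_real (fekete m j))) = (\<Sum>j<m. ln (cmod (z - of_real (fekete m j))))"
    by (rule ln_prod) (use pos in auto)
  then show "ln (cmod (poly (fekete_poly m) (cnj z))) = real m * fekete_level m + (\<Sum>j<m. ln (cmod (z - of_real (fekete m j))))"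
    unfolding e using p by (simp only: ln_mult_pos exp_gt_zero ln_exp)
qed

lemma fekete_level_tendsto: "(\<lambda>n. fekete_level (n + 2)) \<longlonglongrightarrow> V"
proof -
  have "(\<lambda>n. ln 2 / (real (n + 2) - 1)) \<longlonglongrightarrow> 0" by real_asymp
  from tendsto_diff[OF fekete_energy_tendsto this] show ?thesis by (simp add: fekete_level_def)
qed

end

theorem theorem5p2:
  fixes \<mu> :: "real set \<Rightarrow> complex^'l^'l::finite"
    and p :: "nat \<Rightarrow> 'l mat_poly"
    and E :: "real set"
  assumes "matrix_measure \<mu>"
    and "\<mu> UNIV = mat 1"
    and "E = matrix_supp \<mu>"
    and "compact E"
    and "nontrivial_mm \<mu>"
    and "right_orthonormal \<mu> p"
    and "regular_mm \<mu> p"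
    and "0 < log_capacity E"
  shows "weak_conv_m (zero_counting_measure p) (equilibrium_measure E)"
proof -
  obtain a where a: "0 < a" "\<And>x. x \<in> E \<Longrightarrow> \<bar>x\<bar> \<le> a"
    using compact_imp_bounded[OF \<open>compact E\<close>] by (auto simp: bounded_pos)
  interpret orthonormal_matrix_polynomials \<mu> a p
    by unfold_locales (use assms a in auto)
  interpret positive_capacity E "3 * a / 2"
  proof
    show "\<bar>x\<bar> \<le> 2 * (3 * a / 2)" if "x \<in> E" for x using a(1) a(2)[OF that] by simp
    show "min_log_energy E \<noteq> \<infinity>" using \<open>0 < log_capacity E\<close> by (auto simp: log_capacity_def)
  qed (use a \<open>compact E\<close> in auto)
  \<comment> \<open>The polynomial of degree \<open>n + 3\<close> is compared with \<open>n + 2\<close> near-Fekete points. The first three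
    counting measures are left out; the one for degree 0 is not even a probability measure.\<close>
  let ?Z = "\<lambda>n. zero_counting_measure p (Suc (n + 2))"
  have "weak_conv_m ?Z (equilibrium_measure E)"
  proof (rule weak_conv_equilibrium_measureI)
    show "real_distribution (?Z n)" for n by (rule zero_counting(1))
    show "AE x in ?Z n. \<bar>x\<bar> \<le> 2 * (3 * a / 2)" for n using zero_counting(2)[of "n + 2"] by simp
    fix z :: complex assume z: "Im z \<noteq> 0"
    let ?l = "real CARD('l)"
    let ?pot = "log_pot (equilibrium_measure E) z"
    let ?avg = "\<lambda>n. (\<Sum>i<n + 2. ln (cmod (z - of_real (fekete (n + 2) i)))) / real (n + 2)"
    let ?jac = "\<lambda>n. ln (root n (cmod (det (jacobi_prod \<mu> p n))))"
    define c where "c = ln (\<bar>Im z\<bar> / a) - ln (fact CARD('l)) / ?l"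
    \<comment> \<open>The lower bound for the potential: a term from the constants, the normalised Fekete polynomial,
      and the leading coefficient. The last two contribute \<open>V\<close> with opposite signs in the limit.\<close>
    define b where "b n = c / real (Suc (n + 2)) + real (n + 2) / real (Suc (n + 2)) * (fekete_level (n + 2) + ?avg n)
      + ?jac (Suc (n + 2)) / ?l" for n
    have "b \<longlonglongrightarrow> 0 + 1 * (V + ?pot) + (- ?l * V) / ?l"
      unfolding b_def
    proof (intro tendsto_add tendsto_mult fekete_level_tendsto fekete_potential_tendsto z tendsto_divide tendsto_const)
      show "(\<lambda>n. c / real (Suc (n + 2))) \<longlonglongrightarrow> 0"
        by (rule real_tendsto_divide_at_top[OF tendsto_const]) real_asymp
      show "(\<lambda>n. real (n + 2) / real (Suc (n + 2))) \<longlonglongrightarrow> 1" by real_asymp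
      have "(\<lambda>n. root n (cmod (det (jacobi_prod \<mu> p n)))) \<longlonglongrightarrow> exp (- V) ^ CARD('l)"
        using \<open>regular_mm \<mu> p\<close> \<open>E = matrix_supp \<mu>\<close> unfolding regular_mm_def log_capacity_eq[symmetric] by simp
      then have "?jac \<longlonglongrightarrow> ln (exp (- V) ^ CARD('l))" by (intro tendsto_ln) auto
      also have "ln (exp (- V) ^ CARD('l)) = - ?l * V" by (simp add: ln_realpow)
      finally have "?jac \<longlonglongrightarrow> - ?l * V" .
      from LIMSEQ_ignore_initial_segment[OF this, of 3]
      show "(\<lambda>n. ?jac (Suc (n + 2))) \<longlonglongrightarrow> - ?l * V" by (simp add: numeral_3_eq_3)
    qed auto
    then have "b \<longlonglongrightarrow> ?pot" by simp
    moreover have "b n \<le> log_pot (?Z n) z" for n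
    proof -
      let ?N = "n + 2"
      let ?J = "ln (cmod (det (jacobi_prod \<mu> p (Suc ?N))))"
      have J: "?jac (Suc ?N) = ?J / real (Suc ?N)"
        using det_jacobi_prod_nonzero[of "Suc ?N"] by (intro ln_root) auto
      have "?l * (ln (\<bar>Im z\<bar> / a) + ln (cmod (poly (fekete_poly ?N) (cnj z)))) - ln (fact CARD('l)) \<le> ln (cmod (poly (D (Suc ?N)) z))"
        by (rule ln_cmod_D_ge[OF z degree_fekete_poly _ fekete_poly_nonreal(1)[OF z]])
          (use fekete_poly_le_1 \<open>E = matrix_supp \<mu>\<close> in auto)
      moreover have "ln (cmod (poly (fekete_poly ?N) (cnj z))) = real ?N * (fekete_level ?N + ?avg n)"
      proof -
        have "real ?N * u + v = real ?N * (u + v / real ?N)" for u v by (simp add: field_simps)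
        then show ?thesis unfolding fekete_poly_nonreal(2)[OF z] .
      qed
      ultimately have "?l * (ln (\<bar>Im z\<bar> / a) + real ?N * (fekete_level ?N + ?avg n)) - ln (fact CARD('l)) + ?J \<le> ln (cmod (poly (D (Suc ?N)) z)) + ?J"
        by (simp only: add_le_cancel_right)
      then have "(?l * (ln (\<bar>Im z\<bar> / a) + real ?N * (fekete_level ?N + ?avg n)) - ln (fact CARD('l)) + ?J) / real (Suc ?N * CARD('l))
         \<le> log_pot (?Z n) z"
        unfolding zero_counting(3)[OF z] by (rule divide_right_mono) simp
      also have "(?l * (ln (\<bar>Im z\<bar> / a) + real ?N * (fekete_level ?N + ?avg n)) - ln (fact CARD('l)) + ?J) / real (Suc ?N * CARD('l)) = b n"
      proof -
        have "(l * (u + m * v) - f + j) / (M * l) = (u - f / l) / M + m / M * v + j / M / l" if "l \<noteq> 0" "M \<noteq> 0" for l u m v f j M :: real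
          using that by (simp add: field_simps)
        from this[of ?l "real (Suc ?N)"] show ?thesis
          unfolding b_def c_def J of_nat_mult by simp
      qed
      finally show ?thesis .
    qed
    ultimately show "\<exists>b. b \<longlonglongrightarrow> ?pot \<and> (\<forall>\<^sub>F n in sequentially. b n \<le> log_pot (?Z n) z)"
      by (intro exI[of _ b]) auto
  qed
  then have "(\<lambda>n. cdf (zero_counting_measure p (n + 3)) x) \<longlonglongrightarrow> cdf (equilibrium_measure E) x"
    if "isCont (cdf (equilibrium_measure E)) x" for x
    using that by (simp add: weak_conv_m_def weak_conv_def numeral_3_eq_3)
  then show ?thesis unfolding weak_conv_m_def weak_conv_def
    by (auto intro: LIMSEQ_offset[of _ 3])
qed

end
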